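(* Let $n\ge1$, and let $\psi:\mathbb{R}^k\to\mathbb{R}$ be a smooth compactly supported cutoff with $\psi(\mathbf x)=1$ for $|\mathbf x|\le2$. Then the function $E_{K,B,\psi}1$ lies in $L^q(\mathbb{R}^{kn})$ for every $q>\frac{n(n+1)}{2}+1$.
   Context: Let $K$ be an algebraic number field of degree $k$ with $\mathbb{Q}$-basis $B=\{\omega_1,\dots,\omega_k\}$. Define rational polynomials $Q_{l,j}$ ($1\le l\le n$, $1\le j\le k$) by $(q_1\omega_1+\dots+q_k\omega_k)^l=\sum_{j=1}^kQ_{l,j}(q_1,\dots,q_k)\omega_j$ for all $q_1,\dots,q_k\in\mathbb{Q}$; view them as real polynomials on $\mathbb{R}^k$ and write $\vec{\mathbf Q}(\mathbf x)=(Q_{l,j}(\mathbf x))_{1\le l\le n,1\le j\le k}\in\mathbb{R}^{nk}$. For $g$ a function on $\mathbb{R}^k$, the extension operator is $E_{K,B,\psi}g(\vec{\boldsymbol\xi})=\int_{\mathbb{R}^k}\exp(2\pi i\,\vec{\boldsymbol\xi}\cdot\vec{\mathbf Q}(\mathbf x))\,g(\mathbf x)\psi(\mathbf x)\,d\mathbf x$ for $\vec{\boldsymbol\xi}\in\mathbb{R}^{nk}$ (usual dot product), and $E_{K,B,\psi}1$ is this with $g\equiv1$. *)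

theory Defs
  imports "HOL-Analysis.Analysis" "HOL-Library.Poly_Mapping"
begin

section \<open>Number fields and rational bases\<close>

global_interpretation rat_vs: vector_space "\<lambda>(q::rat) (x::'a::field_char_0). of_rat q * x"
  by unfold_locales (simp_all add: algebra_simps of_rat_add of_rat_mult)

text \<open>A number field is a subfield, of finite dimension over the rationals, of some ambient
  field of characteristic 0 (the ambient type itself is allowed).\<close>

definition number_field :: "'a::field_char_0 set \<Rightarrow> bool" where
  "number_field K \<longleftrightarrow>
     0 \<in> K \<and> 1 \<in> K \<and>
     (\<forall>x\<in>K. \<forall>y\<in>K. x + y \<in> K \<and> x - y \<in> K \<and> x * y \<in> K) \<and>
     (\<forall>x\<in>K. inverse x \<in> K) \<and>
     (\<exists>S. finite S \<and> rat_vs.span S = K)"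

text \<open>The basis is indexed by a finite type \<open>'k\<close>, so the degree of \<open>K\<close> is \<open>CARD('k)\<close>.\<close>

definition rat_basis :: "'a::field_char_0 set \<Rightarrow> ('k::finite \<Rightarrow> 'a) \<Rightarrow> bool" where
  "rat_basis K \<omega> \<longleftrightarrow>
     inj \<omega> \<and> rat_vs.independent (range \<omega>) \<and> rat_vs.span (range \<omega>) = K"


section \<open>Rational polynomials and the coordinates of powers\<close>

text \<open>A rational polynomial in variables indexed by \<open>'k\<close> is a finitely supported map from
  exponent vectors to coefficients; it is evaluated in any field of characteristic 0.\<close>

type_synonym 'k rat_mpoly = "('k \<Rightarrow>\<^sub>0 nat) \<Rightarrow>\<^sub>0 rat"

definition mpoly_eval :: "'k::finite rat_mpoly \<Rightarrow> ('k \<Rightarrow> 'b) \<Rightarrow> 'b::field_char_0" where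
  "mpoly_eval p x =
     (\<Sum>m\<in>Poly_Mapping.keys p.
        of_rat (Poly_Mapping.lookup p m) * (\<Prod>j\<in>UNIV. x j ^ Poly_Mapping.lookup m j))"

text \<open>When \<open>\<omega>\<close> is a basis, this determines \<open>Q l j\<close> uniquely for \<open>1 \<le> l \<le> n\<close>, since a rational
  polynomial vanishing at all rational points is zero; existence is shown below.\<close>

definition power_coordinates ::
    "('k::finite \<Rightarrow> 'a::field_char_0) \<Rightarrow> nat \<Rightarrow> (nat \<Rightarrow> 'k \<Rightarrow> 'k rat_mpoly) \<Rightarrow> bool" where
  "power_coordinates \<omega> n Q \<longleftrightarrow>
     (\<forall>l\<in>{1..n}. \<forall>q :: 'k \<Rightarrow> rat.
        (\<Sum>j\<in>UNIV. of_rat (q j) * \<omega> j) ^ l =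
        (\<Sum>j\<in>UNIV. of_rat (mpoly_eval (Q l j) q) * \<omega> j))"

lemma mpoly_eval_0 [simp]: "mpoly_eval 0 x = 0"
  by (simp add: mpoly_eval_def)

lemma mpoly_eval_add: "mpoly_eval (p + r) x = mpoly_eval p x + mpoly_eval r x"
  unfolding mpoly_eval_def
  by (rule setsum_keys_plus_distrib) (simp_all add: of_rat_add algebra_simps)

lemma mpoly_eval_sum: "mpoly_eval (\<Sum>i\<in>A. p i) x = (\<Sum>i\<in>A. mpoly_eval (p i) x)"
  by (induction A rule: infinite_finite_induct) (simp_all add: mpoly_eval_add)

lemma mpoly_eval_single:
  "mpoly_eval (Poly_Mapping.single m c) x =
     of_rat c * (\<Prod>j\<in>UNIV. x j ^ Poly_Mapping.lookup m j)"
  by (simp add: mpoly_eval_def)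

lemma ex_mpoly_mult_var:
  "\<exists>r. \<forall>x :: 'k::finite \<Rightarrow> 'b::field_char_0.
     mpoly_eval r x = of_rat c * x i * mpoly_eval p x"
proof -
  define r where "r = (\<Sum>m\<in>Poly_Mapping.keys p.
    Poly_Mapping.single (m + Poly_Mapping.single i 1) (c * Poly_Mapping.lookup p m))"
  have var: "(\<Prod>j\<in>UNIV. x j ^ Poly_Mapping.lookup (Poly_Mapping.single i 1) j) = x i"
    for x :: "'k \<Rightarrow> 'b"
  proof -
    have "(\<Prod>j\<in>UNIV. x j ^ Poly_Mapping.lookup (Poly_Mapping.single i 1) j) =
        (\<Prod>j\<in>UNIV. if j = i then x j else 1)"
      by (rule prod.cong) (auto simp: lookup_single when_def)
    then show ?thesis by simp
  qed
  have "mpoly_eval r x = of_rat c * x i * mpoly_eval p x" for x :: "'k \<Rightarrow> 'b"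
    unfolding r_def mpoly_eval_sum mpoly_eval_def[of p] sum_distrib_left
    by (rule sum.cong[OF refl],
        simp only: mpoly_eval_single lookup_add power_add prod.distrib var of_rat_mult mult_ac)
  then show ?thesis by blast
qed

lemma rat_basis_coordinates:
  assumes "rat_basis K \<omega>" "y \<in> K"
  shows "\<exists>c. y = (\<Sum>j\<in>UNIV. of_rat (c j) * \<omega> j)"
proof -
  have "y \<in> rat_vs.span (range \<omega>)" and inj: "inj \<omega>"
    using assms by (auto simp: rat_basis_def)
  then obtain u where "y = (\<Sum>v\<in>range \<omega>. of_rat (u v) * v)"
    unfolding rat_vs.span_finite[OF finite_imageI[OF finite]] by blast
  then have "y = (\<Sum>j\<in>UNIV. of_rat (u (\<omega> j)) * \<omega> j)"
    by (simp only: sum.reindex[OF inj] o_def)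
  then show ?thesis by (rule exI[of _ "\<lambda>j. u (\<omega> j)"])
qed

lemma power_coordinates_exist:
  fixes \<omega> :: "'k::finite \<Rightarrow> 'a::field_char_0"
  assumes K: "number_field K" and basis: "rat_basis K \<omega>"
  shows "\<exists>Q. power_coordinates \<omega> n Q"
proof -
  have mem: "\<omega> i \<in> K" for i
    using basis rat_vs.span_base[of "\<omega> i" "range \<omega>"] by (simp add: rat_basis_def)
  have "\<forall>a b. \<exists>c. \<omega> a * \<omega> b = (\<Sum>j\<in>UNIV. of_rat (c j) * \<omega> j)"
    using K mem by (intro allI rat_basis_coordinates[OF basis]) (auto simp: number_field_def)
  then obtain C where C: "\<And>a b. \<omega> a * \<omega> b = (\<Sum>j\<in>UNIV. of_rat (C a b j) * \<omega> j)"
    by metis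
  define X where "X q = (\<Sum>j\<in>UNIV. of_rat (q j) * \<omega> j)" for q :: "'k \<Rightarrow> rat"
  have "\<exists>P :: 'k \<Rightarrow> 'k rat_mpoly. \<forall>q. X q ^ l = (\<Sum>j\<in>UNIV. of_rat (mpoly_eval (P j) q) * \<omega> j)" for l
  proof (induction l)
    case 0
    have "1 \<in> K" using K by (simp add: number_field_def)
    then obtain c where c: "1 = (\<Sum>j\<in>UNIV. of_rat (c j) * \<omega> j)"
      using rat_basis_coordinates[OF basis] by blast
    have "mpoly_eval (Poly_Mapping.single 0 (c j)) q = c j" for j and q :: "'k \<Rightarrow> rat"
      by (simp add: mpoly_eval_single)
    then show ?case using c
      by (intro exI[of _ "\<lambda>j. Poly_Mapping.single 0 (c j)"]) simp
  next
    case (Suc l)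
    then obtain P :: "'k \<Rightarrow> 'k rat_mpoly"
      where P: "\<And>q. X q ^ l = (\<Sum>j\<in>UNIV. of_rat (mpoly_eval (P j) q) * \<omega> j)"
      by blast
    define R where "R a b j = (SOME r. \<forall>q :: 'k \<Rightarrow> rat.
        mpoly_eval r q = of_rat (C a b j) * q a * mpoly_eval (P b) q)" for a b j
    have R: "mpoly_eval (R a b j) q = of_rat (C a b j) * q a * mpoly_eval (P b) q"
      for a b j and q :: "'k \<Rightarrow> rat"
      unfolding R_def using someI_ex[OF ex_mpoly_mult_var] by blast
    define P' where "P' j = (\<Sum>a\<in>UNIV. \<Sum>b\<in>UNIV. R a b j)" for j
    have "X q ^ Suc l = (\<Sum>j\<in>UNIV. of_rat (mpoly_eval (P' j) q) * \<omega> j)" for q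
    proof -
      have "X q ^ Suc l = (\<Sum>a\<in>UNIV. of_rat (q a) * \<omega> a) *
          (\<Sum>b\<in>UNIV. of_rat (mpoly_eval (P b) q) * \<omega> b)"
        by (simp only: power_Suc P) (simp only: X_def)
      also have "\<dots> = (\<Sum>a\<in>UNIV. \<Sum>b\<in>UNIV. (of_rat (q a) * of_rat (mpoly_eval (P b) q)) * (\<omega> a * \<omega> b))"
        unfolding sum_product by (intro sum.cong refl) (simp only: mult_ac)
      also have "\<dots> = (\<Sum>a\<in>UNIV. \<Sum>b\<in>UNIV. \<Sum>j\<in>UNIV. of_rat (mpoly_eval (R a b j) q) * \<omega> j)"
      proof (intro sum.cong refl)
        fix a b
        show "of_rat (q a) * of_rat (mpoly_eval (P b) q) * (\<omega> a * \<omega> b) =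
            (\<Sum>j\<in>UNIV. of_rat (mpoly_eval (R a b j) q) * \<omega> j)"
          unfolding C[of a b] R sum_distrib_left
          by (rule sum.cong[OF refl]) (simp only: of_rat_mult of_rat_eq_id id_apply mult_ac)
      qed
      also have "\<dots> = (\<Sum>a\<in>UNIV. \<Sum>j\<in>UNIV. \<Sum>b\<in>UNIV. of_rat (mpoly_eval (R a b j) q) * \<omega> j)"
        by (rule sum.cong[OF refl], rule sum.swap)
      also have "\<dots> = (\<Sum>j\<in>UNIV. \<Sum>a\<in>UNIV. \<Sum>b\<in>UNIV. of_rat (mpoly_eval (R a b j) q) * \<omega> j)"
        by (rule sum.swap)
      also have "\<dots> = (\<Sum>j\<in>UNIV. of_rat (mpoly_eval (P' j) q) * \<omega> j)"
        by (simp add: P'_def mpoly_eval_sum of_rat_sum sum_distrib_right)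
      finally show ?thesis .
    qed
    then show ?case by blast
  qed
  then show ?thesis
    unfolding power_coordinates_def X_def by metis
qed


section \<open>The extension operator\<close>

text \<open>The rows of \<open>\<real>\<^sup>n\<^sup>k\<close> are indexed by a finite type \<open>'n\<close>; \<open>deg\<close>, a bijection of \<open>'n\<close> with
  \<open>{1..n}\<close> in use, gives the power belonging to a row. The inner product of \<open>real^'k^'n\<close> is
  the usual dot product of \<open>\<real>\<^sup>n\<^sup>k\<close>.\<close>

definition power_map ::
    "('n::finite \<Rightarrow> nat) \<Rightarrow> (nat \<Rightarrow> 'k \<Rightarrow> 'k rat_mpoly) \<Rightarrow> real^'k::finite \<Rightarrow> real^'k^'n" where
  "power_map deg Q x = (\<chi> i j. mpoly_eval (Q (deg i) j) (\<lambda>m. x $ m))"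

definition extension_operator ::
    "('n::finite \<Rightarrow> nat) \<Rightarrow> (nat \<Rightarrow> 'k \<Rightarrow> 'k rat_mpoly) \<Rightarrow> (real^'k \<Rightarrow> real) \<Rightarrow>
     (real^'k::finite \<Rightarrow> complex) \<Rightarrow> real^'k^'n \<Rightarrow> complex" where
  "extension_operator deg Q \<psi> g \<xi> =
     (LINT x|lebesgue.
        exp (2 * of_real pi * \<i> * of_real (\<xi> \<bullet> power_map deg Q x)) * g x * of_real (\<psi> x))"


section \<open>Smooth functions and Lebesgue spaces\<close>

primrec times_differentiable :: "nat \<Rightarrow> ('a::euclidean_space \<Rightarrow> real) \<Rightarrow> bool" where
  "times_differentiable 0 f \<longleftrightarrow> continuous_on UNIV f"
| "times_differentiable (Suc m) f \<longleftrightarrow>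
     (\<forall>x. f differentiable at x) \<and>
     (\<forall>v. times_differentiable m (\<lambda>x. frechet_derivative f (at x) v))"

definition smooth :: "('a::euclidean_space \<Rightarrow> real) \<Rightarrow> bool" where
  "smooth f \<longleftrightarrow> (\<forall>m. times_differentiable m f)"

definition compactly_supported :: "('a::euclidean_space \<Rightarrow> real) \<Rightarrow> bool" where
  "compactly_supported f \<longleftrightarrow> compact (closure {x. f x \<noteq> 0})"

definition in_Lp :: "real \<Rightarrow> 'a measure \<Rightarrow> ('a \<Rightarrow> complex) \<Rightarrow> bool" where
  "in_Lp q M f \<longleftrightarrow> f \<in> borel_measurable M \<and> integrable M (\<lambda>x. norm (f x) powr q)"

end

theory Submission
  imports Defs "HOL-Computational_Algebra.Fundamental_Theorem_Algebra"
begin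

text \<open>The characters of \<open>K\<close> diagonalise multiplication: in the coordinates \<open>Y j\<close> that they give on
  \<open>\<real>\<^sup>k\<close>, stable under conjugation, the phase is a sum of one-variable polynomials \<open>P j (Y j)\<close>.
  Let \<open>H j\<close> be the minimum over the support of \<open>\<psi>\<close> of the height
  \<open>1 + (\<Sum>r. \<bar>P j\<^sup>(\<^sup>r\<^sup>) / r!\<bar>\<^sup>1\<^sup>/\<^sup>r)\<close>. At distance \<open>\<delta> = H j\<^sup>\<epsilon>\<^sup>-\<^sup>1\<close> from its roots the derivative of
  \<open>P j\<close> is at least of order \<open>H j\<close>, so each integration by parts with the derivation dual to \<open>Y j\<close>
  gains \<open>H j\<^sup>-\<^sup>\<epsilon>\<close> there, while the neighbourhoods of the roots contribute at most their volume. The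
  extension operator is therefore bounded by \<open>\<Prod>j. H j\<^sup>\<epsilon>\<^sup>-\<^sup>1\<close>; the loss of \<open>\<epsilon>\<close> is harmless because
  the range of exponents is open.

  The heights vary slowly at the scale \<open>1 / H j\<close>, hence \<open>(\<Prod>j. H j)\<^sup>-\<^sup>p\<close> is bounded by the integral over
  the base point \<open>x\<close> of the product of the heights at \<open>x\<close> to the power \<open>1 - p\<close>. Now exchange the
  integrals: for fixed \<open>x\<close> the frequencies are, up to a linear change of variables, the Taylor
  coefficients of the \<open>P j\<close> at \<open>Y j x\<close>, and the resulting integral converges exactly when
  \<open>p - 1 > 1 + 2 + \<dots> + n\<close>.\<close>

section \<open>Separable annihilators\<close>

text \<open>The phase separates only in complex coordinates, so real and complex places are treated
  alike: the derivation dual to \<open>Y j\<close> annihilates every other coordinate, the conjugate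
  one included, and does not see the other summands of the phase. Only the cutoffs involve
  \<open>Y j\<close> together with its conjugate, which is why all scales must agree at conjugate
  places. Every estimate must be uniform in the frequency, so constants are quantified before
  polynomials, scales and open sets. The exponent \<open>1/r\<close> in the height makes a Taylor
  coefficient of order \<open>r\<close> measure an inverse length: at distance \<open>1 / H\<close>
  its term is bounded. A height at most \<open>A\<close> confines the coefficient of order
  \<open>r\<close> to size \<open>A^r\<close>, hence the \<open>n\<close> coefficients at one index
  to a set of measure about \<open>A^(1 + ... + n)\<close>; this is the sum in the critical
  exponent. The additional 1 is the volume \<open>1 / H\<close> of the cell on which the height is
  stable. A single integration by parts gains too little, so about \<open>1 / \<epsilon>\<close> of
  them are made at each place.\<close>

lemma map_poly_of_rat_add:
  "map_poly (of_rat :: rat \<Rightarrow> 'a::field_char_0) (p + q) = map_poly of_rat p + map_poly of_rat q"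
  by (intro poly_eqI) (simp add: coeff_map_poly of_rat_add)

lemma map_poly_of_rat_smult:
  "map_poly (of_rat :: rat \<Rightarrow> 'a::field_char_0) (smult c p) = smult (of_rat c) (map_poly of_rat p)"
  by (intro poly_eqI) (simp add: coeff_map_poly of_rat_mult)

lemma map_poly_of_rat_mult:
  "map_poly (of_rat :: rat \<Rightarrow> 'a::field_char_0) (p * q) = map_poly of_rat p * map_poly of_rat q"
  by (induction p)
    (simp_all add: map_poly_of_rat_add map_poly_of_rat_smult map_poly_pCons)

lemma map_poly_of_rat_pderiv:
  "map_poly (of_rat :: rat \<Rightarrow> 'a::field_char_0) (pderiv p) = pderiv (map_poly of_rat p)"
  by (intro poly_eqI) (simp add: coeff_map_poly coeff_pderiv of_rat_mult of_rat_add)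

lemma degree_map_poly_of_rat [simp]:
  "degree (map_poly (of_rat :: rat \<Rightarrow> 'a::field_char_0) p) = degree p"
  by (rule degree_map_poly) simp

text \<open>The nonzero polynomial of least degree annihilating an element of a field is separable:
  the generator of the ideal spanned by it and its derivative divides it, so it annihilates
  the element or has a cofactor that does.\<close>

lemma separable_annihilator:
  fixes x :: "'a::field_char_0" and f0 :: "rat poly"
  assumes "f0 \<noteq> 0" "poly (map_poly of_rat f0) x = 0"
  obtains f :: "rat poly" where "f \<noteq> 0" "poly (map_poly of_rat f) x = 0"
    "rsquarefree (map_poly of_rat f :: complex poly)"
proof -
  define A where "A = {f :: rat poly. f \<noteq> 0 \<and> poly (map_poly of_rat f) x = 0}"
  have "f0 \<in> A" using assms by (simp add: A_def)
  then obtain f where f: "f \<in> A" and fmin: "\<And>g. g \<in> A \<Longrightarrow> degree f \<le> degree g"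
    using arg_min_nat_lemma[of "\<lambda>f. f \<in> A" f0 degree] by blast
  have f0: "f \<noteq> 0" "poly (map_poly of_rat f) x = 0" using f by (auto simp: A_def)
  have degf: "degree f > 0"
  proof (rule ccontr)
    assume "\<not> degree f > 0"
    then obtain c where c: "f = [:c:]" by (metis degree_eq_zeroE gr0I)
    then show False using f0 by (simp add: map_poly_pCons)
  qed
  define I where "I = {g. g \<noteq> 0 \<and> (\<exists>a b. g = a * f + b * pderiv f)}"
  have "pderiv f \<noteq> 0" using degf by (simp add: pderiv_eq_0_iff)
  then have "pderiv f \<in> I" unfolding I_def by (auto intro: exI[of _ 0] exI[of _ 1])
  then obtain d where d: "d \<in> I" and dmin: "\<And>g. g \<in> I \<Longrightarrow> degree d \<le> degree g"
    using arg_min_nat_lemma[of "\<lambda>f. f \<in> I" "pderiv f" degree] by blast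
  obtain a b where ab: "d = a * f + b * pderiv f" and d0: "d \<noteq> 0" using d by (auto simp: I_def)
  have degd: "degree d < degree f"
    using dmin[OF \<open>pderiv f \<in> I\<close>] degf by (simp add: degree_pderiv)
  have "f mod d = 0"
  proof (rule ccontr)
    assume ne: "f mod d \<noteq> 0"
    have "f mod d = f - (f div d) * d" by (simp add: minus_div_mult_eq_mod)
    also have "\<dots> = (1 - (f div d) * a) * f + (- (f div d) * b) * pderiv f"
      unfolding ab by (simp add: algebra_simps)
    finally have "f mod d \<in> I" using ne unfolding I_def by blast
    then have "degree d \<le> degree (f mod d)" by (rule dmin)
    moreover have "degree (f mod d) < degree d" using degree_mod_less[OF d0, of f] ne by blast
    ultimately show False by simp
  qed
  then obtain h where h: "f = d * h" by (metis mod_0_imp_dvd dvdE)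
  then have h0: "h \<noteq> 0" using f0 by auto
  have "poly (map_poly of_rat d) x * poly (map_poly of_rat h) x = 0"
    using f0 h by (simp add: map_poly_of_rat_mult)
  moreover have "poly (map_poly of_rat d) x \<noteq> 0"
    using fmin[of d] d0 degd by (auto simp: A_def)
  ultimately have "h \<in> A" using h0 by (auto simp: A_def)
  then have "degree f \<le> degree h" by (rule fmin)
  then have "degree d = 0" using h d0 h0 by (simp add: degree_mult_eq)
  then obtain c where c: "d = [:c:]" "c \<noteq> 0" using d0 by (metis degree_eq_zeroE pCons_0_0)
  \<comment> \<open>The Bezout relation between \<open>f\<close> and its derivative survives the
    passage to the complex numbers, so a common root would be a root of the nonzero constant
    \<open>d\<close>.\<close>
  have "rsquarefree (map_poly of_rat f :: complex poly)"
    unfolding rsquarefree_roots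
  proof safe
    fix z :: complex
    assume z: "poly (map_poly of_rat f) z = 0" "poly (pderiv (map_poly of_rat f)) z = 0"
    have "poly (map_poly of_rat d) z = 0"
      using z unfolding ab
      by (simp add: map_poly_of_rat_add map_poly_of_rat_mult map_poly_of_rat_pderiv)
    then show False using c by (simp add: map_poly_pCons)
  qed
  with f0 show ?thesis by (rule that)
qed

text \<open>Lagrange interpolation of the constant 1: both sides have degree below
  \<open>card R\<close> and agree on \<open>R\<close>. Applied to an operator annihilated by the
  polynomial with simple roots \<open>R\<close>, the identity splits a vector into
  eigenvectors.\<close>

lemma lagrange_one:
  fixes R :: "complex set"
  assumes "finite R" "R \<noteq> {}"
  shows "(\<Sum>r\<in>R. smult (inverse (\<Prod>s\<in>R-{r}. r - s)) (\<Prod>s\<in>R-{r}. [:-s, 1:])) = 1"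
proof (rule poly_eqI_degree[of R])
  fix x assume x: "x \<in> R"
  have "poly (\<Sum>r\<in>R. smult (inverse (\<Prod>s\<in>R-{r}. r - s)) (\<Prod>s\<in>R-{r}. [:-s, 1:])) x
      = (\<Sum>r\<in>R. inverse (\<Prod>s\<in>R-{r}. r - s) * (\<Prod>s\<in>R-{r}. x - s))"
    by (simp add: poly_sum poly_prod)
  also have "\<dots> = (\<Sum>r\<in>R. if r = x then 1 else 0)"
  proof (rule sum.cong[OF refl])
    fix r assume "r \<in> R"
    show "inverse (\<Prod>s\<in>R-{r}. r - s) * (\<Prod>s\<in>R-{r}. x - s) = (if r = x then 1 else 0)"
    proof (cases "r = x")
      case True
      then show ?thesis using assms by simp
    next
      case False
      then have "(\<Prod>s\<in>R-{r}. x - s) = 0" using x assms by (intro prod_zero) auto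
      then show ?thesis using False by simp
    qed
  qed
  also have "\<dots> = 1" using x assms by simp
  finally show "poly (\<Sum>r\<in>R. smult (inverse (\<Prod>s\<in>R-{r}. r - s)) (\<Prod>s\<in>R-{r}. [:-s, 1:])) x
      = poly 1 x" by simp
next
  have "degree (smult (inverse (\<Prod>s\<in>R-{r}. r - s)) (\<Prod>s\<in>R-{r}. [:-s, 1:])) < card R"
    if "r \<in> R" for r
  proof -
    have "degree (\<Prod>s\<in>R-{r}. [:-s, 1:]) \<le> (\<Sum>s\<in>R-{r}. degree [:-s, 1:])"
      using degree_prod_sum_le[of "R-{r}" "\<lambda>s. [:-s, 1:]"] assms by (simp add: o_def)
    also have "\<dots> < card R"
      using that assms by (simp add: card_gt_0_iff)
    finally show ?thesis by (meson degree_smult_le le_less_trans)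
  qed
  then show "degree (\<Sum>r\<in>R. smult (inverse (\<Prod>s\<in>R-{r}. r - s)) (\<Prod>s\<in>R-{r}. [:-s, 1:])) < card R"
    using assms by (intro degree_sum_less) (auto simp: card_gt_0_iff)
  show "degree (1::complex poly) < card R" using assms by (simp add: card_gt_0_iff)
qed

section \<open>Characters of a number field\<close>

locale number_field_basis =
  fixes K :: "'a::field_char_0 set" and \<omega> :: "'k::finite \<Rightarrow> 'a"
  assumes K: "number_field K" and basis: "rat_basis K \<omega>"
begin

section \<open>Coordinates in \<open>K\<close> and rational-linear functionals on
  \<open>K\<close>\<close>

definition coord :: "'a \<Rightarrow> 'k \<Rightarrow> rat" where
  "coord x = (SOME c. x = (\<Sum>j\<in>UNIV. of_rat (c j) * \<omega> j))"

lemma coord: "x \<in> K \<Longrightarrow> (\<Sum>j\<in>UNIV. of_rat (coord x j) * \<omega> j) = x"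
  unfolding coord_def by (rule someI_ex[OF rat_basis_coordinates[OF basis], symmetric])

lemma basis_mem: "\<omega> i \<in> K"
  using basis rat_vs.span_base[of "\<omega> i" "range \<omega>"] by (simp add: rat_basis_def)

lemma comb_mem: "(\<Sum>j\<in>UNIV. of_rat (c j) * \<omega> j) \<in> K"
proof -
  have "(\<Sum>j\<in>UNIV. of_rat (c j) * \<omega> j) \<in> rat_vs.span (range \<omega>)"
    by (intro rat_vs.span_sum rat_vs.span_scale rat_vs.span_base) auto
  then show ?thesis using basis by (simp add: rat_basis_def)
qed

lemma comb_zero:
  assumes "(\<Sum>j\<in>UNIV. of_rat (c j) * \<omega> j) = 0"
  shows "c j = 0"
proof -
  have inj: "inj \<omega>" and ind: "rat_vs.independent (range \<omega>)"
    using basis by (auto simp: rat_basis_def)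
  have "(\<Sum>v\<in>range \<omega>. of_rat (c (inv \<omega> v)) * v) = 0"
    using assms by (simp only: sum.reindex[OF inj] o_def inv_f_f[OF inj])
  then have "c (inv \<omega> (\<omega> j)) = 0"
    by (intro rat_vs.independentD[OF ind, of "range \<omega>" "\<lambda>v. c (inv \<omega> v)"]) auto
  then show ?thesis by (simp only: inv_f_f[OF inj])
qed

lemma coord_unique:
  assumes "x = (\<Sum>j\<in>UNIV. of_rat (c j) * \<omega> j)"
  shows "coord x = c"
proof
  fix j
  have "(\<Sum>j\<in>UNIV. of_rat (coord x j) * \<omega> j) = x"
    unfolding assms by (rule coord[OF comb_mem])
  then have "(\<Sum>j\<in>UNIV. of_rat (coord x j - c j) * \<omega> j) = 0"
    using assms by (simp add: of_rat_diff left_diff_distrib sum_subtractf)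
  then have "coord x j - c j = 0" by (rule comb_zero)
  then show "coord x j = c j" by simp
qed

lemma mem_add: "x \<in> K \<Longrightarrow> y \<in> K \<Longrightarrow> x + y \<in> K"
  and mem_mult: "x \<in> K \<Longrightarrow> y \<in> K \<Longrightarrow> x * y \<in> K"
  and mem_one: "1 \<in> K" and mem_zero: "0 \<in> K"
  using K by (auto simp: number_field_def)

lemma mem_power: "x \<in> K \<Longrightarrow> x ^ i \<in> K"
  by (induction i) (auto intro: mem_one mem_mult)

lemma mem_rat: "x \<in> K \<Longrightarrow> of_rat r * x \<in> K"
  using basis rat_vs.span_scale[of x "range \<omega>" r] by (simp add: rat_basis_def)

lemma mem_sum: "(\<And>i. i \<in> I \<Longrightarrow> f i \<in> K) \<Longrightarrow> sum f I \<in> K"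
  by (induction I rule: infinite_finite_induct) (auto intro: mem_add mem_zero)

lemma coord_add: "x \<in> K \<Longrightarrow> y \<in> K \<Longrightarrow> coord (x + y) = (\<lambda>j. coord x j + coord y j)"
  by (rule coord_unique) (simp add: of_rat_add distrib_right sum.distrib coord)

lemma coord_rat: "x \<in> K \<Longrightarrow> coord (of_rat r * x) = (\<lambda>j. r * coord x j)"
proof (rule coord_unique)
  assume "x \<in> K"
  then have "of_rat r * x = of_rat r * (\<Sum>j\<in>UNIV. of_rat (coord x j) * \<omega> j)" by (simp only: coord)
  also have "\<dots> = (\<Sum>j\<in>UNIV. of_rat (r * coord x j) * \<omega> j)"
    by (simp only: sum_distrib_left of_rat_mult mult.assoc)
  finally show "of_rat r * x = (\<Sum>j\<in>UNIV. of_rat (r * coord x j) * \<omega> j)" .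
qed

lemma coord_zero: "coord 0 j = 0"
  using coord_rat[OF mem_zero, of 0] by simp

text \<open>Functionals on \<open>K\<close> that are linear over the rationals are encoded by their
  values on the basis (see \<open>lin_basis\<close>), so that independence, span and dimension are
  those of \<open>complex^'k\<close>. Arguments have to lie in \<open>K\<close>, since
  \<open>coord\<close> is an arbitrary choice elsewhere.\<close>

definition lin :: "complex^'k \<Rightarrow> 'a \<Rightarrow> complex" where
  "lin v x = (\<Sum>j\<in>UNIV. v $ j * of_rat (coord x j))"

lemma lin_add: "x \<in> K \<Longrightarrow> y \<in> K \<Longrightarrow> lin v (x + y) = lin v x + lin v y"
  by (simp add: lin_def coord_add of_rat_add distrib_left sum.distrib)

lemma lin_rat: "x \<in> K \<Longrightarrow> lin v (of_rat r * x) = of_rat r * lin v x"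
  unfolding lin_def by (simp add: coord_rat of_rat_mult) (simp add: sum_distrib_left mult_ac)

lemma lin_zero: "lin v 0 = 0"
  by (simp add: lin_def coord_zero)

lemma lin_sum: "(\<And>i. i \<in> I \<Longrightarrow> f i \<in> K) \<Longrightarrow> lin v (sum f I) = (\<Sum>i\<in>I. lin v (f i))"
  by (induction I rule: infinite_finite_induct) (auto simp: lin_zero lin_add mem_sum)

lemma coord_basis: "coord (\<omega> i) = (\<lambda>j. if j = i then 1 else 0)"
proof (rule coord_unique)
  have "(\<Sum>j\<in>UNIV. of_rat (if j = i then 1 else 0) * \<omega> j) = (\<Sum>j\<in>UNIV. if j = i then \<omega> j else 0)"
    by (rule sum.cong) auto
  then show "\<omega> i = (\<Sum>j\<in>UNIV. of_rat (if j = i then 1 else 0) * \<omega> j)" by simp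
qed

lemma lin_basis: "lin v (\<omega> i) = v $ i"
proof -
  have "lin v (\<omega> i) = (\<Sum>j\<in>UNIV. if j = i then v $ j else 0)"
    unfolding lin_def coord_basis by (rule sum.cong) auto
  then show ?thesis by simp
qed

lemma lin_expand:
  "x \<in> K \<Longrightarrow> y \<in> K \<Longrightarrow> lin v (x * y) = (\<Sum>j\<in>UNIV. of_rat (coord y j) * lin v (x * \<omega> j))"
proof -
  assume xy: "x \<in> K" "y \<in> K"
  have "lin v (x * y) = lin v (\<Sum>j\<in>UNIV. of_rat (coord y j) * (x * \<omega> j))"
    by (subst (1) coord[OF xy(2), symmetric]) (simp add: sum_distrib_left mult_ac)
  also have "\<dots> = (\<Sum>j\<in>UNIV. lin v (of_rat (coord y j) * (x * \<omega> j)))"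
    by (rule lin_sum) (auto intro: mem_rat mem_mult xy basis_mem)
  finally show ?thesis by (simp add: lin_rat mem_mult xy basis_mem)
qed

text \<open>The \<open>CARD('k) + 1\<close> powers of \<open>x\<close> lie in a space of rational
  dimension \<open>CARD('k)\<close>: two of them coincide, or they are distinct and
  dependent.\<close>

lemma algebraic:
  assumes x: "x \<in> K"
  shows "\<exists>f. f \<noteq> 0 \<and> poly (map_poly of_rat f) x = 0"
proof (cases "inj_on (\<lambda>i. x ^ i) {..CARD('k)}")
  case False
  then obtain i j where ij: "x ^ i = x ^ j" "i \<noteq> j" by (auto simp: inj_on_def)
  let ?f = "monom 1 i - monom 1 j :: rat poly"
  have "?f \<noteq> 0" using ij by (simp add: monom_eq_iff')
  moreover have "map_poly of_rat ?f = (monom 1 i - monom 1 j :: 'a poly)"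
    by (intro poly_eqI) (simp add: coeff_map_poly of_rat_diff)
  ultimately show ?thesis using ij by (metis poly_diff poly_monom diff_self mult_1)
next
  case True
  define P where "P = (\<lambda>i. x ^ i) ` {..CARD('k)}"
  have "card P = Suc CARD('k)" using card_image[OF True] by (simp add: P_def)
  moreover have "P \<subseteq> rat_vs.span (range \<omega>)"
    using mem_power[OF x] basis by (auto simp: P_def rat_basis_def)
  moreover have "card (range \<omega>) = CARD('k)"
    using basis card_image[of \<omega> UNIV] by (simp add: rat_basis_def)
  ultimately have "\<not> rat_vs.independent P"
    using rat_vs.independent_span_bound[of "range \<omega>" P] by auto
  then obtain u where u: "(\<Sum>v\<in>P. of_rat (u v) * v) = 0" "\<exists>v\<in>P. u v \<noteq> 0"
    using rat_vs.dependent_finite[of P] by (auto simp: P_def)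
  define f where "f = (\<Sum>i\<le>CARD('k). monom (u (x ^ i)) i)"
  obtain i where i: "i \<le> CARD('k)" "u (x ^ i) \<noteq> 0" using u(2) by (auto simp: P_def)
  have "coeff f i = u (x ^ i)"
    using i(1) by (simp add: f_def coeff_sum)
  then have "f \<noteq> 0" using i by auto
  have "map_poly of_rat f = (\<Sum>i\<le>CARD('k). monom (of_rat (u (x ^ i)) :: 'a) i)"
    unfolding f_def by (intro poly_eqI) (simp add: coeff_map_poly coeff_sum of_rat_sum if_distrib[of of_rat] cong: if_cong)
  then have "poly (map_poly of_rat f) x = (\<Sum>i\<le>CARD('k). of_rat (u (x ^ i)) * x ^ i)"
    by (simp add: poly_sum poly_monom)
  also have "\<dots> = 0" using u(1) by (simp add: P_def sum.reindex[OF True])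
  finally show ?thesis using \<open>f \<noteq> 0\<close> by blast
qed

text \<open>A vector \<open>v\<close> stands for the functional \<open>lin v\<close>; a polynomial \<open>p\<close> acts as \<open>p\<close> applied to the
  transpose of the multiplication by \<open>x\<close>.\<close>

definition act :: "complex poly \<Rightarrow> 'a \<Rightarrow> complex^'k \<Rightarrow> complex^'k" where
  "act p x v = (\<chi> j. \<Sum>i\<le>degree p. coeff p i * lin v (x ^ i * \<omega> j))"

lemma sum_degree_le: "degree p \<le> d \<Longrightarrow> (\<Sum>i\<le>degree p. coeff p i * f i) = (\<Sum>i\<le>d. coeff p i * f i)"
  for p :: "complex poly"
  by (rule sum.mono_neutral_left) (auto simp: coeff_eq_0)

lemma lin_act:
  assumes "x \<in> K" "y \<in> K"
  shows "lin (act p x v) y = (\<Sum>i\<le>degree p. coeff p i * lin v (x ^ i * y))"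
proof -
  have "lin (act p x v) y
      = (\<Sum>j\<in>UNIV. \<Sum>i\<le>degree p. coeff p i * (of_rat (coord y j) * lin v (x ^ i * \<omega> j)))"
    unfolding lin_def[of "act p x v"] by (simp add: act_def sum_distrib_left sum_distrib_right mult_ac)
  also have "\<dots> = (\<Sum>i\<le>degree p. coeff p i * (\<Sum>j\<in>UNIV. of_rat (coord y j) * lin v (x ^ i * \<omega> j)))"
    by (subst sum.swap) (simp add: sum_distrib_left)
  also have "\<dots> = (\<Sum>i\<le>degree p. coeff p i * lin v (x ^ i * y))"
    using assms by (simp add: lin_expand mem_power)
  finally show ?thesis .
qed

lemma vec_eq_lin: "(\<And>y. y \<in> K \<Longrightarrow> lin v y = lin w y) \<Longrightarrow> v = w"
  using basis_mem lin_basis by (metis vec_eq_iff)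

lemma act_add: "act (p + q) x v = act p x v + act q x v"
proof -
  let ?d = "max (degree (p + q)) (max (degree p) (degree q))"
  have le: "degree (p + q) \<le> ?d" "degree p \<le> ?d" "degree q \<le> ?d" by auto
  show ?thesis
    by (simp only: act_def vec_eq_iff vec_lambda_beta vector_add_component le[THEN sum_degree_le])
      (simp add: distrib_right sum.distrib)
qed

lemma act_smult: "act (smult c p) x v = c *s act p x v"
  by (simp add: act_def vec_eq_iff sum_distrib_left mult_ac)

lemma act_sum: "act (sum f I) x v = (\<Sum>i\<in>I. act (f i) x v)"
  by (induction I rule: infinite_finite_induct) (simp_all add: act_add, simp_all add: act_def vec_eq_iff)

lemma act_one: "act 1 x v = v"
  by (simp add: act_def vec_eq_iff lin_basis)

text \<open>The source of eigenvectors: if the product of \<open>X - r\<close> and \<open>p\<close>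
  acts as zero, then \<open>act p x v\<close> is an eigenvector with eigenvalue
  \<open>r\<close>.\<close>

lemma lin_act_linear:
  assumes "x \<in> K" "y \<in> K"
  shows "lin (act ([:-r, 1:] * p) x v) y = lin (act p x v) (x * y) - r * lin (act p x v) y"
proof -
  have "lin (act (pCons 0 p) x v) y = lin (act p x v) (x * y)"
  proof (cases "p = 0")
    case False
    then have "lin (act (pCons 0 p) x v) y = (\<Sum>i\<le>Suc (degree p). coeff (pCons 0 p) i * lin v (x ^ i * y))"
      using assms by (simp add: lin_act del: sum.atMost_Suc)
    also have "\<dots> = (\<Sum>i\<le>degree p. coeff p i * lin v (x ^ Suc i * y))"
      by (simp add: sum.atMost_Suc_shift del: power_Suc sum.atMost_Suc)
    also have "\<dots> = lin (act p x v) (x * y)"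
      using assms by (simp add: lin_act mem_mult mult_ac)
    finally show ?thesis .
  qed (use assms in \<open>simp add: lin_act mem_mult\<close>)
  moreover have "[:-r, 1:] * p = pCons 0 p + smult (-r) p"
    by (simp add: add.commute)
  moreover have "lin (v + c *s w) y = lin v y + c * lin w y" for c v w
    by (simp add: lin_def distrib_right distrib_left sum.distrib sum_distrib_left mult_ac)
  ultimately show ?thesis
    by (simp only: act_add act_smult) simp
qed

text \<open>Rational coefficients pass through \<open>lin v\<close>, which is linear over the
  rationals only; what remains is \<open>lin v\<close> of \<open>f(x) * y = 0\<close>.\<close>

lemma act_annihilator:
  fixes f :: "rat poly"
  assumes x: "x \<in> K" and f: "poly (map_poly of_rat f) x = 0"
  shows "act (map_poly of_rat f) x v = 0"
proof (rule vec_eq_lin)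
  fix y assume y: "y \<in> K"
  have "lin (act (map_poly of_rat f) x v) y = (\<Sum>i\<le>degree f. lin v (of_rat (coeff f i) * (x ^ i * y)))"
    using x y by (simp add: lin_act coeff_map_poly lin_rat mem_mult mem_power)
  also have "\<dots> = lin v (\<Sum>i\<le>degree f. of_rat (coeff f i) * (x ^ i * y))"
    using x y by (subst lin_sum) (auto intro: mem_rat mem_mult mem_power)
  also have "(\<Sum>i\<le>degree f. of_rat (coeff f i) * (x ^ i * y)) = poly (map_poly of_rat f) x * y"
    by (simp add: poly_altdef coeff_map_poly sum_distrib_right sum_distrib_left mult_ac)
  finally show "lin (act (map_poly of_rat f) x v) y = lin 0 y"
    using f by (simp add: lin_def coord_zero)
qed

text \<open>The union of all eigenspaces of the transposed multiplication by \<open>x\<close>, zero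
  included. It need not be a subspace, as the eigenvalue is not recorded; hence the spans
  below.\<close>

definition eig :: "'a \<Rightarrow> (complex^'k) set" where
  "eig x = {v. \<exists>c. \<forall>y\<in>K. lin v (x * y) = c * lin v y}"

lemma act_eig:
  assumes v: "v \<in> eig x" and x: "x \<in> K" and z: "z \<in> K"
  shows "act p z v \<in> eig x"
proof -
  obtain c where c: "\<And>y. y \<in> K \<Longrightarrow> lin v (x * y) = c * lin v y" using v by (auto simp: eig_def)
  have "lin (act p z v) (x * y) = c * lin (act p z v) y" if y: "y \<in> K" for y
  proof -
    have "lin v (z ^ i * (x * y)) = c * lin v (z ^ i * y)" for i
      using c[of "z ^ i * y"] y z by (simp add: mult_ac mem_mult mem_power)
    then show ?thesis using x y z by (simp add: lin_act mem_mult sum_distrib_left mult_ac)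
  qed
  then show ?thesis by (auto simp: eig_def)
qed

text \<open>Simultaneous diagonalisation, one element at a time. Interpolation at the roots of a
  separable annihilator splits a vector into eigenvectors for \<open>x\<close>. Each piece is a
  polynomial in \<open>x\<close> applied to the vector, so it stays an eigenvector for the earlier
  elements (\<open>act_eig\<close>), because multiplications commute.\<close>

lemma joint_eig_span:
  assumes "finite A" "A \<subseteq> K"
  shows "vec.span (\<Inter>x\<in>A. eig x) = UNIV"
  using assms
proof (induction A rule: finite_induct)
  case empty
  show ?case by (simp add: vec.span_UNIV)
next
  case (insert x A)
  have x: "x \<in> K" using insert by simp
  obtain f0 where "f0 \<noteq> 0" "poly (map_poly of_rat f0) x = 0" using algebraic[OF x] by blast
  then obtain f :: "rat poly" where f: "f \<noteq> 0" "poly (map_poly of_rat f) x = 0"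
    and sq: "rsquarefree (map_poly of_rat f :: complex poly)" by (rule separable_annihilator)
  define F where "F = (map_poly of_rat f :: complex poly)"
  define R where "R = {z. poly F z = 0}"
  have F0: "F \<noteq> 0" using sq by (simp add: F_def rsquarefree_def)
  have R: "finite R" unfolding R_def using F0 by (rule poly_roots_finite)
  have dec: "F = smult (lead_coeff F) (\<Prod>z\<in>R. [:-z, 1:])"
    using complex_poly_decompose_rsquarefree[OF sq] by (simp add: F_def R_def)
  have Fx: "act F x v = 0" for v using act_annihilator[OF x f(2)] by (simp add: F_def)
  \<comment> \<open>Without roots \<open>F\<close> would be a nonzero constant, which does not act
    as zero.\<close>
  have Rne: "R \<noteq> {}"
  proof
    assume "R = {}"
    then have "F = smult (lead_coeff F) 1" using dec by simp
    then have "act F x v = lead_coeff F *s v" for v by (metis act_smult act_one)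
    then show False using Fx[of 1] F0 by (simp add: vec_eq_iff)
  qed
  define g where "g r = (\<Prod>s\<in>R-{r}. [:-s, 1:])" for r
  define c where "c r = inverse (\<Prod>s\<in>R-{r}. r - s)" for r
  have one: "(\<Sum>r\<in>R. smult (c r) (g r)) = 1"
    unfolding c_def g_def by (rule lagrange_one[OF R Rne])
  have eigx: "act (g r) x v \<in> eig x" if r: "r \<in> R" for r v
  proof -
    have "F = smult (lead_coeff F) ([:-r, 1:] * g r)"
      using dec prod.remove[OF R r, of "\<lambda>z. [:-z, 1:]"] by (simp add: g_def)
    then have "lead_coeff F *s act ([:-r, 1:] * g r) x v = 0" by (metis Fx act_smult)
    then have "act ([:-r, 1:] * g r) x v = 0" using F0 by (simp add: vec_eq_iff)
    then have "lin (act (g r) x v) (x * y) = r * lin (act (g r) x v) y" if "y \<in> K" for y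
      using lin_act_linear[OF x that, of r "g r" v] by (simp add: lin_def)
    then show ?thesis by (auto simp: eig_def)
  qed
  have "v \<in> vec.span (\<Inter>x\<in>insert x A. eig x)" if v: "v \<in> (\<Inter>x\<in>A. eig x)" for v
  proof -
    have "v = (\<Sum>r\<in>R. c r *s act (g r) x v)"
      by (subst act_one[of x, symmetric]) (simp only: one[symmetric] act_sum act_smult)
    moreover have "act (g r) x v \<in> (\<Inter>x\<in>insert x A. eig x)" if "r \<in> R" for r
      using eigx[OF that] act_eig[OF _ _ x] v insert.prems by auto
    ultimately show ?thesis
      by (metis (no_types, lifting) vec.span_sum vec.span_scale vec.span_base)
  qed
  then have "vec.span (\<Inter>x\<in>A. eig x) \<subseteq> vec.span (\<Inter>x\<in>insert x A. eig x)"
    by (intro vec.span_minimal vec.subspace_span) auto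
  then show ?case using insert by auto
qed

section \<open>Characters: they span, are independent and are stable under conjugation\<close>

definition chars :: "(complex^'k) set" where
  "chars = {s. lin s 1 = 1 \<and> (\<forall>x\<in>K. \<forall>y\<in>K. lin s (x * y) = lin s x * lin s y)}"

text \<open>A joint eigenvector is a character up to its value \<open>a\<close> at 1: the eigenvalue
  equations at 1 express the eigenvalues through \<open>v\<close>, whence
  \<open>v(xy) a = v(x) v(y)\<close>. The value \<open>a\<close> is nonzero, since otherwise
  \<open>v\<close> would vanish on the basis.\<close>

lemma chars_span: "vec.span chars = UNIV"
proof -
  have "v \<in> vec.span chars" if v: "v \<in> (\<Inter>x\<in>range \<omega>. eig x)" for v
  proof (cases "v = 0")
    case True
    then show ?thesis by (simp add: vec.span_zero)
  next
    case False
    have "\<exists>c. \<forall>y\<in>K. lin v (\<omega> j * y) = c * lin v y" for j using v by (auto simp: eig_def)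
    then obtain c where c: "\<And>j y. y \<in> K \<Longrightarrow> lin v (\<omega> j * y) = c j * lin v y" by metis
    define a where "a = lin v 1"
    have cv: "c j * a = v $ j" for j using c[OF mem_one, of j] by (simp add: lin_basis a_def)
    have a: "a \<noteq> 0" using False cv by (auto simp: vec_eq_iff)
    have mult: "lin v (x * y) * a = lin v x * lin v y" if "x \<in> K" "y \<in> K" for x y
    proof -
      have "lin v (x * y) * a = lin v (y * x) * a" by (simp add: mult.commute)
      also have "\<dots> = (\<Sum>j\<in>UNIV. of_rat (coord x j) * (c j * lin v y)) * a"
        using that by (simp add: lin_expand) (simp add: c that mult.commute[of y])
      also have "\<dots> = (\<Sum>j\<in>UNIV. of_rat (coord x j) * (c j * a)) * lin v y"
        by (simp add: sum_distrib_right sum_distrib_left mult_ac)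
      also have "\<dots> = lin v x * lin v y" unfolding cv lin_def[of v x] by (simp add: mult.commute)
      finally show ?thesis .
    qed
    have sc: "lin (inverse a *s v) x = inverse a * lin v x" for x
      by (simp add: lin_def sum_distrib_left mult_ac)
    have "inverse a * lin v (x * y) = inverse a * lin v x * (inverse a * lin v y)"
      if "x \<in> K" "y \<in> K" for x y
    proof -
      have "inverse a * lin v (x * y) = inverse a * inverse a * (lin v (x * y) * a)" using a by simp
      also have "\<dots> = inverse a * lin v x * (inverse a * lin v y)" unfolding mult[OF that] by (simp only: mult_ac)
      finally show ?thesis .
    qed
    then have "inverse a *s v \<in> chars"
      unfolding chars_def mem_Collect_eq sc a_def[symmetric] using a by simp
    then have "a *s (inverse a *s v) \<in> vec.span chars" by (intro vec.span_scale vec.span_base)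
    then show ?thesis using a by simp
  qed
  then have "vec.span (\<Inter>x\<in>range \<omega>. eig x) \<subseteq> vec.span chars"
    by (intro vec.span_minimal vec.subspace_span) auto
  then show ?thesis using joint_eig_span[of "range \<omega>"] basis_mem by auto
qed

text \<open>Dedekind's argument: evaluate the relation at multiples of \<open>\<omega> m\<close> and
  subtract \<open>s0 $ m\<close> times the relation. The term of \<open>s0\<close> drops out, and
  any other character differs from \<open>s0\<close> at some \<open>m\<close>. The last coefficient
  is read off at 1.\<close>

lemma chars_independent_aux:
  assumes "finite T" "T \<subseteq> chars" "(\<Sum>s\<in>T. u s *s s) = 0"
  shows "\<forall>s\<in>T. u s = 0"
  using assms
proof (induction T arbitrary: u rule: finite_induct)
  case empty
  then show ?case by simp
next
  case (insert s0 T)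
  have lin_comb: "(\<Sum>s\<in>insert s0 T. u s * lin s x) = 0" for x
  proof -
    have "(\<Sum>s\<in>insert s0 T. u s * lin s x)
        = (\<Sum>j\<in>UNIV. (\<Sum>s\<in>insert s0 T. u s *s s) $ j * of_rat (coord x j))"
      unfolding lin_def sum_component sum_distrib_right sum_distrib_left vector_smult_component
      by (subst sum.swap) (simp add: mult_ac)
    then show ?thesis using insert.prems by simp
  qed
  have T0: "\<forall>s\<in>T. u s * (s $ m - s0 $ m) = 0" for m
  proof (rule insert.IH)
    show "T \<subseteq> chars" using insert.prems by simp
    have "(\<Sum>s\<in>T. u s * (s $ m - s0 $ m) * s $ j) = 0" for j
    proof -
      have "(\<Sum>s\<in>insert s0 T. u s * lin s (\<omega> m * \<omega> j)) - s0 $ m * (\<Sum>s\<in>insert s0 T. u s * lin s (\<omega> j)) = 0"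
        by (simp only: lin_comb mult_zero_right diff_zero)
      moreover have "lin s (\<omega> m * \<omega> j) = s $ m * s $ j" if "s \<in> insert s0 T" for s
        using insert.prems(1) that basis_mem by (auto simp: chars_def lin_basis)
      ultimately have "(\<Sum>s\<in>insert s0 T. u s * (s $ m * s $ j)) - s0 $ m * (\<Sum>s\<in>insert s0 T. u s * s $ j) = 0"
        by (simp add: lin_basis)
      then have "(\<Sum>s\<in>insert s0 T. u s * (s $ m - s0 $ m) * s $ j) = 0"
        by (simp only: sum_distrib_left flip: sum_subtractf) (simp add: algebra_simps)
      then show ?thesis using insert.hyps by simp
    qed
    then show "(\<Sum>s\<in>T. (u s * (s $ m - s0 $ m)) *s s) = 0"
      by (simp add: vec_eq_iff sum_component)
  qed
  have uT: "u s = 0" if s: "s \<in> T" for s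
  proof -
    have "s \<noteq> s0" using s insert.hyps by auto
    then obtain m where "s $ m \<noteq> s0 $ m" by (auto simp: vec_eq_iff)
    then show ?thesis using T0[of m] s by auto
  qed
  moreover have "u s0 = 0"
    using lin_comb[of 1] uT insert.prems(1) insert.hyps by (simp add: chars_def)
  ultimately show ?case by auto
qed

lemma chars_independent: "vec.independent chars"
  unfolding vec.independent_explicit_module
  using chars_independent_aux by blast

lemma card_chars: "finite chars" "card chars = CARD('k)"
proof -
  show "finite chars" using chars_independent by (rule vec.finiteI_independent)
  have "card chars = vec.dim (UNIV :: (complex^'k) set)"
    using vec.dim_eq_card[of chars UNIV] chars_span chars_independent by (simp add: vec.span_UNIV)
  then show "card chars = CARD('k)" by (simp add: vec.dim_UNIV card_cart_basis)
qed

lemma lin_cnj: "lin (\<chi> j. cnj (s $ j)) x = cnj (lin s x)"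
proof -
  have "cnj (of_rat r) = of_rat r" for r
    by (cases r) (simp add: of_rat_rat)
  then show ?thesis by (simp add: lin_def cnj_sum)
qed

lemma cnj_chars: "s \<in> chars \<Longrightarrow> (\<chi> j. cnj (s $ j)) \<in> chars"
  by (simp add: chars_def lin_cnj)

end

section \<open>Coordinates and derivations\<close>

text \<open>What the analysis uses of the number field, apart from the product rule, which enters
  only with the phase: an invertible matrix \<open>S\<close>, in use the values of the characters on
  the basis, whose rows are permuted by conjugation. Fixed points of \<open>\<kappa>\<close> are the
  real places, pairs exchanged by it the complex ones.\<close>

locale conj_frame =
  fixes S T :: "'k::finite \<Rightarrow> 'k \<Rightarrow> complex" and \<kappa> :: "'k \<Rightarrow> 'k"
  assumes ST: "\<And>i j. (\<Sum>m\<in>UNIV. S i m * T m j) = (if i = j then 1 else 0)"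
    and TS: "\<And>m l. (\<Sum>j\<in>UNIV. T m j * S j l) = (if m = l then 1 else 0)"
    and S_cnj: "\<And>j m. S (\<kappa> j) m = cnj (S j m)"
begin

definition Y :: "'k \<Rightarrow> real^'k \<Rightarrow> complex" where
  "Y j x = (\<Sum>m\<in>UNIV. S j m * of_real (x $ m))"

lemma kappa_kappa [simp]: "\<kappa> (\<kappa> j) = j"
proof -
  have "(\<Sum>m\<in>UNIV. S (\<kappa> (\<kappa> j)) m * T m j) = (\<Sum>m\<in>UNIV. S j m * T m j)" by (simp add: S_cnj)
  then show ?thesis by (simp add: ST split: if_splits)
qed

lemma kappa_eq_iff: "\<kappa> i = j \<longleftrightarrow> i = \<kappa> j"
  by (metis kappa_kappa)

lemma Y_cnj: "Y (\<kappa> j) x = cnj (Y j x)"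
  by (simp add: Y_def S_cnj cnj_sum)

text \<open>Conjugating \<open>T\<close> and permuting its columns by \<open>\<kappa>\<close> gives
  another inverse of \<open>S\<close>, and inverses are unique.\<close>

lemma T_cnj: "T m (\<kappa> j) = cnj (T m j)"
proof -
  have "(\<Sum>l\<in>UNIV. S i l * cnj (T l j)) = (if i = \<kappa> j then 1 else 0)" for i
  proof -
    have "(\<Sum>l\<in>UNIV. S i l * cnj (T l j)) = cnj (\<Sum>l\<in>UNIV. S (\<kappa> i) l * T l j)"
      by (simp add: S_cnj cnj_sum)
    then show ?thesis by (auto simp: ST kappa_eq_iff)
  qed
  then have "(\<Sum>i\<in>UNIV. T m i * (\<Sum>l\<in>UNIV. S i l * cnj (T l j))) = T m (\<kappa> j)"
    by (simp add: if_distrib[of "\<lambda>c. _ * c"] cong: if_cong)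
  moreover have "(\<Sum>i\<in>UNIV. T m i * (\<Sum>l\<in>UNIV. S i l * cnj (T l j)))
      = (\<Sum>l\<in>UNIV. (\<Sum>i\<in>UNIV. T m i * S i l) * cnj (T l j))"
    unfolding sum_distrib_left sum_distrib_right by (subst sum.swap) (simp add: mult_ac)
  ultimately show ?thesis
    by (simp add: TS if_distrib[of "\<lambda>c. c * _"] cong: if_cong)
qed

lemma linear_Y: "bounded_linear (Y j)"
  unfolding Y_def
  by (intro bounded_linear_sum bounded_linear_const_mult bounded_linear_compose[OF bounded_linear_of_real]
      bounded_linear_vec_nth)

lemma Y_inverse: "(\<Sum>j\<in>UNIV. T m j * Y j x) = of_real (x $ m)"
proof -
  have "(\<Sum>j\<in>UNIV. T m j * Y j x) = (\<Sum>l\<in>UNIV. (\<Sum>j\<in>UNIV. T m j * S j l) * of_real (x $ l))"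
    unfolding Y_def sum_distrib_left sum_distrib_right by (subst sum.swap) (simp add: mult_ac)
  then show ?thesis by (simp add: TS if_distrib[of "\<lambda>c. c * _"] cong: if_cong)
qed

text \<open>The formula that inverts \<open>Y\<close> gives real coordinates, because conjugation
  only permutes the terms of the sum. This allows coordinates of different points to be combined
  into one point.\<close>

lemma Y_surj:
  assumes "\<And>j. y (\<kappa> j) = cnj (y j)"
  shows "\<exists>x. \<forall>j. Y j x = y j"
proof -
  define x where "x = (\<chi> m. Re (\<Sum>j\<in>UNIV. T m j * y j))"
  have "of_real (x $ m) = (\<Sum>j\<in>UNIV. T m j * y j)" for m
  proof -
    have "cnj (\<Sum>j\<in>UNIV. T m j * y j) = (\<Sum>j\<in>UNIV. T m (\<kappa> j) * y (\<kappa> j))"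
      by (simp add: assms T_cnj cnj_sum)
    also have "\<dots> = (\<Sum>j\<in>UNIV. T m j * y j)"
      by (rule sum.reindex_bij_witness[of _ \<kappa> \<kappa>]) auto
    finally have "(\<Sum>j\<in>UNIV. T m j * y j) \<in> \<real>" by (simp add: Reals_cnj_iff)
    then show ?thesis unfolding x_def by (simp del: Re_sum)
  qed
  then have "Y i x = (\<Sum>j\<in>UNIV. (\<Sum>m\<in>UNIV. S i m * T m j) * y j)" for i
    unfolding Y_def sum_distrib_left sum_distrib_right by simp (subst sum.swap, simp add: sum_distrib_left mult_ac)
  then have "Y i x = y i" for i
    by (simp add: ST if_distrib[of "\<lambda>c. c * _"] cong: if_cong)
  then show ?thesis by blast
qed

lemma norm_le_Y: "\<exists>C>0. \<forall>x. norm x \<le> C * (\<Sum>j\<in>UNIV. norm (Y j x))"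
proof -
  define C where "C = 1 + (\<Sum>m\<in>UNIV. \<Sum>j\<in>UNIV. norm (T m j))"
  have "norm x \<le> C * (\<Sum>j\<in>UNIV. norm (Y j x))" for x
  proof -
    have "norm x \<le> (\<Sum>m\<in>UNIV. \<bar>x $ m\<bar>)" by (rule norm_le_l1_cart)
    also have "\<dots> = (\<Sum>m\<in>UNIV. norm (\<Sum>j\<in>UNIV. T m j * Y j x))" by (simp add: Y_inverse)
    also have "\<dots> \<le> (\<Sum>m\<in>UNIV. \<Sum>j\<in>UNIV. norm (T m j) * (\<Sum>j\<in>UNIV. norm (Y j x)))"
    proof (intro sum_mono order.trans[OF norm_sum])
      fix m j
      show "norm (T m j * Y j x) \<le> norm (T m j) * (\<Sum>j\<in>UNIV. norm (Y j x))"
        unfolding norm_mult by (intro mult_left_mono member_le_sum) auto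
    qed
    also have "\<dots> \<le> C * (\<Sum>j\<in>UNIV. norm (Y j x))"
      by (simp add: C_def sum_distrib_right distrib_right sum_nonneg)
    finally show ?thesis .
  qed
  moreover have "C > 0" unfolding C_def by (intro add_pos_nonneg sum_nonneg) auto
  ultimately show ?thesis by blast
qed

text \<open>The derivations dual to the coordinates \<open>Y\<close>; at a complex place this is the Wirtinger
  derivative.\<close>

definition D :: "'k \<Rightarrow> (real^'k \<Rightarrow> complex) \<Rightarrow> real^'k \<Rightarrow> complex" where
  "D j g x = (\<Sum>m\<in>UNIV. T m j * frechet_derivative g (at x) (axis m 1))"

lemma D_eq: "(g has_derivative g') (at x) \<Longrightarrow> D j g x = (\<Sum>m\<in>UNIV. T m j * g' (axis m 1))"
  by (simp add: D_def frechet_derivative_at[symmetric])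

lemma D_const [simp]: "D j (\<lambda>_. c) x = 0"
  by (simp add: D_eq[OF has_derivative_const])

lemma Y_axis: "Y i (axis m 1) = S i m"
  by (simp add: Y_def axis_def if_distrib[of of_real] if_distrib[of "\<lambda>c. _ * c"] cong: if_cong)

lemma Y_derivative: "(Y i has_derivative Y i) (at x)"
  using linear_Y by (rule bounded_linear_imp_has_derivative)

lemma D_Y: "D j (Y i) x = (if i = j then 1 else 0)"
  by (simp add: D_eq[OF Y_derivative] Y_axis mult.commute[of "T _ _"] ST)

lemma D_chain:
  assumes "g differentiable at x" "(f has_field_derivative f') (at (g x))"
  shows "(\<lambda>x. f (g x)) differentiable at x" "D j (\<lambda>x. f (g x)) x = f' * D j g x"
proof -
  obtain g' where g': "(g has_derivative g') (at x)" using assms(1) by (auto simp: differentiable_def)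
  have d: "((\<lambda>x. f (g x)) has_derivative (\<lambda>h. f' * g' h)) (at x)"
    using has_derivative_compose[OF g', of f "(*) f'"] assms(2) by (simp add: has_field_derivative_def)
  then show "(\<lambda>x. f (g x)) differentiable at x" by (auto simp: differentiable_def)
  show "D j (\<lambda>x. f (g x)) x = f' * D j g x"
    by (simp add: D_eq[OF d] D_eq[OF g'] sum_distrib_left mult_ac)
qed

lemma D_add:
  assumes "f differentiable at x" "g differentiable at x"
  shows "D j (\<lambda>x. f x + g x) x = D j f x + D j g x"
proof -
  obtain f' g' where d: "(f has_derivative f') (at x)" "(g has_derivative g') (at x)"
    using assms by (auto simp: differentiable_def)
  show ?thesis
    by (simp add: D_eq[OF has_derivative_add[OF d]] D_eq[OF d(1)] D_eq[OF d(2)] distrib_left sum.distrib)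
qed

lemma D_mult:
  assumes "f differentiable at x" "g differentiable at x"
  shows "D j (\<lambda>x. f x * g x) x = D j f x * g x + f x * D j g x"
proof -
  obtain f' g' where d: "(f has_derivative f') (at x)" "(g has_derivative g') (at x)"
    using assms by (auto simp: differentiable_def)
  show ?thesis
    by (simp add: D_eq[OF has_derivative_mult[OF d]] D_eq[OF d(1)] D_eq[OF d(2)] distrib_left sum.distrib
        sum_distrib_left sum_distrib_right mult_ac)
qed

lemma D_cong:
  assumes "g differentiable at x" "open U" "x \<in> U" "\<And>x. x \<in> U \<Longrightarrow> g x = h x"
  shows "h differentiable at x" "D j h x = D j g x"
proof -
  obtain g' where g': "(g has_derivative g') (at x)" using assms(1) by (auto simp: differentiable_def)
  have "(h has_derivative g') (at x)"
    using has_derivative_transform_within_open[OF g' assms(2,3,4)] by blast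
  then show "h differentiable at x" "D j h x = D j g x"
    using D_eq g' by (auto simp: differentiable_def)
qed

section \<open>Calculus of weighted derivative bounds\<close>

text \<open>\<open>bd \<delta> U m w g\<close>: the iterated derivatives of \<open>g\<close> of order up to \<open>m\<close> are bounded on \<open>U\<close> by
  the weight \<open>w\<close>, where each derivative in the direction \<open>j\<close> costs a factor \<open>1 / \<delta> j\<close>.\<close>

primrec bd :: "('k \<Rightarrow> real) \<Rightarrow> (real^'k) set \<Rightarrow> nat \<Rightarrow> (real^'k \<Rightarrow> real) \<Rightarrow> (real^'k \<Rightarrow> complex) \<Rightarrow> bool" where
  "bd \<delta> U 0 w g \<longleftrightarrow> (\<forall>x\<in>U. norm (g x) \<le> w x)"
| "bd \<delta> U (Suc m) w g \<longleftrightarrow> (\<forall>x\<in>U. norm (g x) \<le> w x \<and> g differentiable at x) \<and>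
     (\<forall>j. bd \<delta> U m (\<lambda>x. w x / \<delta> j) (D j g))"

lemma bd_norm: "bd \<delta> U m w g \<Longrightarrow> x \<in> U \<Longrightarrow> norm (g x) \<le> w x"
  by (cases m) auto

lemma bd_nonneg: "bd \<delta> U m w g \<Longrightarrow> x \<in> U \<Longrightarrow> 0 \<le> w x"
  using bd_norm norm_ge_zero order_trans by blast

lemma bd_cong:
  assumes "open U" "\<And>x. x \<in> U \<Longrightarrow> g x = h x" "bd \<delta> U m w g"
  shows "bd \<delta> U m w h"
  using assms(2,3)
proof (induction m arbitrary: g h w)
  case 0
  then show ?case by simp
next
  case (Suc m)
  have *: "h differentiable at x" "D j h x = D j g x" if "x \<in> U" for x j
    using D_cong[of g x U h] Suc.prems that \<open>open U\<close> by auto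
  show ?case
    using Suc.prems * Suc.IH[of "D _ g" "D _ h"] by simp
qed

lemma bd_weight:
  assumes "\<And>j. 0 < \<delta> j" "\<And>x. x \<in> U \<Longrightarrow> w x \<le> w' x" "bd \<delta> U m w g"
  shows "bd \<delta> U m w' g"
  using assms(2,3)
proof (induction m arbitrary: g w w')
  case 0
  then show ?case by force
next
  case (Suc m)
  have "bd \<delta> U m (\<lambda>x. w' x / \<delta> j) (D j g)" for j
    by (rule Suc.IH[of "\<lambda>x. w x / \<delta> j"]) (use Suc.prems assms(1)[of j] in \<open>auto intro!: divide_right_mono\<close>)
  then show ?case using Suc.prems by force
qed

lemma bd_Suc: "bd \<delta> U (Suc m) w g \<Longrightarrow> bd \<delta> U m w g"
  by (induction m arbitrary: g w) auto

lemma bd_le: "m \<le> m' \<Longrightarrow> bd \<delta> U m' w g \<Longrightarrow> bd \<delta> U m w g"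
  by (induction m' rule: dec_induct) (auto dest: bd_Suc simp del: bd.simps)

lemma bd_subset: "V \<subseteq> U \<Longrightarrow> bd \<delta> U m w g \<Longrightarrow> bd \<delta> V m w g"
  by (induction m arbitrary: g w) auto

lemma bd_delta:
  assumes "\<And>j. 0 < \<delta>' j" "\<And>j. \<delta>' j \<le> \<delta> j" "bd \<delta> U m w g"
  shows "bd \<delta>' U m w g"
  using assms(3)
proof (induction m arbitrary: g w)
  case (Suc m)
  have "bd \<delta>' U m (\<lambda>x. w x / \<delta>' j) (D j g)" for j
  proof (rule bd_weight[OF assms(1)])
    show "bd \<delta>' U m (\<lambda>x. w x / \<delta> j) (D j g)" using Suc by simp
    show "w x / \<delta> j \<le> w x / \<delta>' j" if "x \<in> U" for x
      using bd_nonneg[OF Suc.prems that] assms(1)[of j] assms(2)[of j] by (intro divide_left_mono) auto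
  qed
  then show ?case using Suc.prems by simp
qed auto

lemma bd_const: "(\<And>j. 0 < \<delta> j) \<Longrightarrow> norm c \<le> C \<Longrightarrow> bd \<delta> U m (\<lambda>_. C) (\<lambda>_. c)"
proof (induction m arbitrary: c C)
  case (Suc m)
  have "bd \<delta> U m (\<lambda>_. C / \<delta> j) (D j (\<lambda>_. c))" for j
  proof -
    have "D j (\<lambda>_. c) = (\<lambda>_. 0)" by (rule ext) simp
    moreover have "0 \<le> C / \<delta> j"
      using Suc.prems(1)[of j] order_trans[OF norm_ge_zero Suc.prems(2)] by simp
    ultimately show ?thesis using Suc.IH[OF Suc.prems(1), of 0 "C / \<delta> j"] by simp
  qed
  then show ?case using Suc.prems by simp
qed simp

lemma bd_add:
  assumes "open U" "bd \<delta> U m w1 g1" "bd \<delta> U m w2 g2"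
  shows "bd \<delta> U m (\<lambda>x. w1 x + w2 x) (\<lambda>x. g1 x + g2 x)"
  using assms(2,3)
proof (induction m arbitrary: g1 g2 w1 w2)
  case 0
  then show ?case by (auto intro: norm_triangle_mono)
next
  case (Suc m)
  have "bd \<delta> U m (\<lambda>x. w1 x / \<delta> j + w2 x / \<delta> j) (\<lambda>x. D j g1 x + D j g2 x)" for j
    using Suc by (intro Suc.IH) auto
  then have "bd \<delta> U m (\<lambda>x. (w1 x + w2 x) / \<delta> j) (\<lambda>x. D j g1 x + D j g2 x)" for j
    by (simp add: add_divide_distrib)
  then have "bd \<delta> U m (\<lambda>x. (w1 x + w2 x) / \<delta> j) (D j (\<lambda>x. g1 x + g2 x))" for j
    by (rule bd_cong[OF \<open>open U\<close>, rotated]) (use Suc.prems D_add in auto)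
  then show ?case using Suc.prems by (auto intro: norm_triangle_mono)
qed

lemma bd_sum:
  assumes "open U" "\<And>j. 0 < \<delta> j" "finite I" "\<And>i. i \<in> I \<Longrightarrow> bd \<delta> U m (w i) (g i)"
  shows "bd \<delta> U m (\<lambda>x. \<Sum>i\<in>I. w i x) (\<lambda>x. \<Sum>i\<in>I. g i x)"
  using assms(3,4)
proof (induction I rule: finite_induct)
  case empty
  show ?case using bd_const[of \<delta> 0 0 U m] assms(2) by simp
next
  case (insert i I)
  then show ?case using bd_add[OF \<open>open U\<close>, of \<delta> m "w i" "g i"] by simp
qed

lemma bd_mult:
  assumes "open U" "\<And>j. 0 < \<delta> j" "bd \<delta> U m w1 g1" "bd \<delta> U m w2 g2"
  shows "bd \<delta> U m (\<lambda>x. 2 ^ m * w1 x * w2 x) (\<lambda>x. g1 x * g2 x)"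
  using assms(3,4)
proof (induction m arbitrary: g1 g2 w1 w2)
  case 0
  then show ?case by (auto simp: norm_mult intro!: mult_mono intro: order_trans[OF norm_ge_zero])
next
  case (Suc m)
  have g: "bd \<delta> U m w1 g1" "bd \<delta> U m w2 g2"
    and Dg: "bd \<delta> U m (\<lambda>x. w1 x / \<delta> j) (D j g1)" "bd \<delta> U m (\<lambda>x. w2 x / \<delta> j) (D j g2)" for j
    using Suc.prems Suc.prems[THEN bd_Suc] by auto
  note sum2 = bd_add[OF \<open>open U\<close> Suc.IH[OF Dg(1) g(2)] Suc.IH[OF g(1) Dg(2)]]
  have "bd \<delta> U m (\<lambda>x. 2 ^ Suc m * w1 x * w2 x / \<delta> j) (\<lambda>x. D j g1 x * g2 x + g1 x * D j g2 x)" for j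
    using sum2[of j j] by (simp add: mult_ac)
  then have "bd \<delta> U m (\<lambda>x. 2 ^ Suc m * w1 x * w2 x / \<delta> j) (D j (\<lambda>x. g1 x * g2 x))" for j
    by (rule bd_cong[OF \<open>open U\<close>, rotated]) (use Suc.prems D_mult in auto)
  moreover have "norm (g1 x * g2 x) \<le> 2 ^ Suc m * w1 x * w2 x" if x: "x \<in> U" for x
  proof -
    have "norm (g1 x * g2 x) \<le> w1 x * w2 x" unfolding norm_mult
      using mult_mono[OF bd_norm[OF Suc.prems(1) x] bd_norm[OF Suc.prems(2) x]]
        bd_nonneg[OF Suc.prems(1) x] by simp
    also have "\<dots> \<le> 2 ^ Suc m * (w1 x * w2 x)"
      using bd_nonneg[OF Suc.prems(1) x] bd_nonneg[OF Suc.prems(2) x] one_le_power[of "2::real" "Suc m"]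
      using mult_right_mono[of 1 "2 ^ Suc m" "w1 x * w2 x"] by (simp del: power_Suc)
    finally show ?thesis by (simp add: mult_ac)
  qed
  ultimately show ?case using Suc.prems by simp
qed

lemma bd_cmult:
  assumes "open U" "\<And>j. 0 < \<delta> j" "bd \<delta> U m w g"
  shows "bd \<delta> U m (\<lambda>x. norm c * w x) (\<lambda>x. c * g x)"
  using assms(3)
proof (induction m arbitrary: g w)
  case 0
  then show ?case by (auto simp: norm_mult intro!: mult_left_mono)
next
  case (Suc m)
  have "bd \<delta> U m (\<lambda>x. norm c * w x / \<delta> j) (D j (\<lambda>x. c * g x))" for j
  proof (rule bd_cong[OF \<open>open U\<close>])
    show "bd \<delta> U m (\<lambda>x. norm c * w x / \<delta> j) (\<lambda>x. c * D j g x)"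
      using Suc.IH[of "\<lambda>x. w x / \<delta> j" "D j g"] Suc.prems by simp
    show "c * D j g x = D j (\<lambda>x. c * g x) x" if "x \<in> U" for x
      using D_mult[of "\<lambda>_. c" x g j] Suc.prems that by simp
  qed
  then show ?case using Suc.prems by (auto simp: norm_mult intro!: mult_left_mono)
qed

lemma bd_prod:
  assumes "open U" "\<And>j. 0 < \<delta> j" "1 \<le> C" "finite I" "\<And>i. i \<in> I \<Longrightarrow> bd \<delta> U m (\<lambda>_. C) (g i)"
  shows "bd \<delta> U m (\<lambda>_. (2 ^ m * C) ^ card I) (\<lambda>x. \<Prod>i\<in>I. g i x)"
  using assms(4,5)
proof (induction I rule: finite_induct)
  case empty
  show ?case using bd_const[of \<delta> 1 1 U m] assms(2) by simp
next
  case (insert i I)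
  then have "bd \<delta> U m (\<lambda>_. 2 ^ m * C * (2 ^ m * C) ^ card I) (\<lambda>x. g i x * (\<Prod>i\<in>I. g i x))"
    by (intro bd_mult assms(1,2)) auto
  then show ?case using insert by simp
qed

text \<open>The weight \<open>w\<close> bounds \<open>g\<close> from below and, up to
  \<open>C\<close>, its derivatives from above. In \<open>D (1/g) = - D g / g^2\<close> the two
  factors \<open>1 / w\<close> and the factor \<open>C * w\<close> combine to a single
  \<open>1 / w\<close>, so the induction keeps its form, with a constant that depends on
  \<open>m\<close> and \<open>C\<close> only.\<close>

lemma bd_inverse:
  "\<exists>K. \<forall>\<delta> U w g. open U \<longrightarrow> (\<forall>j. 0 < \<delta> j) \<longrightarrow> bd \<delta> U m (\<lambda>x. C * w x) g \<longrightarrow>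
     (\<forall>x\<in>U. 0 < w x \<and> w x \<le> norm (g x)) \<longrightarrow> bd \<delta> U m (\<lambda>x. K / w x) (\<lambda>x. inverse (g x))"
proof (induction m)
  case 0
  have "norm (inverse (g x)) \<le> 1 / w x" if "0 < w x" "w x \<le> norm (g x)" for w and g :: "real^'k \<Rightarrow> complex" and x
    using that by (simp add: norm_inverse divide_inverse le_imp_inverse_le)
  then show ?case by (intro exI[of _ 1]) auto
next
  case (Suc m)
  then obtain K where K: "\<And>\<delta> U w g. open U \<Longrightarrow> (\<And>j. 0 < \<delta> j) \<Longrightarrow> bd \<delta> U m (\<lambda>x. C * w x) g \<Longrightarrow>
     (\<And>x. x\<in>U \<Longrightarrow> 0 < w x \<and> w x \<le> norm (g x)) \<Longrightarrow> bd \<delta> U m (\<lambda>x. K / w x) (\<lambda>x. inverse (g x))"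
    by metis
  define L where "L = max 1 (2 ^ m * C * (2 ^ m * K * K))"
  have "bd \<delta> U (Suc m) (\<lambda>x. L / w x) (\<lambda>x. inverse (g x))"
    if U: "open U" and \<delta>: "\<And>j. 0 < \<delta> j" and g: "bd \<delta> U (Suc m) (\<lambda>x. C * w x) g"
      and w: "\<And>x. x\<in>U \<Longrightarrow> 0 < w x \<and> w x \<le> norm (g x)" for \<delta> U w g
  proof -
    have g0: "g x \<noteq> 0" if "x \<in> U" for x using w[OF that] by auto
    have dg: "g differentiable at x" if "x \<in> U" for x using g that by simp
    have inv: "(\<lambda>x. inverse (g x)) differentiable at x"
      "D j (\<lambda>x. inverse (g x)) x = - (inverse (g x) * inverse (g x)) * D j g x" if "x \<in> U" for x j
      using D_chain[OF dg[OF that], of inverse "- (inverse (g x) * inverse (g x))"]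
        DERIV_inverse[OF g0[OF that]] by (auto simp: power2_eq_square numeral_2_eq_2)
    have ig: "bd \<delta> U m (\<lambda>x. K / w x) (\<lambda>x. inverse (g x))"
      by (rule K[OF U \<delta> bd_Suc[OF g] w])
    have "bd \<delta> U m (\<lambda>x. L / w x / \<delta> j) (D j (\<lambda>x. inverse (g x)))" for j
    proof (rule bd_cong[OF U])
      have "bd \<delta> U m (\<lambda>x. 2 ^ m * (norm (-1 :: complex) * (2 ^ m * (K / w x) * (K / w x))) * (C * w x / \<delta> j))
          (\<lambda>x. (- 1) * (inverse (g x) * inverse (g x)) * D j g x)"
        using g by (intro bd_mult bd_cmult U \<delta> ig) simp
      then show "bd \<delta> U m (\<lambda>x. L / w x / \<delta> j) (\<lambda>x. (- 1) * (inverse (g x) * inverse (g x)) * D j g x)"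
      proof (rule bd_weight[OF \<delta>, rotated])
        fix x assume x: "x \<in> U"
        have "2 ^ m * (norm (-1 :: complex) * (2 ^ m * (K / w x) * (K / w x))) * (C * w x / \<delta> j)
            = (2 ^ m * C * (2 ^ m * K * K)) / w x / \<delta> j"
          using w[OF x] \<delta>[of j] by (simp add: field_simps)
        also have "\<dots> \<le> L / w x / \<delta> j"
          using w[OF x] \<delta>[of j] by (intro divide_right_mono) (auto simp: L_def)
        finally show "2 ^ m * (norm (-1 :: complex) * (2 ^ m * (K / w x) * (K / w x))) * (C * w x / \<delta> j)
            \<le> L / w x / \<delta> j" .
      qed
    qed (use inv in simp)
    moreover have "norm (inverse (g x)) \<le> L / w x" if "x \<in> U" for x
    proof -
      have "norm (inverse (g x)) \<le> 1 / w x"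
        using w[OF that] by (simp add: norm_inverse divide_inverse le_imp_inverse_le)
      also have "\<dots> \<le> L / w x" using w[OF that] by (intro divide_right_mono) (auto simp: L_def)
      finally show ?thesis .
    qed
    ultimately show ?thesis using inv by simp
  qed
  then show ?case by blast
qed

text \<open>Only \<open>D i\<close> sees a polynomial in \<open>Y i\<close>; all other derivations,
  also the one at a distinct conjugate place, give zero. Hence ordinary derivatives at the scale
  \<open>\<delta> i\<close> are all that has to be bounded.\<close>

lemma bd_poly:
  assumes "open U" "\<And>j. 0 < \<delta> j" "0 \<le> C"
    "\<And>r x. r \<le> m \<Longrightarrow> x \<in> U \<Longrightarrow> norm (poly ((pderiv ^^ r) q) (Y i x)) \<le> C * w x / \<delta> i ^ r"
    "\<And>x. x \<in> U \<Longrightarrow> 0 \<le> w x"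
  shows "bd \<delta> U m (\<lambda>x. C * w x) (\<lambda>x. poly q (Y i x))"
  using assms(4,5)
proof (induction m arbitrary: q w)
  case 0
  show ?case using "0.prems"(1)[of 0] by simp
next
  case (Suc m)
  have yd: "Y i differentiable at x" for x
    using Y_derivative by (auto simp: differentiable_def)
  have d: "(\<lambda>x. poly q (Y i x)) differentiable at x"
    "D j (\<lambda>x. poly q (Y i x)) x = (if i = j then poly (pderiv q) (Y i x) else 0)" for x j
    using D_chain[of "Y i" x "poly q", OF yd poly_DERIV] by (simp_all add: D_Y)
  have "bd \<delta> U m (\<lambda>x. C * w x / \<delta> j) (D j (\<lambda>x. poly q (Y i x)))" for j
  proof (rule bd_cong[OF \<open>open U\<close> d(2)[symmetric]])
    show "bd \<delta> U m (\<lambda>x. C * w x / \<delta> j) (\<lambda>x. if i = j then poly (pderiv q) (Y i x) else 0)"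
    proof (cases "i = j")
      case True
      have "bd \<delta> U m (\<lambda>x. C * (w x / \<delta> i)) (\<lambda>x. poly (pderiv q) (Y i x))"
      proof (rule Suc.IH)
        fix r x assume r: "r \<le> m" "x \<in> U"
        have "norm (poly ((pderiv ^^ Suc r) q) (Y i x)) \<le> C * w x / \<delta> i ^ Suc r"
          using r by (intro Suc.prems) auto
        then show "norm (poly ((pderiv ^^ r) (pderiv q)) (Y i x)) \<le> C * (w x / \<delta> i) / \<delta> i ^ r"
          by (simp add: funpow_swap1 field_simps)
      qed (use assms(2)[of i] Suc.prems(2) in simp)
      then show ?thesis using True by simp
    next
      case False
      have "bd \<delta> U m (\<lambda>x. C * w x / \<delta> j) (\<lambda>x. 0)"
        by (rule bd_weight[OF assms(2) _ bd_const[OF assms(2), of 0 0]])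
          (use assms(2)[of j] assms(3) Suc.prems(2) in auto)
      then show ?thesis using False by simp
    qed
  qed
  then show ?case using d Suc.prems(1)[of 0] by simp
qed

end

section \<open>Cutoff functions and integration by parts\<close>

text \<open>At 0, where the two branches meet, the difference quotient is at most \<open>|h|\<close>
  for small \<open>h\<close>, because the exponent is at least 2.\<close>

lemma max_power_DERIV:
  assumes "2 \<le> M"
  shows "((\<lambda>t::real. max 0 t ^ M) has_real_derivative real M * max 0 t ^ (M - 1)) (at t)"
proof -
  consider "t < 0" | "t > 0" | "t = 0" by linarith
  then show ?thesis
  proof cases
    case 1
    have "((\<lambda>t::real. max 0 t ^ M) has_real_derivative 0) (at t)"
      by (rule has_field_derivative_transform_within_open[of "\<lambda>_. 0" _ _ "{..<0}"]) (use 1 assms in auto)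
    then show ?thesis using 1 assms by (simp add: zero_power)
  next
    case 2
    have "((\<lambda>t::real. max 0 t ^ M) has_real_derivative real M * t ^ (M - 1)) (at t)"
    proof (rule has_field_derivative_transform_within_open[of "\<lambda>t. t ^ M" _ _ "{0<..}"])
      show "((\<lambda>t. t ^ M) has_real_derivative real M * t ^ (M - 1)) (at t)"
        by (rule derivative_eq_intros refl | simp)+
    qed (use 2 in auto)
    then show ?thesis using 2 by simp
  next
    case 3
    have "((\<lambda>h::real. (max 0 (0 + h) ^ M - max 0 0 ^ M) / h) \<longlongrightarrow> 0) (at 0)"
    proof (rule Lim_null_comparison)
      show "((\<lambda>h::real. \<bar>h\<bar>) \<longlongrightarrow> 0) (at 0)" by (rule tendsto_rabs_zero) (rule tendsto_ident_at)
      have "norm ((max 0 (0 + h) ^ M - max 0 0 ^ M) / h) \<le> \<bar>h\<bar>" if "h \<noteq> 0" "\<bar>h\<bar> < 1" for h :: real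
      proof -
        have "max 0 h ^ M \<le> max 0 h ^ 2" using that assms by (intro power_decreasing) auto
        also have "\<dots> \<le> h\<^sup>2" by (cases "0 \<le> h") auto
        finally have "\<bar>max 0 h ^ M\<bar> \<le> \<bar>h\<bar> * \<bar>h\<bar>" by (simp add: power2_eq_square)
        then have "\<bar>max 0 h ^ M\<bar> / \<bar>h\<bar> \<le> \<bar>h\<bar>" using that by (simp add: divide_le_eq)
        then show ?thesis using assms by (simp add: zero_power)
      qed
      then show "\<forall>\<^sub>F h in at 0. norm ((max 0 (0 + h) ^ M - max 0 0 ^ M) / h) \<le> \<bar>h\<bar>"
        unfolding eventually_at by (intro exI[of _ 1]) (auto simp: dist_real_def)
    qed
    then have "((\<lambda>t::real. max 0 t ^ M) has_real_derivative 0) (at 0)" by (rule DERIV_def[THEN iffD2])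
    then show ?thesis using 3 assms by (simp add: zero_power)
  qed
qed

text \<open>Finite smoothness suffices, as the number of integrations by parts is fixed. The affine
  function of \<open>t = 1 / (1 + r^2)\<close> is 1 at \<open>t = 1/2\<close>, that is
  \<open>r = 1\<close>, and 0 at \<open>t = 1/5\<close>, that is \<open>r = 2\<close>; the two
  powers of positive parts flatten the result to 0 inside and 1 outside. The variable
  \<open>t\<close> is a rational function of a coordinate and its conjugate, with bounded
  derivatives.\<close>

definition cut :: "nat \<Rightarrow> real \<Rightarrow> real" where
  "cut M r = max 0 (1 - max 0 (10 / 3 * (1 / (1 + r\<^sup>2) - 1 / 5)) ^ M) ^ M"

lemma cut_eq_0:
  assumes "0 < M" "0 \<le> r" "r \<le> 1"
  shows "cut M r = 0"
proof -
  have "r\<^sup>2 \<le> 1" using assms by (simp add: power_le_one)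
  moreover have "0 < 1 + r\<^sup>2" by (simp add: add_pos_nonneg)
  ultimately have "1 / 2 \<le> 1 / (1 + r\<^sup>2)" by (simp add: field_simps)
  then have "1 \<le> 10 / 3 * (1 / (1 + r\<^sup>2) - 1 / 5)" by simp
  then have "1 \<le> max 0 (10 / 3 * (1 / (1 + r\<^sup>2) - 1 / 5)) ^ M" by (intro one_le_power) auto
  then have "max 0 (1 - max 0 (10 / 3 * (1 / (1 + r\<^sup>2) - 1 / 5)) ^ M) = 0" by simp
  then show ?thesis using assms by (simp add: cut_def)
qed

lemma cut_eq_1:
  assumes "0 < M" "2 \<le> r"
  shows "cut M r = 1"
proof -
  have "4 \<le> r\<^sup>2" using power_mono[of 2 r 2] assms by simp
  then have "1 / (1 + r\<^sup>2) \<le> 1 / 5" by (simp add: field_simps)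
  then have "10 / 3 * (1 / (1 + r\<^sup>2) - 1 / 5) \<le> 0" by simp
  then have "max 0 (10 / 3 * (1 / (1 + r\<^sup>2) - 1 / 5)) = 0" by simp
  then show ?thesis using assms by (simp add: cut_def zero_power)
qed

section \<open>Integrals of derivatives of compactly supported functions\<close>

lemma integrable_compact_support:
  fixes f :: "'a::euclidean_space \<Rightarrow> 'b::euclidean_space"
  assumes "continuous_on UNIV f" "compact C" "\<And>x. x \<notin> C \<Longrightarrow> f x = 0"
  shows "integrable lborel f"
proof -
  have "integrable lborel (\<lambda>x. indicator C x *\<^sub>R f x)"
    using assms by (intro borel_integrable_compact) (auto intro: continuous_on_subset)
  moreover have "(\<lambda>x. indicator C x *\<^sub>R f x) = f" using assms(3) by (auto simp: indicator_def)
  ultimately show ?thesis by simp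
qed

lemma integral_translate:
  fixes f :: "'a::euclidean_space \<Rightarrow> 'b::{banach, second_countable_topology}"
  assumes "f \<in> borel_measurable borel"
  shows "(LINT x|lborel. f (x + a)) = (LINT x|lborel. f x)"
proof -
  have "(LINT x|lborel. f x) = (LINT x|distr lborel borel ((+) a). f x)"
    by (simp add: lborel_distr_plus)
  also have "\<dots> = (LINT x|lborel. f (a + x))" using assms by (subst integral_distr) auto
  finally show ?thesis by (simp add: add.commute)
qed

text \<open>Difference quotients of \<open>g\<close> integrate to zero by translation invariance.
  They are bounded by the derivative and vanish off one fixed ball, so dominated convergence
  applies.\<close>

lemma integral_directional_derivative:
  fixes g :: "'a::euclidean_space \<Rightarrow> complex"
  assumes der: "\<And>x. (g has_derivative g' x) (at x)"
    and cont: "continuous_on UNIV (\<lambda>x. g' x e)"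
    and C: "compact C" "\<And>x. x \<notin> C \<Longrightarrow> g x = 0"
  shows "(LINT x|lborel. g' x e) = 0"
proof -
  have gc: "continuous_on UNIV g"
    using der by (intro has_derivative_continuous_on[of UNIV g g']) simp
  obtain R where R: "\<And>x. x \<in> C \<Longrightarrow> norm x \<le> R" using C(1) compact_imp_bounded bounded_iff by metis
  have zero: "g' x e = 0" if "x \<notin> C" for x
  proof -
    have "open (- C)" using C(1) by (simp add: compact_imp_closed open_Compl)
    then have "(g has_derivative (\<lambda>_. 0)) (at x)"
      by (rule has_derivative_transform_within_open[OF has_derivative_const[of 0]]) (use that C(2) in auto)
    then show ?thesis using has_derivative_unique[OF der] by metis
  qed
  have "bounded ((\<lambda>x. g' x e) ` C)"
    using cont C(1) by (intro compact_imp_bounded compact_continuous_image) (auto intro: continuous_on_subset)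
  then obtain B0 where B0: "\<And>x. x \<in> C \<Longrightarrow> norm (g' x e) \<le> B0" by (auto simp: bounded_iff)
  define B where "B = max 0 B0"
  have B: "norm (g' x e) \<le> B" for x using B0[of x] zero[of x] by (cases "x \<in> C") (auto simp: B_def)
  define s where "s n = inverse (real (Suc n))" for n
  have s: "0 < s n" "s n \<le> 1" for n by (auto simp: s_def inverse_le_1_iff)
  define q where "q n x = (g (x + s n *\<^sub>R e) - g x) /\<^sub>R s n" for n x
  have line: "((\<lambda>t. g (x + t *\<^sub>R e)) has_vector_derivative g' (x + t *\<^sub>R e) e) (at t)" for x t
  proof -
    have "((\<lambda>t. g (x + t *\<^sub>R e)) has_derivative (\<lambda>h. g' (x + t *\<^sub>R e) (h *\<^sub>R e))) (at t)"
      by (rule has_derivative_compose[OF _ der]) (auto intro!: derivative_eq_intros)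
    moreover have "g' y (h *\<^sub>R e) = h *\<^sub>R g' y e" for y h
      using der[of y] by (simp add: has_derivative_def bounded_linear.linear linear_scale)
    ultimately show ?thesis by (simp add: has_vector_derivative_def)
  qed
  have qbound: "norm (q n x) \<le> B" for n x
  proof -
    have "norm (g (x + s n *\<^sub>R e) - g (x + 0 *\<^sub>R e)) \<le> B * norm (s n - 0)"
    proof (rule differentiable_bound[of "{0..s n}"])
      fix t
      show "((\<lambda>t. g (x + t *\<^sub>R e)) has_derivative (\<lambda>h. h *\<^sub>R g' (x + t *\<^sub>R e) e)) (at t within {0..s n})"
        using has_vector_derivative_at_within[OF line] by (simp add: has_vector_derivative_def)
      show "onorm (\<lambda>h. h *\<^sub>R g' (x + t *\<^sub>R e) e) \<le> B"
      proof (rule onorm_le)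
        show "norm (h *\<^sub>R g' (x + t *\<^sub>R e) e) \<le> B * norm h" for h
          using mult_right_mono[OF B norm_ge_zero, of "x + t *\<^sub>R e" h] by (simp add: mult.commute)
      qed
    qed (use B s[of n] in auto)
    then have "norm (g (x + s n *\<^sub>R e) - g x) \<le> B * s n" using s[of n] by simp
    then have "norm (g (x + s n *\<^sub>R e) - g x) / s n \<le> B" using s[of n] by (simp add: divide_le_eq)
    then show ?thesis using s[of n] by (simp add: q_def divide_inverse mult.commute)
  qed
  have qsupp: "q n x = 0" if "norm x > R + norm e" for n x
  proof -
    have "x \<notin> C" using R[of x] that norm_ge_zero[of e] by linarith
    moreover have "norm (s n *\<^sub>R e) \<le> norm e" using s[of n] by (simp add: mult_left_le_one_le)
    then have "norm (x + s n *\<^sub>R e) > R" using norm_triangle_ineq4[of "x + s n *\<^sub>R e" "s n *\<^sub>R e"] that by simp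
    then have "x + s n *\<^sub>R e \<notin> C" using R[of "x + s n *\<^sub>R e"] by linarith
    ultimately show ?thesis using C(2) by (simp add: q_def)
  qed
  have lim: "(\<lambda>n. q n x) \<longlonglongrightarrow> g' x e" for x
  proof -
    have "((\<lambda>h. norm (g (x + h *\<^sub>R e) - g x - h *\<^sub>R g' x e) / norm h) \<longlongrightarrow> 0) (at 0)"
      using line[of x 0] by (simp add: has_vector_derivative_def has_derivative_at)
    then have "((\<lambda>h. norm ((g (x + h *\<^sub>R e) - g x) /\<^sub>R h - g' x e)) \<longlongrightarrow> 0) (at 0)"
    proof (rule Lim_transform_eventually)
      have *: "norm (v - h *\<^sub>R w) / norm h = norm (v /\<^sub>R h - w)" if "h \<noteq> 0" for h and v w :: complex
      proof -
        have "norm (v /\<^sub>R h - w) = norm ((v - h *\<^sub>R w) /\<^sub>R h)" using that by (simp add: scaleR_diff_right)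
        then show ?thesis by (simp add: divide_inverse mult.commute)
      qed
      show "\<forall>\<^sub>F h in at 0. norm (g (x + h *\<^sub>R e) - g x - h *\<^sub>R g' x e) / norm h
          = norm ((g (x + h *\<^sub>R e) - g x) /\<^sub>R h - g' x e)"
        unfolding eventually_at_filter by (intro always_eventually allI impI *)
    qed
    then have "((\<lambda>t. (g (x + t *\<^sub>R e) - g x) /\<^sub>R t) \<longlongrightarrow> g' x e) (at 0)"
      by (rule LIM_zero_cancel[OF tendsto_norm_zero_cancel])
    moreover have "filterlim s (at 0) sequentially"
    proof (rule filterlim_atI)
      show "s \<longlonglongrightarrow> 0" unfolding s_def by (rule LIMSEQ_inverse_real_of_nat)
      show "\<forall>\<^sub>F n in sequentially. s n \<noteq> 0" using s(1) by (intro always_eventually allI) (simp add: less_imp_neq[symmetric])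
    qed
    ultimately show ?thesis unfolding q_def by (rule filterlim_compose)
  qed
  have gi: "integrable lborel g" by (rule integrable_compact_support[OF gc C])
  have qi: "(LINT x|lborel. q n x) = 0" for n
  proof -
    have "integrable lborel (\<lambda>x. g (x + s n *\<^sub>R e))"
      using integrable_distr[of "(+) (s n *\<^sub>R e)" lborel borel g] gi
      by (simp add: lborel_distr_plus add.commute)
    then have "(LINT x|lborel. q n x) = ((LINT x|lborel. g (x + s n *\<^sub>R e)) - (LINT x|lborel. g x)) /\<^sub>R s n"
      unfolding q_def using gi by simp
    then show ?thesis using integral_translate[OF borel_measurable_continuous_onI[OF gc], of "s n *\<^sub>R e"] by simp
  qed
  have "(\<lambda>n. LINT x|lborel. q n x) \<longlonglongrightarrow> (LINT x|lborel. g' x e)"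
  proof (rule integral_dominated_convergence[where w = "\<lambda>x. B * indicator (cball 0 (R + norm e)) x"])
    show "integrable lborel (\<lambda>x. B * indicator (cball 0 (R + norm e)) x)"
      by (intro integrable_mult_right integrable_real_indicator emeasure_bounded_finite) auto
    show "AE x in lborel. norm (q n x) \<le> B * indicator (cball 0 (R + norm e)) x" for n
      using qbound qsupp by (auto simp: indicator_def)
    show "q n \<in> borel_measurable lborel" for n
    proof -
      have "continuous_on UNIV (q n)"
        unfolding q_def by (intro continuous_intros gc continuous_on_compose2[OF gc]) auto
      then show ?thesis using borel_measurable_continuous_onI by simp
    qed
    show "(\<lambda>x. g' x e) \<in> borel_measurable lborel"
      using borel_measurable_continuous_onI[OF cont] by simp
  qed (use lim in auto)
  then show ?thesis by (simp add: qi LIMSEQ_const_iff)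
qed

section \<open>Derivative bounds for the cutoffs\<close>

context conj_frame begin

text \<open>The cutoffs are not holomorphic, so the chain rule with a complex derivative does not
  cover them. For real inner values the outer derivative is a real scalar and passes through
  \<open>D\<close>.\<close>

lemma D_chain_real:
  assumes g: "(\<lambda>x. complex_of_real (g x)) differentiable at x" and f: "(f has_real_derivative f') (at (g x))"
  shows "(\<lambda>x. complex_of_real (f (g x))) differentiable at x"
    "D j (\<lambda>x. of_real (f (g x))) x = of_real f' * D j (\<lambda>x. of_real (g x)) x"
proof -
  obtain G where G: "((\<lambda>x. complex_of_real (g x)) has_derivative G) (at x)"
    using g by (auto simp: differentiable_def)
  have g': "(g has_derivative (\<lambda>h. Re (G h))) (at x)"
    using bounded_linear.has_derivative[OF bounded_linear_Re G] by simp
  have og: "((\<lambda>x. complex_of_real (g x)) has_derivative (\<lambda>h. of_real (Re (G h)))) (at x)"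
    by (rule bounded_linear.has_derivative[OF bounded_linear_of_real g'])
  have "((\<lambda>x. f (g x)) has_derivative (\<lambda>h. f' * Re (G h))) (at x)"
    using has_derivative_compose[OF g', of f "(*) f'"] f by (simp add: has_field_derivative_def)
  then have ofg: "((\<lambda>x. complex_of_real (f (g x))) has_derivative (\<lambda>h. of_real (f' * Re (G h)))) (at x)"
    by (rule bounded_linear.has_derivative[OF bounded_linear_of_real])
  then show "(\<lambda>x. complex_of_real (f (g x))) differentiable at x" by (auto simp: differentiable_def)
  show "D j (\<lambda>x. of_real (f (g x))) x = of_real f' * D j (\<lambda>x. of_real (g x)) x"
    by (simp add: D_eq[OF og] D_eq[OF ofg] sum_distrib_left mult_ac)
qed

text \<open>Each derivative lowers the exponent by one; \<open>m < M\<close> keeps it at least 2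
  whenever one is taken.\<close>

lemma bd_max_power:
  assumes "m < M"
  shows "\<exists>K. \<forall>\<delta> U g. open U \<longrightarrow> (\<forall>j. 0 < \<delta> j) \<longrightarrow> bd \<delta> U m (\<lambda>_. C) (\<lambda>x. of_real (g x)) \<longrightarrow>
     bd \<delta> U m (\<lambda>_. K) (\<lambda>x. of_real (max 0 (g x) ^ M))"
  using assms
proof (induction m arbitrary: M)
  case 0
  have "norm (complex_of_real (max 0 t ^ M)) \<le> \<bar>C\<bar> ^ M" if "norm (complex_of_real t) \<le> C" for t
  proof -
    have "max 0 t ^ M \<le> \<bar>C\<bar> ^ M" using that by (intro power_mono) auto
    then show ?thesis by (simp only: norm_of_real) simp
  qed
  then show ?case by (intro exI[of _ "\<bar>C\<bar> ^ M"]) auto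
next
  case (Suc m)
  then have "m < M - 1" by simp
  obtain K where K: "\<forall>\<delta> U g. open U \<longrightarrow> (\<forall>j. 0 < \<delta> j) \<longrightarrow> bd \<delta> U m (\<lambda>_. C) (\<lambda>x. of_real (g x)) \<longrightarrow>
     bd \<delta> U m (\<lambda>_. K) (\<lambda>x. of_real (max 0 (g x) ^ (M - 1)))"
    by (rule exE[OF Suc.IH[OF \<open>m < M - 1\<close>]])
  define L where "L = max (\<bar>C\<bar> ^ M) (2 ^ m * (real M * K) * C)"
  have main: "bd \<delta> U (Suc m) (\<lambda>_. L) (\<lambda>x. of_real (max 0 (g x) ^ M))"
    if U: "open U" and \<delta>: "\<And>j. 0 < \<delta> j" and g: "bd \<delta> U (Suc m) (\<lambda>_. C) (\<lambda>x. of_real (g x))" for \<delta> U g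
  proof -
    have dg: "(\<lambda>x. complex_of_real (g x)) differentiable at x" if "x \<in> U" for x using g that by simp
    have M: "2 \<le> M" using Suc.prems by simp
    note ch = D_chain_real[OF dg max_power_DERIV[OF M]]
    have "bd \<delta> U m (\<lambda>x. L / \<delta> j) (D j (\<lambda>x. of_real (max 0 (g x) ^ M)))" for j
    proof (rule bd_cong[OF U])
      have "bd \<delta> U m (\<lambda>x. 2 ^ m * (norm (complex_of_nat M) * K) * (C / \<delta> j))
          (\<lambda>x. of_nat M * of_real (max 0 (g x) ^ (M - 1)) * D j (\<lambda>x. of_real (g x)) x)"
        using g by (intro bd_mult bd_cmult U \<delta> K[rule_format] bd_Suc[OF g]) simp
      then show "bd \<delta> U m (\<lambda>x. L / \<delta> j)
          (\<lambda>x. of_nat M * of_real (max 0 (g x) ^ (M - 1)) * D j (\<lambda>x. of_real (g x)) x)"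
      proof (rule bd_weight[OF \<delta>, rotated])
        show "2 ^ m * (norm (complex_of_nat M) * K) * (C / \<delta> j) \<le> L / \<delta> j"
          using \<delta>[of j] by (auto simp: L_def divide_right_mono)
      qed
    qed (simp only: ch(2) of_real_mult of_real_of_nat_eq)
    moreover have "norm (complex_of_real (max 0 (g x) ^ M)) \<le> L" if "x \<in> U" for x
    proof -
      have "norm (complex_of_real (g x)) \<le> C" using g that by simp
      then have "max 0 (g x) ^ M \<le> \<bar>C\<bar> ^ M" by (intro power_mono) auto
      then show ?thesis by (simp only: norm_of_real) (simp add: L_def)
    qed
    ultimately show ?thesis using ch by simp
  qed
  show ?case by (intro exI[of _ L] allI impI, rule main) auto
qed

end

lemma resolvent_norm:
  fixes w :: complex
  shows "norm (complex_of_real (1 / (1 + (norm w)\<^sup>2))) \<le> 1"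
    "norm (complex_of_real (1 / (1 + (norm w)\<^sup>2)) * w) \<le> 1"
    "norm (complex_of_real (1 / (1 + (norm w)\<^sup>2)) * cnj w) \<le> 1"
proof -
  have a: "1 + (norm w)\<^sup>2 > 0" by (simp add: add_pos_nonneg)
  have "0 \<le> (norm w - 1)\<^sup>2" by simp
  then have "2 * norm w \<le> 1 + (norm w)\<^sup>2" by (simp add: power2_eq_square algebra_simps)
  then have b: "norm w \<le> 1 + (norm w)\<^sup>2" using norm_ge_zero[of w] by linarith
  show "norm (complex_of_real (1 / (1 + (norm w)\<^sup>2))) \<le> 1"
    "norm (complex_of_real (1 / (1 + (norm w)\<^sup>2)) * w) \<le> 1"
    "norm (complex_of_real (1 / (1 + (norm w)\<^sup>2)) * cnj w) \<le> 1"
    using a b by (simp_all add: norm_mult norm_divide abs_of_pos del: of_real_add of_real_power of_real_divide)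
qed

context conj_frame begin

definition resolvent :: "'k \<Rightarrow> complex \<Rightarrow> real \<Rightarrow> real^'k \<Rightarrow> complex" where
  "resolvent i z d x = of_real (1 / (1 + (norm ((Y i x - z) / of_real d))\<^sup>2))"

text \<open>With \<open>W\<close> the rescaled difference and \<open>G\<close> the resolvent, the
  family \<open>G\<close>, \<open>G W\<close>, \<open>G cnj W\<close> is closed under
  differentiation: each first derivative is a polynomial of degree at most two in them, with
  coefficients of size \<open>1 / \<delta> i\<close>. Hence the simultaneous induction. The
  derivation at \<open>\<kappa> i\<close> acts on \<open>cnj W\<close>, which is why
  \<open>\<delta> (\<kappa> i) = \<delta> i\<close> is required.\<close>

lemma bd_resolvent:
  "\<exists>K. \<forall>\<delta> i z. (\<forall>j. 0 < \<delta> j) \<longrightarrow> \<delta> (\<kappa> i) = \<delta> i \<longrightarrow>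
     bd \<delta> UNIV m (\<lambda>_. K) (resolvent i z (\<delta> i)) \<and>
     bd \<delta> UNIV m (\<lambda>_. K) (\<lambda>x. resolvent i z (\<delta> i) x * ((Y i x - z) / of_real (\<delta> i))) \<and>
     bd \<delta> UNIV m (\<lambda>_. K) (\<lambda>x. resolvent i z (\<delta> i) x * cnj ((Y i x - z) / of_real (\<delta> i)))"
proof (induction m)
  case 0
  show ?case unfolding bd.simps resolvent_def
    by (intro exI[of _ 1] allI impI conjI ballI resolvent_norm)
next
  case (Suc m)
  obtain K where K: "\<forall>\<delta> i z. (\<forall>j. 0 < \<delta> j) \<longrightarrow> \<delta> (\<kappa> i) = \<delta> i \<longrightarrow>
     bd \<delta> UNIV m (\<lambda>_. K) (resolvent i z (\<delta> i)) \<and>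
     bd \<delta> UNIV m (\<lambda>_. K) (\<lambda>x. resolvent i z (\<delta> i) x * ((Y i x - z) / of_real (\<delta> i))) \<and>
     bd \<delta> UNIV m (\<lambda>_. K) (\<lambda>x. resolvent i z (\<delta> i) x * cnj ((Y i x - z) / of_real (\<delta> i)))"
    by (rule exE[OF Suc.IH])
  \<comment> \<open>Each of the two quadratic terms costs
    \<open>2 ^ m * \<bar>K\<bar> * \<bar>K\<bar>\<close>, the linear one
    \<open>\<bar>K\<bar>\<close>.\<close>
  define L where "L = max 1 (2 * (2 ^ m * \<bar>K\<bar> * \<bar>K\<bar>) + \<bar>K\<bar>)"
  show ?case
  proof (intro exI[of _ L] allI impI)
    fix \<delta> :: "'k \<Rightarrow> real" and i z assume \<delta>: "\<forall>j. 0 < \<delta> j" "\<delta> (\<kappa> i) = \<delta> i"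
    have \<delta>0: "0 < \<delta> j" for j using \<delta> by blast
    define W where "W x = (Y i x - z) / of_real (\<delta> i)" for x
    define V where "V x = (Y (\<kappa> i) x - cnj z) / of_real (\<delta> i)" for x
    define G where "G = resolvent i z (\<delta> i)"
    have V: "cnj (W x) = V x" for x by (simp add: W_def V_def Y_cnj)
    have nsq: "1 + W x * V x = of_real (1 + (norm (W x))\<^sup>2)" for x
      by (simp only: V[symmetric] of_real_add of_real_1 complex_norm_square)
    have Gx: "G x = inverse (1 + W x * V x)" for x
      unfolding G_def resolvent_def W_def[symmetric] nsq
      by (simp add: inverse_eq_divide del: of_real_add)
    have nz: "1 + W x * V x \<noteq> 0" for x
    proof -
      have "1 + (norm (W x))\<^sup>2 > 0" by (simp add: add_pos_nonneg)
      then show ?thesis unfolding nsq by (simp only: of_real_eq_0_iff)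
    qed
    define a where "a j = (if i = j then 1 / complex_of_real (\<delta> i) else 0)" for j
    define b where "b j = (if \<kappa> i = j then 1 / complex_of_real (\<delta> i) else 0)" for j
    have Yd: "Y j differentiable at x" for j x
      using Y_derivative by (auto simp: differentiable_def)
    have dd: "((\<lambda>y. (y - c) / of_real (\<delta> i)) has_field_derivative 1 / of_real (\<delta> i)) (at y)" for c y
      using \<delta>0[of i] by (auto intro!: derivative_eq_intros)
    have Wd: "W differentiable at x" "D j W x = a j" for x j
      using D_chain[OF Yd[of i x] dd[of z]] unfolding W_def[abs_def] a_def by (auto simp: D_Y)
    have Vd: "V differentiable at x" "D j V x = b j" for x j
      using D_chain[OF Yd[of "\<kappa> i" x] dd[of "cnj z"]] unfolding V_def[abs_def] b_def by (auto simp: D_Y)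
    have WVd: "(\<lambda>x. 1 + W x * V x) differentiable at x" for x
      using Wd Vd by (intro derivative_intros) auto
    have D1: "D j (\<lambda>x. 1 + W x * V x) x = a j * V x + W x * b j" for x j
      using D_add[of "\<lambda>_. 1" x "\<lambda>x. W x * V x" j] D_mult[of W x V j] Wd Vd by simp
    have Gd: "G differentiable at x" "D j G x = (- a j) * (G x * (G x * V x)) + (- b j) * (G x * (G x * W x))" for x j
    proof -
      have G_eq: "G = (\<lambda>x. inverse (1 + W x * V x))" using Gx by auto
      have "(inverse has_field_derivative - (G x * G x)) (at (1 + W x * V x))"
        using DERIV_inverse[OF nz, of x] by (simp add: Gx numeral_2_eq_2)
      from D_chain[OF WVd this] show "G differentiable at x"
        "D j G x = (- a j) * (G x * (G x * V x)) + (- b j) * (G x * (G x * W x))"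
        unfolding G_eq[symmetric] D1 by (simp_all add: algebra_simps)
    qed
    have GWd: "(\<lambda>x. G x * W x) differentiable at x"
      "D j (\<lambda>x. G x * W x) x = ((- a j) * (G x * W x * (G x * V x)) + (- b j) * (G x * W x * (G x * W x))) + a j * G x" for x j
      using D_mult[of G x W j, OF Gd(1) Wd(1)] Gd Wd by (auto intro: differentiable_mult simp: algebra_simps)
    have GVd: "(\<lambda>x. G x * V x) differentiable at x"
      "D j (\<lambda>x. G x * V x) x = ((- a j) * (G x * V x * (G x * V x)) + (- b j) * (G x * V x * (G x * W x))) + b j * G x" for x j
      using D_mult[of G x V j, OF Gd(1) Vd(1)] Gd Vd by (auto intro: differentiable_mult simp: algebra_simps)
    have bdK: "bd \<delta> UNIV m (\<lambda>_. \<bar>K\<bar>) G" "bd \<delta> UNIV m (\<lambda>_. \<bar>K\<bar>) (\<lambda>x. G x * W x)" "bd \<delta> UNIV m (\<lambda>_. \<bar>K\<bar>) (\<lambda>x. G x * V x)"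
      using K[rule_format, OF \<delta>0 \<delta>(2), of z] unfolding G_def[symmetric] W_def[symmetric] V
      by (auto intro: bd_weight[OF \<delta>0, of UNIV "\<lambda>_. K" "\<lambda>_. \<bar>K\<bar>"])
    have ab: "norm (- a j) \<le> 1 / \<delta> j" "norm (- b j) \<le> 1 / \<delta> j" "norm (a j) \<le> 1 / \<delta> j" "norm (b j) \<le> 1 / \<delta> j" for j
      using \<delta>0[of j] \<delta>(2) by (auto simp: a_def b_def norm_divide)
    have cm: "bd \<delta> UNIV m (\<lambda>_. 1 / \<delta> j * C) (\<lambda>x. c * h x)"
      if "norm c \<le> 1 / \<delta> j" "bd \<delta> UNIV m (\<lambda>_. C) h" "0 \<le> C" for c h C j
      by (rule bd_weight[OF \<delta>0 mult_right_mono[OF that(1,3)] bd_cmult[OF open_UNIV \<delta>0 that(2), of c]])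
    have quad: "bd \<delta> UNIV m (\<lambda>_. 1 / \<delta> j * (2 ^ m * \<bar>K\<bar> * \<bar>K\<bar>) + 1 / \<delta> j * (2 ^ m * \<bar>K\<bar> * \<bar>K\<bar>))
        (\<lambda>x. (- a j) * (h1 x * h2 x) + (- b j) * (h1 x * h3 x))"
      if "bd \<delta> UNIV m (\<lambda>_. \<bar>K\<bar>) h1" "bd \<delta> UNIV m (\<lambda>_. \<bar>K\<bar>) h2" "bd \<delta> UNIV m (\<lambda>_. \<bar>K\<bar>) h3" for h1 h2 h3 j
      by (rule bd_add[OF open_UNIV cm[OF ab(1) bd_mult[OF open_UNIV \<delta>0 that(1,2)]] cm[OF ab(2) bd_mult[OF open_UNIV \<delta>0 that(1,3)]]]) auto
    have le: "1 / \<delta> j * (2 ^ m * \<bar>K\<bar> * \<bar>K\<bar>) + 1 / \<delta> j * (2 ^ m * \<bar>K\<bar> * \<bar>K\<bar>) + 1 / \<delta> j * \<bar>K\<bar> \<le> L / \<delta> j" for j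
    proof -
      have "1 / \<delta> j * (2 ^ m * \<bar>K\<bar> * \<bar>K\<bar>) + 1 / \<delta> j * (2 ^ m * \<bar>K\<bar> * \<bar>K\<bar>) + 1 / \<delta> j * \<bar>K\<bar>
          = (2 * (2 ^ m * \<bar>K\<bar> * \<bar>K\<bar>) + \<bar>K\<bar>) / \<delta> j" by (simp add: add_divide_distrib)
      also have "\<dots> \<le> L / \<delta> j" using \<delta>0[of j] by (intro divide_right_mono) (auto simp: L_def)
      finally show ?thesis .
    qed
    have DG: "bd \<delta> UNIV m (\<lambda>_. L / \<delta> j) (D j G)" for j
      unfolding Gd(2)[abs_def]
    proof (rule bd_weight[OF \<delta>0 _ quad[OF bdK(1) bdK(3) bdK(2)]])
      have "0 \<le> 1 / \<delta> j * \<bar>K\<bar>" using \<delta>0[of j] by simp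
      with le[of j] show "1 / \<delta> j * (2 ^ m * \<bar>K\<bar> * \<bar>K\<bar>) + 1 / \<delta> j * (2 ^ m * \<bar>K\<bar> * \<bar>K\<bar>) \<le> L / \<delta> j" by linarith
    qed
    have DGW: "bd \<delta> UNIV m (\<lambda>_. L / \<delta> j) (D j (\<lambda>x. G x * W x))" for j
      unfolding GWd(2)[abs_def]
      by (rule bd_weight[OF \<delta>0 le bd_add[OF open_UNIV quad[OF bdK(2,3,2)] cm[OF ab(3) bdK(1)]]]) auto
    have DGV: "bd \<delta> UNIV m (\<lambda>_. L / \<delta> j) (D j (\<lambda>x. G x * V x))" for j
      unfolding GVd(2)[abs_def]
      by (rule bd_weight[OF \<delta>0 le bd_add[OF open_UNIV quad[OF bdK(3,3,2)] cm[OF ab(4) bdK(1)]]]) auto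
    have L1: "1 \<le> L" by (simp add: L_def)
    have norms: "norm (G x) \<le> L" "norm (G x * W x) \<le> L" "norm (G x * V x) \<le> L" for x
      unfolding V[symmetric] G_def resolvent_def W_def[symmetric]
      by (rule order_trans[OF resolvent_norm(1) L1] order_trans[OF resolvent_norm(2) L1]
          order_trans[OF resolvent_norm(3) L1])+
    show "bd \<delta> UNIV (Suc m) (\<lambda>_. L) (resolvent i z (\<delta> i)) \<and>
       bd \<delta> UNIV (Suc m) (\<lambda>_. L) (\<lambda>x. resolvent i z (\<delta> i) x * ((Y i x - z) / of_real (\<delta> i))) \<and>
       bd \<delta> UNIV (Suc m) (\<lambda>_. L) (\<lambda>x. resolvent i z (\<delta> i) x * cnj ((Y i x - z) / of_real (\<delta> i)))"
      unfolding G_def[symmetric] W_def[symmetric] V bd.simps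
      by (intro conjI ballI allI DG DGW DGV norms Gd(1) GWd(1) GVd(1))
  qed
qed

lemma bd_cut:
  assumes "m < M"
  shows "\<exists>K\<ge>1. \<forall>\<delta> i z. (\<forall>j. 0 < \<delta> j) \<longrightarrow> \<delta> (\<kappa> i) = \<delta> i \<longrightarrow>
     bd \<delta> UNIV m (\<lambda>_. K) (\<lambda>x. of_real (cut M (norm ((Y i x - z) / of_real (\<delta> i)))))"
proof -
  obtain K0 where K0: "\<forall>\<delta> i z. (\<forall>j. 0 < \<delta> j) \<longrightarrow> \<delta> (\<kappa> i) = \<delta> i \<longrightarrow>
     bd \<delta> UNIV m (\<lambda>_. K0) (resolvent i z (\<delta> i)) \<and>
     bd \<delta> UNIV m (\<lambda>_. K0) (\<lambda>x. resolvent i z (\<delta> i) x * ((Y i x - z) / of_real (\<delta> i))) \<and>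
     bd \<delta> UNIV m (\<lambda>_. K0) (\<lambda>x. resolvent i z (\<delta> i) x * cnj ((Y i x - z) / of_real (\<delta> i)))"
    by (rule exE[OF bd_resolvent])
  \<comment> \<open>The bound belongs to the affine function \<open>10/3 * resolvent - 2/3\<close>
    inside \<open>cut\<close>; the argument of the outer power is then bounded by
    \<open>1 + K1\<close>.\<close>
  obtain K1 where K1: "\<forall>\<delta> U g. open U \<longrightarrow> (\<forall>j. 0 < \<delta> j) \<longrightarrow> bd \<delta> U m (\<lambda>_. 10 / 3 * K0 + 2 / 3) (\<lambda>x. of_real (g x)) \<longrightarrow>
     bd \<delta> U m (\<lambda>_. K1) (\<lambda>x. of_real (max 0 (g x) ^ M))"
    by (rule exE[OF bd_max_power[OF assms]])
  obtain K2 where K2: "\<forall>\<delta> U g. open U \<longrightarrow> (\<forall>j. 0 < \<delta> j) \<longrightarrow> bd \<delta> U m (\<lambda>_. 1 + K1) (\<lambda>x. of_real (g x)) \<longrightarrow>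
     bd \<delta> U m (\<lambda>_. K2) (\<lambda>x. of_real (max 0 (g x) ^ M))"
    by (rule exE[OF bd_max_power[OF assms]])
  have "bd \<delta> UNIV m (\<lambda>_. max 1 K2) (\<lambda>x. of_real (cut M (norm ((Y i x - z) / of_real (\<delta> i)))))"
    if \<delta>: "\<forall>j. 0 < \<delta> j" "\<delta> (\<kappa> i) = \<delta> i" for \<delta> i z
  proof -
    have \<delta>0: "0 < \<delta> j" for j using \<delta> by blast
    define r where "r x = norm ((Y i x - z) / of_real (\<delta> i))" for x
    have "bd \<delta> UNIV m (\<lambda>_. norm (10 / 3 :: complex) * K0 + 2 / 3) (\<lambda>x. 10 / 3 * resolvent i z (\<delta> i) x + (- 2 / 3))"
      by (intro bd_add bd_cmult bd_const open_UNIV \<delta>0 K0[rule_format, OF \<delta>0 \<delta>(2), THEN conjunct1]) auto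
    then have "bd \<delta> UNIV m (\<lambda>_. 10 / 3 * K0 + 2 / 3) (\<lambda>x. of_real (10 / 3 * (1 / (1 + (r x)\<^sup>2) - 1 / 5)))"
      unfolding resolvent_def r_def[symmetric] by (simp add: algebra_simps)
    from K1[rule_format, OF open_UNIV \<delta>0 this]
    have "bd \<delta> UNIV m (\<lambda>_. 1 + norm (- 1 :: complex) * K1)
        (\<lambda>x. 1 + (- 1) * of_real (max 0 (10 / 3 * (1 / (1 + (r x)\<^sup>2) - 1 / 5)) ^ M))"
      by (intro bd_add bd_cmult bd_const open_UNIV \<delta>0) auto
    then have "bd \<delta> UNIV m (\<lambda>_. 1 + K1) (\<lambda>x. of_real (1 - max 0 (10 / 3 * (1 / (1 + (r x)\<^sup>2) - 1 / 5)) ^ M))"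
      by simp
    from K2[rule_format, OF open_UNIV \<delta>0 this]
    have "bd \<delta> UNIV m (\<lambda>_. K2) (\<lambda>x. of_real (cut M (r x)))" unfolding cut_def .
    then show ?thesis unfolding r_def by (rule bd_weight[OF \<delta>0, rotated]) simp
  qed
  then show ?thesis by (intro exI[of _ "max 1 K2"]) auto
qed

text \<open>The derivations \<open>D j\<close> are constant combinations of the derivatives along
  the axes. The scale is 1 because \<open>\<psi>\<close> is fixed; smaller scales follow by
  \<open>bd_delta\<close>.\<close>

lemma bd_smooth:
  fixes \<psi> :: "real^'k \<Rightarrow> real"
  assumes "times_differentiable m \<psi>" "compact C" "\<And>x. x \<notin> C \<Longrightarrow> \<psi> x = 0"
  shows "\<exists>K\<ge>0. bd (\<lambda>_. 1) UNIV m (\<lambda>_. K) (\<lambda>x. of_real (\<psi> x))"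
  using assms(1,3)
proof (induction m arbitrary: \<psi>)
  case 0
  have "bounded (\<psi> ` C)"
    using 0 assms(2) by (intro compact_imp_bounded compact_continuous_image) (auto intro: continuous_on_subset)
  then obtain K where "\<And>x. x \<in> C \<Longrightarrow> \<bar>\<psi> x\<bar> \<le> K" by (auto simp: bounded_iff)
  then have "\<bar>\<psi> x\<bar> \<le> max 0 K" for x using 0(2)[of x] by (cases "x \<in> C") fastforce+
  then show ?case by (intro exI[of _ "max 0 K"]) auto
next
  case (Suc m)
  have d: "(\<psi> has_derivative frechet_derivative \<psi> (at x)) (at x)" for x
    using Suc.prems by (simp add: frechet_derivative_works[symmetric])
  have "continuous_on UNIV \<psi>" by (rule has_derivative_continuous_on[of _ _ "\<lambda>x. frechet_derivative \<psi> (at x)"]) (simp add: d)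
  then have "bounded (\<psi> ` C)"
    using assms(2) by (intro compact_imp_bounded compact_continuous_image) (auto intro: continuous_on_subset)
  then obtain K0 where "\<And>x. x \<in> C \<Longrightarrow> \<bar>\<psi> x\<bar> \<le> K0" by (auto simp: bounded_iff)
  then have K0: "\<bar>\<psi> x\<bar> \<le> max 0 K0" for x using Suc.prems(2)[of x] by (cases "x \<in> C") fastforce+
  have z: "frechet_derivative \<psi> (at x) v = 0" if "x \<notin> C" for x v
  proof -
    have "open (- C)" using assms(2) by (simp add: compact_imp_closed open_Compl)
    then have "(\<psi> has_derivative (\<lambda>_. 0)) (at x)"
      by (rule has_derivative_transform_within_open[OF has_derivative_const[of 0]]) (use that Suc.prems(2) in auto)
    then show ?thesis by (simp add: frechet_derivative_at[symmetric])
  qed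
  have "\<exists>K\<ge>0. bd (\<lambda>_. 1) UNIV m (\<lambda>_. K) (\<lambda>x. of_real (frechet_derivative \<psi> (at x) (axis l 1)))" for l
    by (rule Suc.IH) (use Suc.prems z in auto)
  then obtain K where K: "\<And>l. K l \<ge> 0" "\<And>l. bd (\<lambda>_. 1) UNIV m (\<lambda>_. K l) (\<lambda>x. of_real (frechet_derivative \<psi> (at x) (axis l 1)))"
    by metis
  define B where "B = max 0 K0 + (\<Sum>j\<in>UNIV. \<Sum>l\<in>UNIV. norm (T l j) * K l)"
  have od: "((\<lambda>x. complex_of_real (\<psi> x)) has_derivative (\<lambda>h. of_real (frechet_derivative \<psi> (at x) h))) (at x)" for x
    by (rule bounded_linear.has_derivative[OF bounded_linear_of_real d])
  have "bd (\<lambda>_. 1) UNIV m (\<lambda>_. B / 1) (D j (\<lambda>x. of_real (\<psi> x)))" for j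
    unfolding D_eq[OF od, abs_def]
  proof (rule bd_weight)
    show "bd (\<lambda>_. 1) UNIV m (\<lambda>_. \<Sum>l\<in>UNIV. norm (T l j) * K l)
        (\<lambda>x. \<Sum>l\<in>UNIV. T l j * of_real (frechet_derivative \<psi> (at x) (axis l 1)))"
      by (intro bd_sum bd_cmult K open_UNIV) auto
    have "(\<Sum>l\<in>UNIV. norm (T l j) * K l) \<le> (\<Sum>j\<in>UNIV. \<Sum>l\<in>UNIV. norm (T l j) * K l)"
      using K(1) by (intro member_le_sum[of j UNIV "\<lambda>j. \<Sum>l\<in>UNIV. norm (T l j) * K l"] sum_nonneg) auto
    then show "(\<Sum>l\<in>UNIV. norm (T l j) * K l) \<le> B / 1" by (simp add: B_def)
  qed auto
  moreover have B: "max 0 K0 \<le> B" unfolding B_def using K(1) by (simp add: sum_nonneg)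
  moreover have "\<bar>\<psi> x\<bar> \<le> B" for x using K0 B by (rule order_trans)
  ultimately show ?case using od by (intro exI[of _ B]) (auto simp: differentiable_def)
qed

end

section \<open>Integration by parts in the coordinate directions\<close>

context conj_frame begin

lemma derivative_axis:
  assumes "(g has_derivative g') (at x)"
  shows "g' (axis m 1) = (\<Sum>j\<in>UNIV. S j m * D j g x)"
proof -
  have "(\<Sum>j\<in>UNIV. S j m * D j g x) = (\<Sum>l\<in>UNIV. (\<Sum>j\<in>UNIV. T l j * S j m) * g' (axis l 1))"
    unfolding D_eq[OF assms] sum_distrib_left sum_distrib_right by (subst sum.swap) (simp add: mult_ac)
  then show ?thesis by (simp add: TS if_distrib[of "\<lambda>c. c * _"] cong: if_cong)
qed

lemma integral_D_zero:
  assumes diff: "\<And>x. g differentiable at x"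
    and cont: "\<And>j. continuous_on UNIV (D j g)"
    and C: "compact C" "\<And>x. x \<notin> C \<Longrightarrow> g x = 0"
  shows "(LINT x|lborel. D j g x) = 0"
proof -
  obtain g' where g': "\<And>x. (g has_derivative g' x) (at x)"
    using diff unfolding differentiable_def by metis
  have c: "continuous_on UNIV (\<lambda>x. g' x (axis m 1))" for m
    unfolding derivative_axis[OF g'] by (intro continuous_intros cont)
  have z: "g' x v = 0" if "x \<notin> C" for x v
  proof -
    have "open (- C)" using C(1) by (simp add: compact_imp_closed open_Compl)
    then have "(g has_derivative (\<lambda>_. 0)) (at x)"
      by (rule has_derivative_transform_within_open[OF has_derivative_const[of 0]]) (use that C(2) in auto)
    then show ?thesis using has_derivative_unique[OF g'] by metis
  qed
  have "integrable lborel (\<lambda>x. g' x (axis m 1))" for m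
    using c C(1) z by (rule integrable_compact_support)
  then have "(LINT x|lborel. D j g x) = (\<Sum>m\<in>UNIV. T m j * (LINT x|lborel. g' x (axis m 1)))"
    unfolding D_eq[OF g'] by simp
  also have "\<dots> = 0"
    using integral_directional_derivative[OF g' c C] by simp
  finally show ?thesis .
qed

lemma continuous_off:
  assumes "open U" "closed C" "C \<subseteq> U" "\<And>x. x \<in> U \<Longrightarrow> g differentiable at x" "\<And>x. x \<notin> C \<Longrightarrow> g x = 0"
  shows "g differentiable at x" "continuous_on UNIV g" "x \<notin> C \<Longrightarrow> D j g x = 0"
proof -
  have *: "g differentiable at x" "D j g x = 0" if "x \<notin> C" for x j
    using D_cong[of "\<lambda>_. 0" x "- C" g] assms(2,5) that by auto
  show "x \<notin> C \<Longrightarrow> D j g x = 0" by (rule *)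
  have d: "g differentiable at x" for x using *(1)[of x] assms(3,4) by blast
  then show "g differentiable at x" .
  show "continuous_on UNIV g"
    using d by (simp add: continuous_on_eq_continuous_at differentiable_imp_continuous_within)
qed

lemma bd_differentiable: "bd \<delta> U (Suc m) w g \<Longrightarrow> x \<in> U \<Longrightarrow> g differentiable at x"
  by simp

lemma bd_D: "bd \<delta> U (Suc m) w g \<Longrightarrow> bd \<delta> U m (\<lambda>x. w x / \<delta> j) (D j g)"
  by simp

text \<open>On \<open>U\<close> the factor \<open>mm\<close> is the reciprocal of the logarithmic
  derivative of \<open>e\<close>, so the derivative of \<open>e * mm * G\<close> is
  \<open>e * G + e * H\<close>, and it integrates to zero. Off \<open>U\<close> nothing is known
  about \<open>mm\<close>, but \<open>G\<close> vanishes there. One order of differentiability is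
  spent, and one more is kept so that \<open>H\<close> is continuous.\<close>

lemma ibp_step:
  assumes U: "open U" and \<delta>: "\<And>j. 0 < \<delta> j" and C: "compact C" "C \<subseteq> U"
    and e: "\<And>x. e differentiable at x" "\<And>i x. D i e x = c i x * e x" "\<And>i x. c i differentiable at x"
    and mm: "bd \<delta> U (Suc (Suc m)) (\<lambda>_. L) mm" "\<And>x. x \<in> U \<Longrightarrow> c j x * mm x = 1"
    and G: "bd \<delta> U (Suc (Suc m)) (\<lambda>_. W) G" "\<And>x. x \<notin> C \<Longrightarrow> G x = 0"
  defines "H \<equiv> \<lambda>x. D j (\<lambda>x. mm x * G x) x"
  shows "bd \<delta> U (Suc m) (\<lambda>_. (2 ^ Suc (Suc m) * L / \<delta> j) * W) H"
    "\<And>x. x \<notin> C \<Longrightarrow> H x = 0"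
    "(LINT x|lborel. e x * G x) = - (LINT x|lborel. e x * H x)"
proof -
  note clC = compact_imp_closed[OF C(1)]
  define F where "F x = mm x * G x" for x
  have F: "bd \<delta> U (Suc (Suc m)) (\<lambda>_. 2 ^ Suc (Suc m) * L * W) F"
    unfolding F_def[abs_def] by (rule bd_mult[OF U \<delta> mm(1) G(1)])
  have HF: "H = D j F" by (simp add: H_def F_def[abs_def])
  have F0: "F x = 0" if "x \<notin> C" for x using G(2)[OF that] by (simp add: F_def)
  have bdDF: "bd \<delta> U (Suc m) (\<lambda>_. 2 ^ Suc (Suc m) * L * W / \<delta> i) (D i F)" for i
    using bd_D[OF F, of i] by simp
  show "bd \<delta> U (Suc m) (\<lambda>_. (2 ^ Suc (Suc m) * L / \<delta> j) * W) H"
    using bdDF[of j] unfolding HF by (simp add: mult_ac del: bd.simps power_Suc)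
  have Foff: "F differentiable at x" "continuous_on UNIV F" for x
    using continuous_off(1,2)[OF U clC C(2), of F] bd_differentiable[OF F] F0 by blast+
  have DF0: "D i F x = 0" if "x \<notin> C" for x i
    using continuous_off(3)[OF U clC C(2), of F] bd_differentiable[OF F] F0 that by blast
  then show H0: "H x = 0" if "x \<notin> C" for x unfolding HF using that by blast
  have DFoff: "continuous_on UNIV (D i F)" for i
    using continuous_off(2)[OF U clC C(2), of "D i F"] bd_differentiable[OF bdDF] DF0 by blast
  have Gc: "continuous_on UNIV G"
    using continuous_off(2)[OF U clC C(2), of G] bd_differentiable[OF G(1)] G(2) by blast
  have ce: "continuous_on UNIV e" "continuous_on UNIV (c i)" for i
    using e by (auto simp: continuous_on_eq_continuous_at differentiable_imp_continuous_within)
  have DeF: "D i (\<lambda>x. e x * F x) x = c i x * e x * F x + e x * D i F x" for i x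
    using D_mult[of e x F i, OF e(1) Foff(1)] by (simp add: e(2))
  have "(LINT x|lborel. D j (\<lambda>x. e x * F x) x) = 0"
  proof (rule integral_D_zero)
    show "(\<lambda>x. e x * F x) differentiable at x" for x using e(1) Foff(1) by (intro differentiable_mult)
    show "continuous_on UNIV (D i (\<lambda>x. e x * F x))" for i
      unfolding DeF[abs_def] by (intro continuous_intros ce Foff(2) DFoff)
    show "e x * F x = 0" if "x \<notin> C" for x using F0[OF that] by simp
  qed (rule C)
  moreover have "D j (\<lambda>x. e x * F x) x = e x * G x + e x * H x" for x
  proof (cases "x \<in> U")
    case True
    have "c j x * e x * F x = (c j x * mm x) * (e x * G x)" by (simp add: F_def)
    then show ?thesis using mm(2)[OF True] by (simp add: DeF HF)
  next
    case False
    then have "x \<notin> C" using C(2) by blast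
    then show ?thesis using G(2) F0 DF0 by (simp add: DeF HF)
  qed
  moreover have "integrable lborel (\<lambda>x. e x * G x)"
    by (rule integrable_compact_support[OF _ C(1)])
      (use G(2) in \<open>auto intro!: continuous_intros ce Gc\<close>)
  moreover have "integrable lborel (\<lambda>x. e x * H x)"
    by (rule integrable_compact_support[OF _ C(1)])
      (use DFoff[of j] H0 in \<open>auto simp: HF intro!: continuous_intros ce\<close>)
  ultimately show "(LINT x|lborel. e x * G x) = - (LINT x|lborel. e x * H x)"
    by (simp add: eq_neg_iff_add_eq_0)
qed

text \<open>The list prescribes the direction of each integration by parts, with repetitions. The
  order \<open>Suc (length js)\<close> leaves one derivative at the end, so that the last integrand
  is continuous; it is then estimated by the volume of \<open>C\<close>.\<close>

lemma ibp_iterate: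
  assumes U: "open U" and \<delta>: "\<And>j. 0 < \<delta> j" and C: "compact C" "C \<subseteq> U"
    and e: "\<And>x. e differentiable at x" "\<And>i x. D i e x = c i x * e x" "\<And>i x. c i differentiable at x"
      "\<And>x. norm (e x) = 1"
    and mm: "\<And>j. j \<in> F \<Longrightarrow> bd \<delta> U m (\<lambda>_. L j) (mm j)" "\<And>j x. j \<in> F \<Longrightarrow> x \<in> U \<Longrightarrow> c j x * mm j x = 1"
      "\<And>j. 0 \<le> L j"
    and G: "bd \<delta> U (Suc (length js)) (\<lambda>_. W) G" "\<And>x. x \<notin> C \<Longrightarrow> G x = 0"
    and js: "set js \<subseteq> F" "Suc (length js) \<le> m" "0 \<le> W"
  shows "norm (LINT x|lborel. e x * G x) \<le> (\<Prod>j\<leftarrow>js. 2 ^ m * L j / \<delta> j) * W * measure lborel C"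
  using G js
proof (induction js arbitrary: G W)
  case Nil
  note clC = compact_imp_closed[OF C(1)]
  have G: "norm (G x) \<le> W * indicator C x" for x
    using bd_norm[OF Nil(1), of x] Nil(2)[of x] C(2) by (cases "x \<in> C") auto
  have cG: "continuous_on UNIV G"
    using continuous_off(2)[OF U clC C(2), of G] bd_differentiable[OF Nil(1)[unfolded list.size]] Nil(2) by blast
  have ce: "continuous_on UNIV e"
    using e by (auto simp: continuous_on_eq_continuous_at differentiable_imp_continuous_within)
  have i: "integrable lborel (\<lambda>x. e x * G x)"
    by (rule integrable_compact_support[OF _ C(1)]) (use Nil(2) in \<open>auto intro!: continuous_intros ce cG\<close>)
  have fin: "emeasure lborel C < \<infinity>" using C(1) by (intro emeasure_bounded_finite compact_imp_bounded)
  have ii: "integrable lborel (\<lambda>x. W * indicator C x)"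
    using fin clC by (intro integrable_mult_right integrable_real_indicator) auto
  have "norm (LINT x|lborel. e x * G x) \<le> (LINT x|lborel. norm (e x * G x))"
    by (rule integral_norm_bound)
  also have "\<dots> \<le> (LINT x|lborel. W * indicator C x)"
    using i ii G e(4) by (intro integral_mono integrable_norm) (auto simp: norm_mult)
  also have "\<dots> = W * measure lborel C" using clC by simp
  finally show ?case by simp
next
  case (Cons j js)
  have j: "j \<in> F" using Cons.prems by simp
  have mj: "bd \<delta> U (Suc (Suc (length js))) (\<lambda>_. L j) (mm j)"
    by (rule bd_le[OF _ mm(1)[OF j]]) (use Cons.prems in simp)
  have G': "bd \<delta> U (Suc (Suc (length js))) (\<lambda>_. W) G" using Cons.prems(1) by (simp only: list.size add_Suc_right add_0_right)
  define W' where "W' = (2 ^ m * L j / \<delta> j) * W"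
  define H where "H = D j (\<lambda>x. mm j x * G x)"
  have step: "bd \<delta> U (Suc (length js)) (\<lambda>_. (2 ^ Suc (Suc (length js)) * L j / \<delta> j) * W) H"
    "(LINT x|lborel. e x * G x) = - (LINT x|lborel. e x * H x)"
    unfolding H_def by (rule ibp_step[OF U \<delta> C e(1-3) mj mm(2)[OF j] G' Cons.prems(2)]; assumption)+
  have H0: "H x = 0" if "x \<notin> C" for x
    unfolding H_def by (rule ibp_step(2)[OF U \<delta> C e(1-3) mj mm(2)[OF j] G' Cons.prems(2) that])
  have "bd \<delta> U (Suc (length js)) (\<lambda>_. W') H"
  proof (rule bd_weight[OF \<delta> _ step(1)])
    have "(2::real) ^ Suc (Suc (length js)) \<le> 2 ^ m" using Cons.prems by (intro power_increasing) auto
    then show "2 ^ Suc (Suc (length js)) * L j / \<delta> j * W \<le> W'"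
      unfolding W'_def using mm(3)[of j] \<delta>[of j] Cons.prems(5)
      by (intro mult_right_mono divide_right_mono) (auto simp del: power_Suc)
  qed
  moreover have W': "0 \<le> W'" using mm(3)[of j] \<delta>[of j] Cons.prems(5) by (simp add: W'_def)
  ultimately have "norm (LINT x|lborel. e x * H x) \<le> (\<Prod>j\<leftarrow>js. 2 ^ m * L j / \<delta> j) * W' * measure lborel C"
    using Cons.prems H0 by (intro Cons.IH) auto
  then show ?case using step(2) by (simp add: W'_def mult_ac)
qed

end

section \<open>Linear changes of variables and volumes\<close>

lemma nn_integral_lborel_translate:
  fixes g :: "'a::euclidean_space \<Rightarrow> ennreal"
  assumes [measurable]: "g \<in> borel_measurable borel"
  shows "(\<integral>\<^sup>+x. g (a + x) \<partial>lborel) = (\<integral>\<^sup>+x. g x \<partial>lborel)"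
proof -
  have "(\<integral>\<^sup>+x. g x \<partial>lborel) = (\<integral>\<^sup>+x. g x \<partial>distr lborel borel ((+) a))"
    by (simp add: lborel_distr_plus)
  also have "\<dots> = (\<integral>\<^sup>+x. g (a + x) \<partial>lborel)" by (subst nn_integral_distr) auto
  finally show ?thesis by simp
qed

lemma nn_integral_lborel_reflect:
  fixes g :: "'a::euclidean_space \<Rightarrow> ennreal"
  assumes [measurable]: "g \<in> borel_measurable borel"
  shows "(\<integral>\<^sup>+x. g (a - x) \<partial>lborel) = (\<integral>\<^sup>+x. g x \<partial>lborel)"
proof -
  have "lborel = density (distr lborel borel (\<lambda>x. a - x)) (\<lambda>_. 1)"
    using lborel_affine[of "-1" a] by (simp add: density_1)
  then have "(\<integral>\<^sup>+x. g x \<partial>lborel) = (\<integral>\<^sup>+x. g x \<partial>distr lborel borel (\<lambda>x. a - x))"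
    by (metis density_1)
  also have "\<dots> = (\<integral>\<^sup>+x. g (a - x) \<partial>lborel)" by (subst nn_integral_distr) auto
  finally show ?thesis by simp
qed

text \<open>Uniqueness of Haar measure: both sides of the identity
  \<open>\<lambda>(A) \<nu>(U) = \<lambda>(U) \<nu>(A)\<close> are the integral of \<open>1\<^sub>A(x) 1\<^sub>U(f z - x)\<close> over \<open>x\<close> and \<open>z\<close>.\<close>

lemma lborel_linear_scaling_aux:
  fixes f :: "'a::euclidean_space \<Rightarrow> 'a"
  assumes f: "linear f" "surj f" and A[measurable]: "A \<in> sets borel" and U[measurable]: "U \<in> sets borel"
  shows "emeasure lborel A * emeasure lborel (f -` U) = emeasure lborel U * emeasure lborel (f -` A)"
proof -
  have f_borel[measurable]: "f \<in> borel_measurable borel"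
    using linear_continuous_on[OF linear_linear[THEN iffD2, OF f(1)]]
    by (intro borel_measurable_continuous_onI) simp
  have vm[measurable]: "f -` B \<in> sets borel" if "B \<in> sets borel" for B
    using measurable_sets[OF f_borel that] by simp
  have shift: "(\<integral>\<^sup>+z. indicator B (f z - x) \<partial>lborel) = emeasure lborel (f -` B)"
    if [measurable]: "B \<in> sets borel" for B x
  proof -
    \<comment> \<open>Surjectivity turns the shift by \<open>x\<close> into a translation of the
      variable \<open>z\<close>.\<close>
    obtain w where w: "x = f w" using f(2) by (metis surjD)
    have "(\<integral>\<^sup>+z. indicator B (f z - x) \<partial>lborel) = (\<integral>\<^sup>+z. indicator B (f (- w + z)) \<partial>lborel)"
      using f(1) by (simp add: w linear_diff)
    also have "\<dots> = (\<integral>\<^sup>+z. indicator B (f z) \<partial>lborel)"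
      by (rule nn_integral_lborel_translate) measurable
    also have "\<dots> = (\<integral>\<^sup>+z. indicator (f -` B) z \<partial>lborel)"
      by (intro nn_integral_cong) (simp add: indicator_def)
    also have "\<dots> = emeasure lborel (f -` B)" by simp
    finally show ?thesis .
  qed
  have "emeasure lborel A * emeasure lborel (f -` U)
      = (\<integral>\<^sup>+x. indicator A x * (\<integral>\<^sup>+z. indicator U (f z - x) \<partial>lborel) \<partial>lborel)"
    by (simp add: shift nn_integral_multc)
  also have "\<dots> = (\<integral>\<^sup>+x. \<integral>\<^sup>+z. indicator A x * indicator U (f z - x) \<partial>lborel \<partial>lborel)"
    by (simp add: nn_integral_cmult)
  also have "\<dots> = (\<integral>\<^sup>+z. \<integral>\<^sup>+x. indicator A x * indicator U (f z - x) \<partial>lborel \<partial>lborel)"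
    by (rule lborel_pair.Fubini') measurable
  also have "\<dots> = (\<integral>\<^sup>+z. \<integral>\<^sup>+x. indicator A (f z - x) * indicator U x \<partial>lborel \<partial>lborel)"
  proof (rule nn_integral_cong)
    fix z
    have "(\<lambda>x. indicator A x * indicator U (f z - x) :: ennreal) \<in> borel_measurable borel" by measurable
    from nn_integral_lborel_reflect[OF this, of "f z"]
    show "(\<integral>\<^sup>+x. indicator A x * indicator U (f z - x) \<partial>lborel)
        = (\<integral>\<^sup>+x. indicator A (f z - x) * indicator U x \<partial>lborel)" by simp
  qed
  also have "\<dots> = (\<integral>\<^sup>+x. \<integral>\<^sup>+z. indicator A (f z - x) * indicator U x \<partial>lborel \<partial>lborel)"
    by (rule lborel_pair.Fubini'[symmetric]) measurable
  also have "\<dots> = (\<integral>\<^sup>+x. (\<integral>\<^sup>+z. indicator A (f z - x) \<partial>lborel) * indicator U x \<partial>lborel)"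
    by (simp add: nn_integral_multc)
  also have "\<dots> = emeasure lborel U * emeasure lborel (f -` A)"
    unfolding shift[OF A] using nn_integral_cmult_indicator[of U lborel "emeasure lborel (f -` A)"]
    by (simp add: mult.commute)
  finally show ?thesis .
qed

text \<open>The constant is the reciprocal of the absolute determinant, expressed by the volume of
  the preimage of the unit ball. In this form a lower bound for \<open>norm (f x)\<close> controls
  it, which later gives uniformity in the base point.\<close>

lemma lborel_linear_scaling:
  fixes f :: "'a::euclidean_space \<Rightarrow> 'a"
  assumes f: "linear f" "inj f"
  defines "c \<equiv> measure lborel (f -` cball 0 1) / measure lborel (cball 0 1 :: 'a set)"
  shows "0 < c" "A \<in> sets borel \<Longrightarrow> emeasure lborel (f -` A) = ennreal c * emeasure lborel A"
    "g \<in> borel_measurable borel \<Longrightarrow> (\<integral>\<^sup>+x. g (f x) \<partial>lborel) = ennreal c * (\<integral>\<^sup>+x. g x \<partial>lborel)"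
proof -
  have surj: "surj f" by (intro linear_injective_imp_surjective f refl)
  let ?U = "cball 0 1 :: 'a set"
  obtain B where B: "0 < B" "\<And>x. B * norm x \<le> norm (f x)"
    using linear_inj_bounded_below_pos[OF f] by metis
  have f_borel[measurable]: "f \<in> borel_measurable borel"
    using linear_continuous_on[OF linear_linear[THEN iffD2, OF f(1)]]
    by (intro borel_measurable_continuous_onI) simp
  have U0: "0 < measure lborel ?U" by (simp add: content_cball_pos)
  have finU: "emeasure lborel ?U = ennreal (measure lborel ?U)"
    using emeasure_bounded_finite[OF bounded_cball, of "0 :: 'a" 1] by (intro emeasure_eq_ennreal_measure) auto
  have sub: "f -` ?U \<subseteq> cball 0 (1 / B)"
  proof
    fix x assume "x \<in> f -` ?U"
    then have "B * norm x \<le> 1" using B(2)[of x] by simp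
    then show "x \<in> cball 0 (1 / B)" using B(1) by (simp add: field_simps)
  qed
  have bdd: "bounded (f -` ?U)" using sub bounded_cball bounded_subset by blast
  have finV: "emeasure lborel (f -` ?U) = ennreal (measure lborel (f -` ?U))"
    using emeasure_bounded_finite[OF bdd] by (intro emeasure_eq_ennreal_measure) auto
  have main: "emeasure lborel (f -` A) = ennreal c * emeasure lborel A" if A: "A \<in> sets borel" for A
  proof -
    have "ennreal (measure lborel ?U) * emeasure lborel (f -` A)
        = ennreal (measure lborel (f -` ?U)) * emeasure lborel A"
      using lborel_linear_scaling_aux[OF f(1) surj A, of ?U] finU finV by (simp add: mult.commute)
    then have "ennreal (1 / measure lborel ?U) * (ennreal (measure lborel ?U) * emeasure lborel (f -` A))
        = ennreal (1 / measure lborel ?U) * (ennreal (measure lborel (f -` ?U)) * emeasure lborel A)" by simp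
    then show ?thesis
      using U0 by (simp add: mult.assoc[symmetric] ennreal_mult[symmetric] c_def)
  qed
  have "c \<noteq> 0"
  proof
    assume "c = 0"
    then have "emeasure lborel (f -` UNIV) = 0" using main[of UNIV] by simp
    then show False by simp
  qed
  then show "0 < c" by (simp add: c_def zero_less_divide_iff less_le)
  show "A \<in> sets borel \<Longrightarrow> emeasure lborel (f -` A) = ennreal c * emeasure lborel A" by (rule main)
  have eq: "distr lborel borel f = density lborel (\<lambda>_. ennreal c)"
  proof (rule measure_eqI)
    fix A assume "A \<in> sets (distr lborel borel f)"
    then have A: "A \<in> sets borel" by simp
    then show "emeasure (distr lborel borel f) A = emeasure (density lborel (\<lambda>_. ennreal c)) A"
      by (simp add: emeasure_distr main emeasure_density nn_integral_cmult_indicator)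
  qed simp
  show "(\<integral>\<^sup>+x. g (f x) \<partial>lborel) = ennreal c * (\<integral>\<^sup>+x. g x \<partial>lborel)" if g[measurable]: "g \<in> borel_measurable borel"
  proof -
    have "(\<integral>\<^sup>+x. g (f x) \<partial>lborel) = (\<integral>\<^sup>+x. g x \<partial>distr lborel borel f)"
      by (subst nn_integral_distr) auto
    also have "\<dots> = ennreal c * (\<integral>\<^sup>+x. g x \<partial>lborel)"
      unfolding eq by (simp add: nn_integral_density nn_integral_cmult)
    finally show ?thesis .
  qed
qed

section \<open>Volumes of boxes and integrals of product decay\<close>

lemma emeasure_box_vec:
  assumes "\<And>i. 0 \<le> r i"
  shows "emeasure lborel {x :: real^'k::finite. \<forall>i. \<bar>x $ i - c i\<bar> \<le> r i} = ennreal (\<Prod>i\<in>UNIV. 2 * r i)"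
proof -
  have eq: "{x :: real^'k. \<forall>i. \<bar>x $ i - c i\<bar> \<le> r i} = cbox (\<chi> i. c i - r i) (\<chi> i. c i + r i)"
    by (auto simp: mem_box_cart abs_le_iff algebra_simps)
  have "(\<chi> i. c i) \<in> cbox (\<chi> i. c i - r i) (\<chi> i. c i + r i)"
    using assms by (auto simp: mem_box_cart)
  then have "cbox (\<chi> i. c i - r i) (\<chi> i. c i + r i) \<noteq> {}" by blast
  then have "measure lborel (cbox (\<chi> i. c i - r i) (\<chi> i. c i + r i)) = (\<Prod>i\<in>UNIV. 2 * r i)"
    by (simp add: content_cbox_cart)
  moreover have "emeasure lborel (cbox (\<chi> i. c i - r i) (\<chi> i. c i + r i) :: (real^'k) set)
      = ennreal (measure lborel (cbox (\<chi> i. c i - r i) (\<chi> i. c i + r i)))"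
    by (rule emeasure_eq_ennreal_measure) (use emeasure_lborel_cbox_finite in \<open>auto simp: less_top[symmetric]\<close>)
  ultimately show ?thesis unfolding eq by simp
qed

lemma prod_Basis_vec:
  fixes F :: "('a::euclidean_space)^'n::finite \<Rightarrow> 'b::comm_monoid_mult"
  shows "(\<Prod>b\<in>Basis. F b) = (\<Prod>i\<in>UNIV. \<Prod>u\<in>Basis. F (axis i u))"
proof -
  have "inj_on (\<lambda>(i, u). axis i u :: 'a^'n) (UNIV \<times> Basis)"
    by (auto simp: inj_on_def axis_eq_axis)
  moreover have "(\<lambda>(i, u). axis i u :: 'a^'n) ` (UNIV \<times> Basis) = Basis"
    by (auto simp: Basis_vec_def)
  ultimately have "(\<Prod>b\<in>Basis. F b) = (\<Prod>(i, u)\<in>UNIV \<times> Basis. F (axis i u))"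
    by (subst prod.reindex_cong[of _ "UNIV \<times> Basis"]) auto
  then show ?thesis by (simp add: prod.cartesian_product)
qed

lemma nn_integral_decay_finite:
  assumes "1 < s"
  shows "(\<integral>\<^sup>+u. ennreal ((1 + \<bar>u\<bar>) powr (- s)) \<partial>lborel) < \<infinity>"
proof -
  have hi: "((\<lambda>x. x powr - s) has_integral -(1 powr (- s + 1)) / (- s + 1)) {1..}"
    by (rule has_integral_powr_to_inf) (use assms in auto)
  have "(\<integral>\<^sup>+x. ennreal (x powr - s) * indicator {1..} x \<partial>lborel) = ennreal (-(1 powr (- s + 1)) / (- s + 1))"
    by (rule nn_integral_has_integral_lebesgue'[OF _ hi]) auto
  then have fin1: "(\<integral>\<^sup>+x. ennreal (x powr - s) * indicator {1..} x \<partial>lborel) < \<infinity>" by simp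
  have fin2: "(\<integral>\<^sup>+u. ennreal ((1 + u) powr - s) * indicator {0..} u \<partial>lborel) < \<infinity>"
  proof -
    have "(\<integral>\<^sup>+u. ennreal ((1 + u) powr - s) * indicator {1..} (1 + u) \<partial>lborel)
        = (\<integral>\<^sup>+x. ennreal (x powr - s) * indicator {1..} x \<partial>lborel)"
      by (rule nn_integral_lborel_translate) measurable
    moreover have "indicator {1..} (1 + u) = (indicator {0..} u :: ennreal)" for u :: real
      by (simp add: indicator_def)
    ultimately show ?thesis using fin1 by simp
  qed
  have fin3: "(\<integral>\<^sup>+u. ennreal ((1 - u) powr - s) * indicator {0..} (- u) \<partial>lborel) < \<infinity>"
  proof -
    have "(\<integral>\<^sup>+u. ennreal ((1 + (0 - u)) powr - s) * indicator {0..} (0 - u) \<partial>lborel)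
        = (\<integral>\<^sup>+u. ennreal ((1 + u) powr - s) * indicator {0..} u \<partial>lborel)"
      by (rule nn_integral_lborel_reflect) measurable
    then show ?thesis using fin2 by simp
  qed
  have "(\<integral>\<^sup>+u. ennreal ((1 + \<bar>u\<bar>) powr (- s)) \<partial>lborel)
      \<le> (\<integral>\<^sup>+u. ennreal ((1 + u) powr - s) * indicator {0..} u + ennreal ((1 - u) powr - s) * indicator {0..} (- u) \<partial>lborel)"
    by (intro nn_integral_mono) (auto simp: indicator_def abs_if)
  also have "\<dots> = (\<integral>\<^sup>+u. ennreal ((1 + u) powr - s) * indicator {0..} u \<partial>lborel)
      + (\<integral>\<^sup>+u. ennreal ((1 - u) powr - s) * indicator {0..} (- u) \<partial>lborel)"
    by (intro nn_integral_add) measurable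
  also have "\<dots> < \<infinity>" using fin2 fin3 by simp
  finally show ?thesis .
qed

lemma nn_integral_matrix_decay_finite:
  assumes "1 < s"
  shows "(\<integral>\<^sup>+x. (\<Prod>i\<in>UNIV. \<Prod>j\<in>UNIV. ennreal ((1 + \<bar>(x::real^'k::finite^'n::finite) $ i $ j\<bar>) powr (- s))) \<partial>lborel) < \<infinity>"
proof -
  let ?f = "\<lambda>u::real. ennreal ((1 + \<bar>u\<bar>) powr (- s))"
  have "(\<Prod>i\<in>UNIV. \<Prod>j\<in>UNIV. ?f (x $ i $ j)) = (\<Prod>b\<in>Basis. ?f (x \<bullet> b))" for x :: "real^'k^'n"
    by (simp add: prod_Basis_vec inner_axis)
  then have "(\<integral>\<^sup>+x. (\<Prod>i\<in>UNIV. \<Prod>j\<in>UNIV. ?f ((x::real^'k^'n) $ i $ j)) \<partial>lborel)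
      = (\<integral>\<^sup>+x. (\<Prod>b\<in>Basis. ?f ((x::real^'k^'n) \<bullet> b)) \<partial>lborel)" by simp
  also have "\<dots> = (\<Prod>b\<in>(Basis :: (real^'k^'n) set). \<integral>\<^sup>+u. ?f u \<partial>lborel)"
    by (rule nn_integral_lborel_prod) auto
  also have "\<dots> < \<infinity>"
    using nn_integral_decay_finite[OF assms] by (simp add: power_eq_top_ennreal_iff less_top[symmetric])
  finally show ?thesis .
qed

section \<open>Taylor coefficients of polynomials\<close>

text \<open>The Leibniz rule stops after two terms. At \<open>r = 0\<close> the truncated
  \<open>r - 1\<close> is harmless, since its coefficient is 0.\<close>

lemma higher_pderiv_linear_mult:
  fixes q :: "'a::idom poly"
  shows "(pderiv ^^ r) ([:-z, 1:] * q) = [:-z, 1:] * (pderiv ^^ r) q + smult (of_nat r) ((pderiv ^^ (r - 1)) q)"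
proof (induction r)
  case (Suc r)
  have "(pderiv ^^ Suc r) ([:-z, 1:] * q)
      = pderiv ([:-z, 1:] * (pderiv ^^ r) q) + smult (of_nat r) (pderiv ((pderiv ^^ (r - 1)) q))"
    using Suc by (simp add: pderiv_add pderiv_smult)
  also have "pderiv ([:-z, 1:] * (pderiv ^^ r) q) = [:-z, 1:] * (pderiv ^^ Suc r) q + (pderiv ^^ r) q"
    by (simp only: pderiv_mult) (simp add: pderiv_pCons)
  also have "smult (of_nat r) (pderiv ((pderiv ^^ (r - 1)) q)) = smult (of_nat r) ((pderiv ^^ r) q)"
    by (cases r) auto
  finally show ?case by (simp add: smult_add_left algebra_simps)
qed simp

text \<open>On a product of linear factors each derivative trades a factor \<open>y - z\<close>, of
  size at least \<open>\<rho>\<close>, for 1. The induction splits off one root; the constants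
  depend on the degree bound and the order only.\<close>

lemma higher_pderiv_bound_away_from_roots:
  "\<exists>K :: nat \<Rightarrow> real. (\<forall>r. 0 \<le> K r) \<and> (\<forall>(q :: complex poly) y \<rho> r. degree q \<le> d \<longrightarrow> 0 < \<rho> \<longrightarrow>
     (\<forall>z. poly q z = 0 \<longrightarrow> \<rho> \<le> norm (y - z)) \<longrightarrow>
     norm (poly ((pderiv ^^ r) q) y) \<le> K r * norm (poly q y) / \<rho> ^ r)"
proof (induction d)
  case 0
  have "norm (poly ((pderiv ^^ r) q) y) \<le> 1 * norm (poly q y) / \<rho> ^ r"
    if "degree q \<le> 0" "0 < \<rho>" for q :: "complex poly" and y \<rho> r
  proof -
    have "degree q = 0" using that by simp
    then obtain c where c: "q = [:c:]" by (rule degree_eq_zeroE)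
    have "(pderiv ^^ Suc m) q = 0" for m by (simp add: c funpow_swap1 pderiv_pCons)
    then show ?thesis using that by (cases r) auto
  qed
  then show ?case by (intro exI[of _ "\<lambda>_. 1"] conjI allI impI) auto
next
  case (Suc d)
  obtain K :: "nat \<Rightarrow> real" where K: "(\<forall>r. 0 \<le> K r) \<and> (\<forall>(q :: complex poly) y \<rho> r. degree q \<le> d \<longrightarrow> 0 < \<rho> \<longrightarrow>
     (\<forall>z. poly q z = 0 \<longrightarrow> \<rho> \<le> norm (y - z)) \<longrightarrow>
     norm (poly ((pderiv ^^ r) q) y) \<le> K r * norm (poly q y) / \<rho> ^ r)"
    by (rule exE[OF Suc.IH])
  have K0: "0 \<le> K r" for r using K by blast
  have K1: "norm (poly ((pderiv ^^ r) q) y) \<le> K r * norm (poly q y) / \<rho> ^ r"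
    if "degree q \<le> d" "0 < \<rho>" "\<And>z. poly q z = 0 \<Longrightarrow> \<rho> \<le> norm (y - z)" for q :: "complex poly" and y \<rho> r
    using K that by blast
  define L where "L r = K r + real r * K (r - 1)" for r
  have L0: "0 \<le> L r" for r using K0 by (simp add: L_def)
  have "norm (poly ((pderiv ^^ r) q) y) \<le> L r * norm (poly q y) / \<rho> ^ r"
    if q: "degree q \<le> Suc d" and \<rho>: "0 < \<rho>" and far: "\<And>z. poly q z = 0 \<Longrightarrow> \<rho> \<le> norm (y - z)"
    for q :: "complex poly" and y \<rho> r
  proof (cases "degree q = 0")
    case True
    have "norm (poly ((pderiv ^^ r) q) y) \<le> K r * norm (poly q y) / \<rho> ^ r"
      using True \<rho> far by (intro K1) auto
    also have "\<dots> \<le> L r * norm (poly q y) / \<rho> ^ r"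
      using K0 \<rho> by (intro divide_right_mono mult_right_mono) (auto simp: L_def)
    finally show ?thesis .
  next
    case False
    then have "\<not> constant (poly q)" by (simp add: constant_degree)
    then obtain z where z: "poly q z = 0" using fundamental_theorem_of_algebra by blast
    then obtain p where p: "q = [:-z, 1:] * p" by (auto simp: poly_eq_0_iff_dvd)
    have "p \<noteq> 0" using p False by auto
    then have "degree q = Suc (degree p)" unfolding p by (subst degree_mult_eq) auto
    then have dp: "degree p \<le> d" using q by simp
    have farp: "\<rho> \<le> norm (y - w)" if "poly p w = 0" for w using far[of w] that by (simp add: p)
    define a where "a = norm (poly p y)"
    define b where "b = norm (y - z)"
    have b: "\<rho> \<le> b" using far[OF z] by (simp add: b_def)
    have qy: "norm (poly q y) = b * a"
      by (simp add: p a_def b_def norm_mult[symmetric] algebra_simps)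
    have "norm (poly ((pderiv ^^ r) q) y)
        \<le> b * norm (poly ((pderiv ^^ r) p) y) + real r * norm (poly ((pderiv ^^ (r - 1)) p) y)"
    proof -
      have "poly ((pderiv ^^ r) q) y = (y - z) * poly ((pderiv ^^ r) p) y + of_nat r * poly ((pderiv ^^ (r - 1)) p) y"
        unfolding p higher_pderiv_linear_mult by (simp add: algebra_simps)
      then show ?thesis using norm_triangle_ineq[of "(y - z) * poly ((pderiv ^^ r) p) y" "of_nat r * poly ((pderiv ^^ (r - 1)) p) y"]
        by (simp add: norm_mult b_def)
    qed
    also have "\<dots> \<le> b * (K r * a / \<rho> ^ r) + real r * K (r - 1) * (b * a / \<rho> ^ r)"
    proof (intro add_mono)
      show "b * norm (poly ((pderiv ^^ r) p) y) \<le> b * (K r * a / \<rho> ^ r)"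
        unfolding a_def by (intro mult_left_mono K1 dp \<rho> farp) (auto simp: b_def)
      show "real r * norm (poly ((pderiv ^^ (r - 1)) p) y) \<le> real r * K (r - 1) * (b * a / \<rho> ^ r)"
      proof (cases r)
        case (Suc m)
        have "norm (poly ((pderiv ^^ m) p) y) \<le> K m * a / \<rho> ^ m"
          unfolding a_def by (intro K1 dp \<rho> farp)
        \<comment> \<open>The power of \<open>\<rho>\<close> missing in the bound for
          \<open>p\<close> is supplied by the factor \<open>b\<close>, which is at least
          \<open>\<rho>\<close>.\<close>
        also have "\<dots> = K m * (\<rho> * a / \<rho> ^ Suc m)" using \<rho> by simp
        also have "\<dots> \<le> K m * (b * a / \<rho> ^ Suc m)"
          using b \<rho> K0 by (intro mult_left_mono divide_right_mono mult_right_mono) (auto simp: a_def)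
        finally have "real r * norm (poly ((pderiv ^^ (r - 1)) p) y) \<le> real r * (K (r - 1) * (b * a / \<rho> ^ r))"
          using Suc by (intro mult_left_mono) auto
        then show ?thesis by (simp only: mult.assoc)
      qed simp
    qed
    also have "\<dots> = L r * norm (poly q y) / \<rho> ^ r"
      by (simp add: qy L_def add_divide_distrib algebra_simps)
    finally show ?thesis .
  qed
  then show ?case using L0 by (intro exI[of _ L]) blast
qed

text \<open>The Taylor coefficient \<open>P^(r)(y) / r!\<close> (see
  \<open>tc_higher_pderiv\<close>), read off from the shifted polynomial, so that a change of base
  point is just a second shift.\<close>

definition tc :: "complex poly \<Rightarrow> complex \<Rightarrow> nat \<Rightarrow> complex" where
  "tc P y r = coeff (pcompose P [:y, 1:]) r"

lemma coeff_pcompose_shift: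
  fixes R :: "complex poly"
  assumes "degree R \<le> d"
  shows "coeff (pcompose R [:h, 1:]) r = (\<Sum>s\<le>d. coeff R s * of_nat (s choose r) * h ^ (s - r))"
proof -
  have c: "coeff ([:h, 1:] ^ s) r = of_nat (s choose r) * h ^ (s - r)" for s
  proof (cases "r \<le> s")
    case True
    then show ?thesis by (simp add: coeff_linear_poly_power)
  next
    case False
    moreover have "degree ([:h, 1:] ^ s) \<le> s" using degree_power_le[of "[:h, 1:]" s] by simp
    ultimately show ?thesis by (simp add: coeff_eq_0 binomial_eq_0)
  qed
  have pw: "pcompose ([:0, 1:] ^ s) q = q ^ s" for s and q :: "complex poly"
  proof (induction s)
    case (Suc s)
    have "pcompose ([:0, 1:] ^ Suc s) q = pcompose [:0, 1:] q * pcompose ([:0, 1:] ^ s) q"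
      by (simp only: power_Suc pcompose_mult)
    then show ?case by (simp add: Suc pcompose_pCons)
  qed (simp add: pcompose_1)
  have "R = (\<Sum>s\<le>d. monom (coeff R s) s)" using assms by (rule poly_as_sum_of_monoms'[symmetric])
  then have "pcompose R [:h, 1:] = pcompose (\<Sum>s\<le>d. monom (coeff R s) s) [:h, 1:]"
    by (rule arg_cong)
  also have "\<dots> = (\<Sum>s\<le>d. pcompose (monom (coeff R s) s) [:h, 1:])"
    by (rule pcompose_sum)
  also have "\<dots> = (\<Sum>s\<le>d. smult (coeff R s) ([:h, 1:] ^ s))"
    by (simp only: monom_altdef pcompose_smult pw)
  finally show ?thesis by (simp add: coeff_sum c mult.assoc)
qed

lemma tc_sum:
  assumes "degree P \<le> d"
  shows "tc P y r = (\<Sum>s\<le>d. coeff P s * of_nat (s choose r) * y ^ (s - r))"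
  unfolding tc_def using assms by (rule coeff_pcompose_shift)

lemma tc_shift:
  assumes "degree P \<le> d"
  shows "tc P (y + h) r = (\<Sum>s\<le>d. tc P y s * of_nat (s choose r) * h ^ (s - r))"
proof -
  have "pcompose (pcompose P [:y, 1:]) [:h, 1:] = pcompose P [:y + h, 1:]"
    by (simp add: pcompose_assoc[symmetric] pcompose_pCons add.commute)
  moreover have "degree (pcompose P [:y, 1:]) \<le> d" using assms by (simp add: degree_pcompose)
  ultimately show ?thesis unfolding tc_def by (metis coeff_pcompose_shift)
qed

lemma tc_higher_pderiv: "fact r * tc P y r = poly ((pderiv ^^ r) P) y"
proof -
  have "(pderiv ^^ r) (pcompose P [:y, 1:]) = pcompose ((pderiv ^^ r) P) [:y, 1:]"
    by (induction r) (simp_all add: pderiv_pcompose pderiv_pCons)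
  then have "coeff ((pderiv ^^ r) (pcompose P [:y, 1:])) 0 = poly ((pderiv ^^ r) P) y"
    by (simp add: poly_0_coeff_0[symmetric] poly_pcompose)
  moreover have "coeff ((pderiv ^^ r) (pcompose P [:y, 1:])) 0 = fact r * tc P y r"
    by (simp add: coeff_higher_pderiv tc_def pochhammer_fact)
  ultimately show ?thesis by simp
qed

text \<open>The coefficient of order 0 is left out, as constants do not oscillate; the summand 1
  keeps negative powers bounded.\<close>

definition height :: "nat \<Rightarrow> complex poly \<Rightarrow> complex \<Rightarrow> real" where
  "height n P y = 1 + (\<Sum>r=1..n. norm (tc P y r) powr (1 / real r))"

lemma height_ge_1: "1 \<le> height n P y"
  by (simp add: height_def sum_nonneg)

lemma tc_le_height:
  assumes "r \<in> {1..n}"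
  shows "norm (tc P y r) \<le> height n P y ^ r"
proof -
  have "norm (tc P y r) powr (1 / real r) \<le> (\<Sum>r=1..n. norm (tc P y r) powr (1 / real r))"
    using assms by (intro member_le_sum) auto
  then have le: "norm (tc P y r) powr (1 / real r) \<le> height n P y" by (simp add: height_def)
  have "norm (tc P y r) = (norm (tc P y r) powr (1 / real r)) ^ r"
    using assms by (cases "tc P y r = 0") (auto simp: powr_realpow[symmetric] powr_powr zero_power)
  also have "\<dots> \<le> height n P y ^ r" using le by (intro power_mono) auto
  finally show ?thesis .
qed

text \<open>In the expansion about \<open>y\<close> the coefficient of order \<open>s\<close> is at
  most \<open>H ^ s\<close> and comes with \<open>h ^ (s - r)\<close>, of size at most
  \<open>H ^ r / H ^ s\<close>; so every term is at most \<open>H ^ r\<close> times a binomial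
  coefficient below or equal to \<open>2 ^ n\<close>. In the constant, \<open>n + 1\<close> counts
  these terms and the outer \<open>n\<close> the summands of the height.\<close>

lemma height_slowly_varying:
  assumes P: "degree P \<le> n" and h: "norm h \<le> 1 / height n P y"
  shows "height n P (y + h) \<le> (1 + real n * ((real n + 1) * 2 ^ n)) * height n P y"
proof -
  define H where "H = height n P y"
  have H: "1 \<le> H" unfolding H_def by (rule height_ge_1)
  define M where "M = (real n + 1) * 2 ^ n"
  have M: "1 \<le> M" unfolding M_def using mult_mono[of 1 "real n + 1" 1 "2 ^ n"] by simp
  have "norm (tc P (y + h) r) powr (1 / real r) \<le> M * H" if r: "r \<in> {1..n}" for r
  proof -
    have "norm (tc P (y + h) r) \<le> (\<Sum>s\<le>n. norm (tc P y s * of_nat (s choose r) * h ^ (s - r)))"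
      unfolding tc_shift[OF P] by (rule norm_sum)
    also have "\<dots> \<le> (\<Sum>s\<le>n. 2 ^ n * H ^ r)"
    proof (rule sum_mono)
      fix s assume s: "s \<in> {..n}"
      show "norm (tc P y s * of_nat (s choose r) * h ^ (s - r)) \<le> 2 ^ n * H ^ r"
      proof (cases "r \<le> s")
        case True
        have "norm (tc P y s) \<le> H ^ s" unfolding H_def using True r s by (intro tc_le_height) auto
        moreover have "norm h ^ (s - r) \<le> (1 / H) ^ (s - r)" using h by (intro power_mono) (auto simp: H_def)
        moreover have "real (s choose r) \<le> 2 ^ n"
        proof -
          have "s choose r \<le> 2 ^ s" by (rule binomial_le_pow2)
          also have "\<dots> \<le> 2 ^ n" using s by (intro power_increasing) auto
          finally show ?thesis by (metis of_nat_le_iff of_nat_power of_nat_numeral)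
        qed
        ultimately have "norm (tc P y s) * real (s choose r) * norm h ^ (s - r) \<le> H ^ s * 2 ^ n * (1 / H) ^ (s - r)"
          using H by (intro mult_mono) auto
        also have "\<dots> = 2 ^ n * H ^ r"
        proof -
          have "H ^ s = H ^ r * H ^ (s - r)" using True by (simp add: power_add[symmetric])
          then show ?thesis using H by (simp add: power_one_over)
        qed
        finally show ?thesis by (simp add: norm_mult norm_power)
      next
        case False
        then show ?thesis using H by (simp add: binomial_eq_0)
      qed
    qed
    also have "\<dots> = M * H ^ r" by (simp add: M_def algebra_simps)
    also have "\<dots> \<le> (M * H) ^ r"
      using M H r self_le_power[of M r] by (simp add: power_mult_distrib mult_right_mono)
    finally have "norm (tc P (y + h) r) powr (1 / real r) \<le> ((M * H) ^ r) powr (1 / real r)"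
      by (intro powr_mono2) auto
    also have "\<dots> = M * H" using M H r by (simp add: powr_realpow[symmetric] powr_powr)
    finally show ?thesis .
  qed
  then have "(\<Sum>r=1..n. norm (tc P (y + h) r) powr (1 / real r)) \<le> (\<Sum>r=1..n. M * H)" by (rule sum_mono)
  then have "height n P (y + h) \<le> 1 + real n * (M * H)" by (simp add: height_def[of _ _ "y + h"])
  also have "\<dots> \<le> (1 + real n * M) * H" using H by (simp add: algebra_simps)
  finally show ?thesis by (simp add: H_def M_def)
qed

text \<open>Pigeonhole: the \<open>n\<close> summands add up to the height minus 1, hence to at
  least half the height.\<close>

lemma height_lower:
  assumes "2 \<le> height n P y"
  shows "\<exists>r\<in>{1..n}. (height n P y / (2 * real n)) ^ r \<le> norm (tc P y r)"
proof (rule ccontr)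
  define H where "H = height n P y"
  assume "\<not> ?thesis"
  then have less: "norm (tc P y r) < (H / (2 * real n)) ^ r" if "r \<in> {1..n}" for r
    using that by (force simp: H_def not_le)
  have "n \<noteq> 0"
  proof
    assume "n = 0"
    then show False using assms by (simp add: height_def)
  qed
  have H: "2 \<le> H" using assms by (simp add: H_def)
  have "norm (tc P y r) powr (1 / real r) \<le> H / (2 * real n)" if r: "r \<in> {1..n}" for r
  proof -
    have "norm (tc P y r) powr (1 / real r) \<le> ((H / (2 * real n)) ^ r) powr (1 / real r)"
      using less[OF r] by (intro powr_mono2) auto
    also have "\<dots> = H / (2 * real n)"
      using r H by (simp add: powr_realpow[symmetric] powr_powr)
    finally show ?thesis .
  qed
  then have "(\<Sum>r=1..n. norm (tc P y r) powr (1 / real r)) \<le> (\<Sum>r=1..n. H / (2 * real n))" by (rule sum_mono)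
  then have "H \<le> 1 + H / 2" using \<open>n \<noteq> 0\<close> by (simp add: H_def height_def[of n P y])
  \<comment> \<open>Taking roots kept only weak inequalities, so the borderline case survives. The
    coefficient of order 1, where the root is trivial, gives a strict one.\<close>
  then have eq: "H = 2" using H by simp
  have "norm (tc P y 1) powr (1 / real 1) < H / (2 * real n)"
    using less[of 1] \<open>n \<noteq> 0\<close> by simp
  then have "(\<Sum>r=1..n. norm (tc P y r) powr (1 / real r)) < (\<Sum>r=1..n. H / (2 * real n))"
    using \<open>\<And>r. r \<in> {1..n} \<Longrightarrow> norm (tc P y r) powr (1 / real r) \<le> H / (2 * real n)\<close> \<open>n \<noteq> 0\<close>
    by (intro sum_strict_mono_ex1) (auto intro!: bexI[of _ 1])
  then have "H < 1 + H / 2" using \<open>n \<noteq> 0\<close> by (simp add: H_def height_def[of n P y])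
  then show False using eq by simp
qed

section \<open>Bounds away from and near the critical points\<close>

text \<open>Some Taylor coefficient of order \<open>r\<close> is at least of order
  \<open>H ^ r\<close>. Up to \<open>r!\<close> it is the derivative of order \<open>r - 1\<close>
  of \<open>P'\<close>, hence at most a constant times \<open>|P'| / \<delta> ^ (r - 1)\<close> away
  from the critical points. As \<open>H * \<delta>\<close> is at least 1, \<open>|P'|\<close> is at
  least of order \<open>H\<close>.\<close>

lemma pderiv_lower_bound:
  "\<exists>c>0. \<forall>P y H \<delta>. degree P \<le> n \<longrightarrow> 2 \<le> H \<longrightarrow> H \<le> height n P y \<longrightarrow> 0 < \<delta> \<longrightarrow> 1 \<le> H * \<delta> \<longrightarrow>
     (\<forall>z. poly (pderiv P) z = 0 \<longrightarrow> \<delta> / 2 \<le> norm (y - z)) \<longrightarrow> c * H \<le> norm (poly (pderiv P) y)"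
proof -
  obtain K :: "nat \<Rightarrow> real" where K: "(\<forall>r. 0 \<le> K r) \<and> (\<forall>(q :: complex poly) y \<rho> r. degree q \<le> n \<longrightarrow> 0 < \<rho> \<longrightarrow>
     (\<forall>z. poly q z = 0 \<longrightarrow> \<rho> \<le> norm (y - z)) \<longrightarrow>
     norm (poly ((pderiv ^^ r) q) y) \<le> K r * norm (poly q y) / \<rho> ^ r)"
    by (rule exE[OF higher_pderiv_bound_away_from_roots])
  define Km where "Km = 1 + (\<Sum>r\<le>n. K r)"
  have Km: "K r \<le> Km" if "r \<le> n" for r
    using member_le_sum[of r "{..n}" K] K that by (simp add: Km_def)
  have Km1: "1 \<le> Km" using K by (simp add: Km_def sum_nonneg)
  \<comment> \<open>The \<open>2 * n\<close> of the pigeonhole and the 2 in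
    \<open>\<delta> / 2\<close> cost at most \<open>(4 * n) ^ r\<close>, which is bounded by
    \<open>(4 * n + 1) ^ n\<close> for all \<open>r\<close> in question.\<close>
  define c where "c = (1 / (4 * real n + 1)) ^ n / Km"
  have "c > 0" using Km1 by (simp add: c_def)
  moreover have "c * H \<le> norm (poly (pderiv P) y)"
    if P: "degree P \<le> n" and H: "2 \<le> H" "H \<le> height n P y" and \<delta>: "0 < \<delta>" "1 \<le> H * \<delta>"
      and far: "\<And>z. poly (pderiv P) z = 0 \<Longrightarrow> \<delta> / 2 \<le> norm (y - z)" for P y H \<delta>
  proof -
    obtain r where r: "r \<in> {1..n}" "(height n P y / (2 * real n)) ^ r \<le> norm (tc P y r)"
      using height_lower[of n P y] H by auto
    have n: "1 \<le> n" using r by simp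
    define p where "p = norm (poly (pderiv P) y)"
    have "(pderiv ^^ r) P = (pderiv ^^ (r - 1)) (pderiv P)"
    proof -
      obtain s where "r = Suc s" using r(1) by (cases r) auto
      then show ?thesis by (simp add: funpow_swap1)
    qed
    then have "fact r * norm (tc P y r) = norm (poly ((pderiv ^^ (r - 1)) (pderiv P)) y)"
      using arg_cong[OF tc_higher_pderiv[of r P y], of norm] by (simp add: norm_mult)
    moreover have "1 * norm (tc P y r) \<le> fact r * norm (tc P y r)"
      by (intro mult_right_mono fact_ge_1) auto
    ultimately have "norm (tc P y r) \<le> norm (poly ((pderiv ^^ (r - 1)) (pderiv P)) y)" by simp
    also have "\<dots> \<le> K (r - 1) * p / (\<delta> / 2) ^ (r - 1)"
      unfolding p_def using K P \<delta> far by (simp add: degree_pderiv)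
    also have "\<dots> \<le> Km * p / (\<delta> / 2) ^ (r - 1)"
      using r \<delta> Km[of "r - 1"] by (intro divide_right_mono mult_right_mono) (auto simp: p_def)
    finally have tcr: "norm (tc P y r) * (\<delta> / 2) ^ (r - 1) \<le> Km * p"
      using \<delta> by (simp add: pos_le_divide_eq)
    have "(1 / (4 * real n + 1)) ^ n \<le> (1 / (4 * real n + 1)) ^ r"
      using r by (intro power_decreasing) auto
    also have "\<dots> \<le> (1 / (4 * real n)) ^ r" using n by (intro power_mono divide_left_mono) auto
    finally have "(1 / (4 * real n + 1)) ^ n * H \<le> (1 / (4 * real n)) ^ r * H" using H by (intro mult_right_mono) auto
    also have "\<dots> \<le> (1 / (4 * real n)) ^ r * (2 ^ r * H * (H * \<delta> / 2 * 2) ^ (r - 1) / 2 ^ (r - 1))"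
    proof (intro mult_left_mono)
      have "(2::real) ^ r = 2 * 2 ^ (r - 1)" using r by (cases r) auto
      moreover have "1 \<le> (H * \<delta>) ^ (r - 1)" using \<delta> by (intro one_le_power)
      then have "1 * H \<le> 2 * (H * \<delta>) ^ (r - 1) * H" using H by (intro mult_right_mono) auto
      ultimately show "H \<le> 2 ^ r * H * (H * \<delta> / 2 * 2) ^ (r - 1) / 2 ^ (r - 1)" by (simp add: mult_ac)
    qed auto
    also have "\<dots> = (H / (2 * real n)) ^ r * (\<delta> / 2) ^ (r - 1)"
    proof -
      obtain s where s: "r = Suc s" using r(1) by (cases r) auto
      have "(4::real) ^ s = 2 ^ s * 2 ^ s" by (simp add: power_mult_distrib[symmetric])
      then show ?thesis using n by (simp add: s power_divide power_mult_distrib field_simps)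
    qed
    also have "\<dots> \<le> (height n P y / (2 * real n)) ^ r * (\<delta> / 2) ^ (r - 1)"
      using H \<delta> by (intro mult_right_mono power_mono divide_right_mono) auto
    also have "\<dots> \<le> norm (tc P y r) * (\<delta> / 2) ^ (r - 1)"
      using r(2) \<delta> by (intro mult_right_mono) auto
    also have "\<dots> \<le> Km * p" by (rule tcr)
    finally show ?thesis using Km1 by (simp add: c_def p_def field_simps)
  qed
  ultimately show ?thesis by (intro exI[of _ c]) auto
qed

context conj_frame begin

text \<open>The weight given to \<open>bd_inverse\<close> is \<open>|P'|\<close> itself, which
  controls the derivatives of \<open>P'\<close> away from its roots at the scale
  \<open>\<delta> i\<close>. The lower bound of order \<open>H\<close> is inserted only
  afterwards.\<close>

lemma bd_inverse_pderiv:
  "\<exists>K\<ge>0. \<forall>P \<delta> U H i. degree P \<le> n \<longrightarrow> open U \<longrightarrow> (\<forall>j. 0 < \<delta> j) \<longrightarrow> 2 \<le> H \<longrightarrow> 1 \<le> H * \<delta> i \<longrightarrow>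
     (\<forall>x\<in>U. H \<le> height n P (Y i x)) \<longrightarrow>
     (\<forall>x\<in>U. \<forall>z. poly (pderiv P) z = 0 \<longrightarrow> \<delta> i / 2 \<le> norm (Y i x - z)) \<longrightarrow>
     bd \<delta> U m (\<lambda>_. K / H) (\<lambda>x. inverse (2 * of_real pi * \<i> * poly (pderiv P) (Y i x))) \<and>
     (\<forall>x\<in>U. poly (pderiv P) (Y i x) \<noteq> 0)"
proof -
  obtain c where c: "c > 0" and clow: "\<forall>P y H \<delta>. degree P \<le> n \<longrightarrow> 2 \<le> H \<longrightarrow> H \<le> height n P y \<longrightarrow> 0 < \<delta> \<longrightarrow> 1 \<le> H * \<delta> \<longrightarrow>
     (\<forall>z. poly (pderiv P) z = 0 \<longrightarrow> \<delta> / 2 \<le> norm (y - z)) \<longrightarrow> c * H \<le> norm (poly (pderiv P) y)"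
    using pderiv_lower_bound[of n] by blast
  obtain K :: "nat \<Rightarrow> real" where K: "(\<forall>r. 0 \<le> K r) \<and> (\<forall>(q :: complex poly) y \<rho> r. degree q \<le> n \<longrightarrow> 0 < \<rho> \<longrightarrow>
     (\<forall>z. poly q z = 0 \<longrightarrow> \<rho> \<le> norm (y - z)) \<longrightarrow>
     norm (poly ((pderiv ^^ r) q) y) \<le> K r * norm (poly q y) / \<rho> ^ r)"
    by (rule exE[OF higher_pderiv_bound_away_from_roots])
  define C1 where "C1 = (\<Sum>r\<le>m. K r * 2 ^ r)"
  have C1: "K r * 2 ^ r \<le> C1" if "r \<le> m" for r
    unfolding C1_def using K that by (intro member_le_sum) auto
  have C10: "0 \<le> C1" unfolding C1_def using K by (intro sum_nonneg) auto
  obtain K2 where K2: "\<forall>\<delta> U w g. open U \<longrightarrow> (\<forall>j. 0 < \<delta> j) \<longrightarrow> bd \<delta> U m (\<lambda>x. C1 * w x) g \<longrightarrow>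
     (\<forall>x\<in>U. 0 < w x \<and> w x \<le> norm (g x)) \<longrightarrow> bd \<delta> U m (\<lambda>x. K2 / w x) (\<lambda>x. inverse (g x))"
    by (rule exE[OF bd_inverse])
  define K3 where "K3 = norm (inverse (2 * of_real pi * \<i>)) * \<bar>K2\<bar> / c"
  have "bd \<delta> U m (\<lambda>_. K3 / H) (\<lambda>x. inverse (2 * of_real pi * \<i> * poly (pderiv P) (Y i x))) \<and>
     (\<forall>x\<in>U. poly (pderiv P) (Y i x) \<noteq> 0)"
    if P: "degree P \<le> n" and U: "open U" and \<delta>: "\<forall>j. 0 < \<delta> j" and H: "2 \<le> H" "1 \<le> H * \<delta> i"
      "\<forall>x\<in>U. H \<le> height n P (Y i x)"
      and far: "\<forall>x\<in>U. \<forall>z. poly (pderiv P) z = 0 \<longrightarrow> \<delta> i / 2 \<le> norm (Y i x - z)" for P \<delta> U H i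
  proof -
    have \<delta>0: "0 < \<delta> j" for j using \<delta> by blast
    define p where "p = pderiv P"
    have low: "c * H \<le> norm (poly p (Y i x))" if "x \<in> U" for x
      unfolding p_def using clow P H far \<delta>0 that by blast
    have cH: "0 < c * H" using c H by simp
    have pos: "0 < norm (poly p (Y i x))" if "x \<in> U" for x using low[OF that] cH by linarith
    have "bd \<delta> U m (\<lambda>x. C1 * norm (poly p (Y i x))) (\<lambda>x. poly p (Y i x))"
    proof (rule bd_poly[OF U \<delta>0 C10])
      fix r x assume r: "r \<le> m" and x: "x \<in> U"
      have "norm (poly ((pderiv ^^ r) p) (Y i x)) \<le> K r * norm (poly p (Y i x)) / (\<delta> i / 2) ^ r"
        using K P far x \<delta>0[of i] by (simp add: p_def degree_pderiv)
      also have "\<dots> = (K r * 2 ^ r) * norm (poly p (Y i x)) / \<delta> i ^ r" by (simp add: power_divide)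
      also have "\<dots> \<le> C1 * norm (poly p (Y i x)) / \<delta> i ^ r"
        using C1[OF r] \<delta>0[of i] by (intro divide_right_mono mult_right_mono) auto
      finally show "norm (poly ((pderiv ^^ r) p) (Y i x)) \<le> C1 * norm (poly p (Y i x)) / \<delta> i ^ r" .
    qed simp
    then have "bd \<delta> U m (\<lambda>x. K2 / norm (poly p (Y i x))) (\<lambda>x. inverse (poly p (Y i x)))"
      using pos by (intro K2[rule_format, OF U \<delta>0]) auto
    from bd_cmult[OF U \<delta>0 this, of "inverse (2 * of_real pi * \<i>)"]
    have "bd \<delta> U m (\<lambda>_. K3 / H) (\<lambda>x. inverse (2 * of_real pi * \<i>) * inverse (poly p (Y i x)))"
    proof (rule bd_weight[OF \<delta>0, rotated])
      fix x assume x: "x \<in> U"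
      have "K2 / norm (poly p (Y i x)) \<le> \<bar>K2\<bar> / norm (poly p (Y i x))" by (intro divide_right_mono) auto
      also have "\<dots> \<le> \<bar>K2\<bar> / (c * H)"
        using low[OF x] cH pos[OF x] c H(1) by (intro divide_left_mono mult_pos_pos) auto
      finally have "norm (inverse (2 * of_real pi * \<i>)) * (K2 / norm (poly p (Y i x)))
          \<le> norm (inverse (2 * of_real pi * \<i>)) * (\<bar>K2\<bar> / (c * H))" by (rule mult_left_mono) simp
      then show "norm (inverse (2 * of_real pi * \<i>)) * (K2 / norm (poly p (Y i x))) \<le> K3 / H"
        by (simp add: K3_def)
    qed
    then have "bd \<delta> U m (\<lambda>_. K3 / H) (\<lambda>x. inverse (2 * of_real pi * \<i> * poly (pderiv P) (Y i x)))"
      by (simp only: inverse_mult_distrib p_def)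
    then show ?thesis using pos by (auto simp: p_def)
  qed
  moreover have "0 \<le> K3" using c by (simp add: K3_def)
  ultimately show ?thesis by (intro exI[of _ K3]) blast
qed

section \<open>Real coordinates and volumes near the critical points\<close>

text \<open>Real coordinates: from each pair of conjugate coordinates \<open>Y\<close> one contributes its real
  part and the other one its imaginary part.\<close>

definition rp :: "'k \<Rightarrow> 'k" where "rp j = (SOME i. i \<in> {j, \<kappa> j})"

lemma rp_kappa: "rp (\<kappa> j) = rp j"
  by (simp add: rp_def insert_commute)

lemma rp_cases: "rp j = j \<or> rp j = \<kappa> j"
proof -
  have "rp j \<in> {j, \<kappa> j}" unfolding rp_def by (rule someI[of _ j]) simp
  then show ?thesis by simp
qed

definition rpart :: "'k \<Rightarrow> complex \<Rightarrow> real" where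
  "rpart j z = (if rp j = j then Re z else Im z)"

lemma rpart_diff: "rpart j (z - w) = rpart j z - rpart j w"
  by (simp add: rpart_def)

lemma abs_rpart_le: "\<bar>rpart j z\<bar> \<le> norm z"
  by (simp add: rpart_def abs_Re_le_cmod abs_Im_le_cmod)

text \<open>At a complex place the indices \<open>j\<close> and \<open>\<kappa> j\<close> share out
  the real and the imaginary part; at a real place the imaginary part vanishes and
  \<open>rp j = j\<close>.\<close>

lemma norm_le_rpart:
  assumes "y (\<kappa> j) = cnj (y j)"
  shows "norm (y j) \<le> \<bar>rpart j (y j)\<bar> + \<bar>rpart (\<kappa> j) (y (\<kappa> j))\<bar>"
proof (cases "\<kappa> j = j")
  case True
  then have "Im (y j) = 0" using assms by (simp add: complex_eq_iff)
  moreover have "rp j = j" using rp_cases[of j] True by auto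
  ultimately show ?thesis by (simp add: rpart_def True cmod_eq_Re)
next
  case False
  have "norm (y j) \<le> \<bar>Re (y j)\<bar> + \<bar>Im (y j)\<bar>" by (rule cmod_le)
  moreover have "\<bar>rpart j (y j)\<bar> + \<bar>rpart (\<kappa> j) (y (\<kappa> j))\<bar> = \<bar>Re (y j)\<bar> + \<bar>Im (y j)\<bar>"
    using rp_cases[of j] False by (auto simp: rpart_def rp_kappa assms)
  ultimately show ?thesis by simp
qed

text \<open>Real linear coordinates in which closeness in every \<open>Y j\<close> becomes
  membership in a box.\<close>

definition tmap :: "real^'k \<Rightarrow> real^'k" where
  "tmap x = (\<chi> j. rpart j (Y j x))"

lemma tmap: "linear tmap" "inj tmap"
proof -
  have "Y j (x + y) = Y j x + Y j y" "Y j (c *\<^sub>R x) = c *\<^sub>R Y j x" for j x y c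
    using linear_Y[of j] by (simp_all add: linear_simps)
  then show lin: "linear tmap"
    by (intro linearI) (auto simp: tmap_def rpart_def vec_eq_iff)
  obtain C where C: "\<And>x. norm x \<le> C * (\<Sum>j\<in>UNIV. norm (Y j x))" using norm_le_Y by blast
  have "x = 0" if "tmap x = 0" for x
  proof -
    have "rpart j (Y j x) = 0" for j using that by (simp add: tmap_def vec_eq_iff)
    note z = this
    have "norm (Y j x) \<le> \<bar>rpart j (Y j x)\<bar> + \<bar>rpart (\<kappa> j) (Y (\<kappa> j) x)\<bar>" for j
      by (rule norm_le_rpart[of "\<lambda>j. Y j x"]) (rule Y_cnj)
    then have "norm (Y j x) = 0" for j unfolding z by simp
    then show ?thesis using C[of x] by simp
  qed
  then show "inj tmap" using lin linear_injective_0 by blast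
qed

text \<open>One centre chosen from each \<open>Z j\<close> gives a box; at most
  \<open>N ^ CARD('k)\<close> preimages of boxes under \<open>tmap\<close> cover the set, because
  \<open>rpart\<close> does not increase norms.\<close>

lemma near_measure:
  "\<exists>C\<ge>0. \<forall>Z \<rho>. (\<forall>j. finite (Z j) \<and> card (Z j) \<le> N \<and> 0 \<le> \<rho> j) \<longrightarrow>
     (\<forall>A\<in>sets borel. A \<subseteq> {x. \<forall>j. \<exists>z\<in>Z j. norm (Y j x - z) \<le> \<rho> j} \<longrightarrow>
       measure lborel A \<le> C * (\<Prod>j\<in>UNIV. \<rho> j))"
proof -
  obtain c where c: "0 < c" and scale: "\<And>A. A \<in> sets borel \<Longrightarrow> emeasure lborel (tmap -` A) = ennreal c * emeasure lborel A"
    using lborel_linear_scaling(1,2)[OF tmap] by blast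
  define C where "C = real N ^ CARD('k) * (c * 2 ^ CARD('k))"
  have "measure lborel A \<le> C * (\<Prod>j\<in>UNIV. \<rho> j)"
    if Z: "\<And>j. finite (Z j)" "\<And>j. card (Z j) \<le> N" and \<rho>: "\<And>j. 0 \<le> \<rho> j" and A: "A \<in> sets borel"
      "A \<subseteq> {x. \<forall>j. \<exists>z\<in>Z j. norm (Y j x - z) \<le> \<rho> j}" for Z \<rho> A
  proof -
    define B where "B g = {t :: real^'k. \<forall>j. \<bar>t $ j - rpart j (g j)\<bar> \<le> \<rho> j}" for g :: "'k \<Rightarrow> complex"
    have "closed (B g)" for g unfolding B_def
      by (intro closed_Collect_all closed_Collect_le continuous_intros)
    then have B: "B g \<in> sets borel" for g by simp
    define I where "I = PiE UNIV Z"
    have I: "finite I" unfolding I_def using Z by (intro finite_PiE) auto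
    have cardI: "card I \<le> N ^ CARD('k)"
    proof -
      have "card I = (\<Prod>j\<in>UNIV. card (Z j))" unfolding I_def by (simp add: card_PiE)
      also have "\<dots> \<le> (\<Prod>j\<in>(UNIV::'k set). N)" using Z by (intro prod_mono) auto
      finally show ?thesis by simp
    qed
    have sub: "A \<subseteq> (\<Union>g\<in>I. tmap -` B g)"
    proof
      fix x assume "x \<in> A"
      then have "\<forall>j. \<exists>z\<in>Z j. norm (Y j x - z) \<le> \<rho> j" using A by blast
      then obtain g where g: "\<And>j. g j \<in> Z j" "\<And>j. norm (Y j x - g j) \<le> \<rho> j" by metis
      have "\<bar>tmap x $ j - rpart j (g j)\<bar> \<le> \<rho> j" for j
        using order_trans[OF abs_rpart_le g(2), of j] by (simp add: tmap_def rpart_diff)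
      then have "x \<in> tmap -` B g" by (simp add: B_def)
      moreover have "g \<in> I" using g by (auto simp: I_def)
      ultimately show "x \<in> (\<Union>g\<in>I. tmap -` B g)" by blast
    qed
    have tm: "tmap -` B g \<in> sets borel" for g
    proof -
      have "tmap \<in> borel_measurable borel"
        using linear_continuous_on[OF linear_linear[THEN iffD2, OF tmap(1)]]
        by (intro borel_measurable_continuous_onI) simp
      from measurable_sets[OF this B[of g]] show ?thesis by simp
    qed
    have "emeasure lborel A \<le> emeasure lborel (\<Union>g\<in>I. tmap -` B g)"
      using sub tm I by (intro emeasure_mono) auto
    also have "\<dots> \<le> (\<Sum>g\<in>I. emeasure lborel (tmap -` B g))"
      using tm I by (intro emeasure_subadditive_finite) auto
    also have "\<dots> = (\<Sum>g\<in>I. ennreal (c * (\<Prod>j\<in>UNIV. 2 * \<rho> j)))"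
    proof (rule sum.cong[OF refl])
      fix g
      have "emeasure lborel (B g) = ennreal (\<Prod>j\<in>UNIV. 2 * \<rho> j)"
        unfolding B_def using \<rho> by (rule emeasure_box_vec)
      then show "emeasure lborel (tmap -` B g) = ennreal (c * (\<Prod>j\<in>UNIV. 2 * \<rho> j))"
        using c by (simp add: scale[OF B] ennreal_mult')
    qed
    also have "\<dots> = ennreal (real (card I) * (c * (\<Prod>j\<in>UNIV. 2 * \<rho> j)))"
      by (simp add: ennreal_mult' ennreal_of_nat_eq_real_of_nat)
    also have "\<dots> \<le> ennreal (C * (\<Prod>j\<in>UNIV. \<rho> j))"
    proof (rule ennreal_leI)
      have "real (card I) * (c * (\<Prod>j\<in>UNIV. 2 * \<rho> j)) \<le> real (N ^ CARD('k)) * (c * (\<Prod>j\<in>UNIV. 2 * \<rho> j))"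
        using cardI c \<rho> by (intro mult_right_mono mult_nonneg_nonneg prod_nonneg) (auto simp del: of_nat_power)
      then show "real (card I) * (c * (\<Prod>j\<in>UNIV. 2 * \<rho> j)) \<le> C * (\<Prod>j\<in>UNIV. \<rho> j)"
        by (simp add: C_def prod.distrib mult_ac)
    qed
    finally have "emeasure lborel A \<le> ennreal (C * (\<Prod>j\<in>UNIV. \<rho> j))" .
    moreover have "0 \<le> C * (\<Prod>j\<in>UNIV. \<rho> j)"
      using c \<rho> by (simp add: C_def prod_nonneg)
    ultimately show ?thesis by (simp add: measure_def enn2real_leI)
  qed
  moreover have "0 \<le> C" using c by (simp add: C_def)
  ultimately show ?thesis by (intro exI[of _ C]) blast
qed

end

section \<open>The oscillatory integral\<close>

lemma pderiv_nonzero: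
  assumes "2 \<le> height n P y"
  shows "pderiv P \<noteq> 0"
proof
  assume p: "pderiv P = 0"
  obtain r where r: "r \<in> {1..n}" "(height n P y / (2 * real n)) ^ r \<le> norm (tc P y r)"
    using height_lower[OF assms] by blast
  obtain s where s: "r = Suc s" using r(1) by (cases r) auto
  have "fact r * tc P y r = 0" unfolding tc_higher_pderiv s by (simp add: funpow_swap1 p)
  then have "tc P y r = 0" by simp
  moreover have "0 < (height n P y / (2 * real n)) ^ r" using assms r(1) by simp
  ultimately show False using r(2) by simp
qed

context conj_frame begin

text \<open>The cutoff is split according to the set \<open>S\<close> of places at which the point
  is near a critical point. A place in \<open>S\<close> earns its factor \<open>\<delta> j\<close>
  by volume, any other place with \<open>2 \<le> H j\<close> by \<open>N\<close> integrations by
  parts, and the places with smaller \<open>H j\<close> cost a constant. Of the exponential only its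
  modulus and its logarithmic derivatives are used.\<close>

lemma oscillatory_integral_bound:
  fixes \<psi> :: "real^'k \<Rightarrow> real"
  assumes smooth: "\<And>m. times_differentiable m \<psi>"
    and C\<psi>: "compact C\<psi>" "{x. \<psi> x \<noteq> 0} \<subseteq> C\<psi>" "C\<psi> \<subseteq> {x. \<forall>j. norm (Y j x) < R}"
    and R: "0 < R" and \<epsilon>: "0 < \<epsilon>" "\<epsilon> < 1" and n: "1 \<le> n"
  shows "\<exists>C\<ge>0. \<forall>P e H. (\<forall>j. degree (P j) \<le> n) \<longrightarrow> (\<forall>x. e differentiable at x) \<longrightarrow>
     (\<forall>i x. D i e x = (2 * of_real pi * \<i> * poly (pderiv (P i)) (Y i x)) * e x) \<longrightarrow> (\<forall>x. norm (e x) = 1) \<longrightarrow>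
     (\<forall>j. 1 \<le> H j \<and> H (\<kappa> j) = H j) \<longrightarrow>
     (\<forall>j x. (\<forall>i. norm (Y i x) \<le> R) \<longrightarrow> H j \<le> height n (P j) (Y j x)) \<longrightarrow>
     norm (LINT x|lborel. e x * of_real (\<psi> x)) \<le> C * (\<Prod>j\<in>UNIV. H j powr - (1 - \<epsilon>))"
proof -
  have supp: "compact C\<psi>" "\<And>x. x \<notin> C\<psi> \<Longrightarrow> \<psi> x = 0" "\<And>j x. x \<in> C\<psi> \<Longrightarrow> norm (Y j x) < R"
    using C\<psi> by auto
  \<comment> \<open>So many steps at one place gain \<open>H powr - (\<epsilon> * N)\<close>, at
    most \<open>1 / H\<close> and thus at most \<open>\<delta>\<close>.\<close>
  define N where "N = nat \<lceil>1 / \<epsilon>\<rceil>"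
  have N: "1 \<le> \<epsilon> * real N"
  proof -
    have "1 / \<epsilon> \<le> real N" unfolding N_def by linarith
    then show ?thesis using \<epsilon> by (simp add: field_simps)
  qed
  define k where "k = CARD('k)"
  \<comment> \<open>\<open>N\<close> steps at up to \<open>k\<close> places, and one derivative left
    over at the end; \<open>bd_cut\<close> then asks for an exponent \<open>M\<close> above
    \<open>m\<close>.\<close>
  define m where "m = N * k + 1"
  define M where "M = m + 1"
  obtain Kc where Kc: "1 \<le> Kc" "\<forall>\<delta> i z. (\<forall>j. 0 < \<delta> j) \<longrightarrow> \<delta> (\<kappa> i) = \<delta> i \<longrightarrow>
     bd \<delta> UNIV m (\<lambda>_. Kc) (\<lambda>x. of_real (cut M (norm ((Y i x - z) / of_real (\<delta> i)))))"
    using bd_cut[of m M] unfolding M_def by auto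
  obtain K\<psi> where K\<psi>: "0 \<le> K\<psi>" "bd (\<lambda>_. 1) UNIV m (\<lambda>_. K\<psi>) (\<lambda>x. of_real (\<psi> x))"
    using bd_smooth[OF smooth supp(1,2)] by blast
  obtain Ki where Ki: "0 \<le> Ki" "\<forall>P \<delta> U H i. degree P \<le> n \<longrightarrow> open U \<longrightarrow> (\<forall>j. 0 < \<delta> j) \<longrightarrow> 2 \<le> H \<longrightarrow> 1 \<le> H * \<delta> i \<longrightarrow>
     (\<forall>x\<in>U. H \<le> height n P (Y i x)) \<longrightarrow>
     (\<forall>x\<in>U. \<forall>z. poly (pderiv P) z = 0 \<longrightarrow> \<delta> i / 2 \<le> norm (Y i x - z)) \<longrightarrow>
     bd \<delta> U m (\<lambda>_. Ki / H) (\<lambda>x. inverse (2 * of_real pi * \<i> * poly (pderiv P) (Y i x))) \<and>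
     (\<forall>x\<in>U. poly (pderiv P) (Y i x) \<noteq> 0)"
    using bd_inverse_pderiv[of n m] by (elim exE conjE) (rule that)
  obtain Cm where Cm: "0 \<le> Cm" "\<forall>Z \<rho>. (\<forall>j. finite (Z j) \<and> card (Z j) \<le> n \<and> 0 \<le> \<rho> j) \<longrightarrow>
     (\<forall>A\<in>sets borel. A \<subseteq> {x. \<forall>j. \<exists>z\<in>Z j. norm (Y j x - z) \<le> \<rho> j} \<longrightarrow>
       measure lborel A \<le> Cm * (\<Prod>j\<in>UNIV. \<rho> j))"
    using near_measure[of n] by (elim exE conjE) (rule that)
  define Kch where "Kch = (2 ^ m * Kc) ^ n"
  define W0 where "W0 = 2 ^ m * K\<psi> * (2 ^ m * (1 + Kch)) ^ k"
  define K3 where "K3 = max 1 (2 ^ m * Ki)"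
  define C1 where "C1 = K3 ^ (N * k) * W0 * (Cm * (2 * (1 + R)) ^ k) * 2 ^ k"
  define C where "C = 2 ^ k * C1"
  have Kch1: "1 \<le> Kch" unfolding Kch_def using Kc(1) mult_mono[of 1 "2 ^ m" 1 Kc] by (intro one_le_power) auto
  have pos: "0 \<le> W0" "1 \<le> K3" "0 \<le> C1"
    using Kch1 K\<psi>(1) Cm(1) R by (auto simp: W0_def K3_def C1_def)
  show ?thesis
  proof (intro exI[of _ C] conjI allI impI)
    show "0 \<le> C" using pos by (simp add: C_def)
    fix P :: "'k \<Rightarrow> complex poly" and e H
    assume P: "\<forall>j. degree (P j) \<le> n" and e_diff: "\<forall>x. e differentiable at x"
      and De: "\<forall>i x. D i e x = (2 * of_real pi * \<i> * poly (pderiv (P i)) (Y i x)) * e x"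
      and e1: "\<forall>x. norm (e x) = 1" and H: "\<forall>j. 1 \<le> H j \<and> H (\<kappa> j) = H j"
      and Hh: "\<forall>j x. (\<forall>i. norm (Y i x) \<le> R) \<longrightarrow> H j \<le> height n (P j) (Y j x)"
    have H1: "1 \<le> H j" for j using H by blast
    \<comment> \<open>Below height 2 the derivative of \<open>P j\<close> may vanish identically, so
      there need not be a finite set of critical points.\<close>
    define J where "J = {j. 2 \<le> H j}"
    define \<delta> where "\<delta> j = H j powr - (1 - \<epsilon>)" for j
    have \<delta>: "0 < \<delta> j" "\<delta> j \<le> 1" "\<delta> (\<kappa> j) = \<delta> j" for j
    proof -
      show "0 < \<delta> j" using H1[of j] by (simp add: \<delta>_def)
      have "H j powr - (1 - \<epsilon>) \<le> H j powr 0" using H1[of j] \<epsilon> by (intro powr_mono) auto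
      then show "\<delta> j \<le> 1" using H1[of j] by (simp add: \<delta>_def)
      show "\<delta> (\<kappa> j) = \<delta> j" using H by (simp add: \<delta>_def)
    qed
    have H\<delta>: "H j * \<delta> j = H j powr \<epsilon>" for j
    proof -
      have "H j * \<delta> j = H j powr 1 * H j powr - (1 - \<epsilon>)" using H1[of j] by (simp add: \<delta>_def)
      also have "\<dots> = H j powr \<epsilon>" by (simp only: powr_add[symmetric]) simp
      finally show ?thesis .
    qed
    have H\<delta>1: "1 \<le> H j * \<delta> j" for j
      unfolding H\<delta> using H1[of j] \<epsilon> by (simp add: ge_one_powr_ge_zero)
    define Z where "Z j = {z. poly (pderiv (P j)) z = 0}" for j
    have Z: "finite (Z j)" "card (Z j) \<le> n" if "j \<in> J" for j
    proof -
      have "Y i 0 = 0" for i using linear_Y[of i] by (simp add: linear_simps)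
      then have "H j \<le> height n (P j) (Y j 0)" using Hh[rule_format, of 0 j] R by simp
      then have "2 \<le> height n (P j) (Y j 0)" using that by (simp add: J_def)
      then have p: "pderiv (P j) \<noteq> 0" by (rule pderiv_nonzero)
      show "finite (Z j)" unfolding Z_def using p by (rule poly_roots_finite)
      have "card (Z j) \<le> degree (pderiv (P j))" unfolding Z_def using p by (rule card_poly_roots_bound)
      also have "\<dots> \<le> n" using P[rule_format, of j] by (simp add: degree_pderiv)
      finally show "card (Z j) \<le> n" .
    qed
    \<comment> \<open>Zero within \<open>\<delta> j\<close> of some critical point, one beyond
      \<open>2 * \<delta> j\<close> from all of them.\<close>
    define ch where "ch j x = (\<Prod>z\<in>Z j. complex_of_real (cut M (norm ((Y j x - z) / of_real (\<delta> j)))))" for j x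
    have bdch: "bd \<delta> UNIV m (\<lambda>_. Kch) (ch j)" if "j \<in> J" for j
    proof (rule bd_weight[OF \<delta>(1)])
      show "bd \<delta> UNIV m (\<lambda>_. (2 ^ m * Kc) ^ card (Z j)) (ch j)"
        unfolding ch_def by (intro bd_prod open_UNIV \<delta> Kc(1) Z that Kc(2)[rule_format])
      show "(2 ^ m * Kc) ^ card (Z j) \<le> Kch"
        unfolding Kch_def using Kc(1) mult_mono[of 1 "2 ^ m" 1 Kc] Z(2)[OF that] by (intro power_increasing) auto
    qed
    define f where "f S j x = (if j \<in> S then 1 + (- 1) * ch j x else ch j x)" for S j x
    have bdf: "bd \<delta> UNIV m (\<lambda>_. 1 + Kch) (f S j)" if "j \<in> J" for S j
    proof (cases "j \<in> S")
      case True
      have "bd \<delta> UNIV m (\<lambda>_. 1 + norm (- 1 :: complex) * Kch) (\<lambda>x. 1 + (- 1) * ch j x)"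
        by (intro bd_add bd_const bd_cmult bdch that \<delta> open_UNIV) auto
      then show ?thesis using True by (simp add: f_def[abs_def])
    next
      case False
      have "bd \<delta> UNIV m (\<lambda>_. 1 + Kch) (ch j)" by (rule bd_weight[OF \<delta>(1) _ bdch[OF that]]) simp
      then show ?thesis using False by (simp add: f_def[abs_def])
    qed
    define G where "G S x = of_real (\<psi> x) * (\<Prod>j\<in>J. f S j x)" for S x
    have fin: "finite J" "finite S" for S :: "'k set" by auto
    have cardk: "card S \<le> k" for S :: "'k set" unfolding k_def by (rule card_mono) auto
    have bdG: "bd \<delta> UNIV m (\<lambda>_. W0) (G S)" for S
    proof (rule bd_weight[OF \<delta>(1)])
      have "bd \<delta> UNIV m (\<lambda>_. K\<psi>) (\<lambda>x. of_real (\<psi> x))"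
        by (rule bd_delta[OF \<delta>(1) _ K\<psi>(2)]) (rule \<delta>)
      then show "bd \<delta> UNIV m (\<lambda>_. 2 ^ m * K\<psi> * (2 ^ m * (1 + Kch)) ^ card J) (G S)"
        unfolding G_def using Kch1 by (intro bd_mult bd_prod open_UNIV \<delta> bdf fin) auto
      have "(2 ^ m * (1 + Kch)) ^ card J \<le> (2 ^ m * (1 + Kch)) ^ k"
        using Kch1 mult_mono[of 1 "2 ^ m" 1 "1 + Kch"] by (intro power_increasing cardk) auto
      then show "2 ^ m * K\<psi> * (2 ^ m * (1 + Kch)) ^ card J \<le> W0"
        unfolding W0_def using K\<psi>(1) by (intro mult_left_mono) auto
    qed
    have sumG: "of_real (\<psi> x) = (\<Sum>S\<in>Pow J. G S x)" for x
    proof -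
      have "(\<Prod>j\<in>J. f S j x) = (\<Prod>j\<in>S. 1 + (- 1) * ch j x) * (\<Prod>j\<in>J - S. ch j x)" if "S \<in> Pow J" for S
      proof -
        have "J \<inter> {j. j \<in> S} = S" "J \<inter> - {j. j \<in> S} = J - S" using that by auto
        then show ?thesis unfolding f_def by (simp only: prod.If_cases[OF fin(1)])
      qed
      then have "(\<Sum>S\<in>Pow J. \<Prod>j\<in>J. f S j x) = (\<Prod>j\<in>J. (1 + (- 1) * ch j x) + ch j x)"
        unfolding prod_add[OF fin(1)] by (rule sum.cong[OF refl])
      also have "\<dots> = 1" by simp
      finally show ?thesis by (simp add: G_def sum_distrib_left[symmetric])
    qed
    have ce: "continuous_on UNIV e"
      using e_diff by (auto simp: continuous_on_eq_continuous_at differentiable_imp_continuous_within)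
    have G0: "G S x = 0" if "x \<notin> C\<psi>" for S x using supp(2)[OF that] by (simp add: G_def)
    have Gint: "integrable lborel (\<lambda>x. e x * G S x)" for S
    proof (rule integrable_compact_support[OF _ supp(1)])
      have "bd \<delta> UNIV (Suc 0) (\<lambda>_. W0) (G S)" by (rule bd_le[OF _ bdG]) (simp add: m_def)
      then have "G S differentiable at x" for x using bd_differentiable by blast
      then have "continuous_on UNIV (G S)"
        by (auto simp: continuous_on_eq_continuous_at differentiable_imp_continuous_within)
      then show "continuous_on UNIV (\<lambda>x. e x * G S x)" by (intro continuous_intros ce)
    qed (simp add: G0)
    have piece: "norm (LINT x|lborel. e x * G S x) \<le> C1 * (\<Prod>j\<in>UNIV. \<delta> j)" if S: "S \<subseteq> J" for S
    proof -
      define F where "F = J - S"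
      \<comment> \<open>The distance \<open>\<delta> j / 2\<close> leaves a margin: the reciprocals
        of the derivatives are controlled on the open set \<open>U\<close>, and the compact set
        \<open>A\<close> containing the support of \<open>G S\<close> lies inside it.\<close>
      define U where "U = {x. (\<forall>j. norm (Y j x) < R) \<and> (\<forall>j\<in>F. \<forall>z\<in>Z j. \<delta> j / 2 < norm (Y j x - z))}"
      define A where "A = {x \<in> C\<psi>. (\<forall>j\<in>F. \<forall>z\<in>Z j. \<delta> j \<le> norm (Y j x - z)) \<and>
          (\<forall>j\<in>S. \<exists>z\<in>Z j. norm (Y j x - z) \<le> 2 * \<delta> j)}"
      have FJ: "F \<subseteq> J" by (auto simp: F_def)
      have cY: "continuous_on B (Y j)" for B j using linear_Y by (rule linear_continuous_on)
      have "open U"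
      proof -
        have "U = (\<Inter>j\<in>UNIV. {x. norm (Y j x) < R}) \<inter> (\<Inter>j\<in>F. \<Inter>z\<in>Z j. {x. \<delta> j / 2 < norm (Y j x - z)})"
          by (auto simp: U_def)
        moreover have "open {x. norm (Y j x) < R}" "open {x. \<delta> j / 2 < norm (Y j x - z)}" for j z
          by (intro open_Collect_less continuous_intros cY)+
        ultimately show ?thesis using Z FJ by (auto intro!: open_Int open_INT)
      qed
      have "compact A"
      proof -
        have "A = C\<psi> \<inter> ((\<Inter>j\<in>F. \<Inter>z\<in>Z j. {x. \<delta> j \<le> norm (Y j x - z)}) \<inter>
            (\<Inter>j\<in>S. \<Union>z\<in>Z j. {x. norm (Y j x - z) \<le> 2 * \<delta> j}))"
          by (auto simp: A_def)
        moreover have "closed {x. \<delta> j \<le> norm (Y j x - z)}" "closed {x. norm (Y j x - z) \<le> 2 * \<delta> j}" for j z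
          by (intro closed_Collect_le continuous_intros cY)+
        ultimately show ?thesis using Z S supp(1)
          by (auto intro!: compact_Int_closed closed_Int closed_INT closed_UN)
      qed
      have AU: "A \<subseteq> U"
      proof
        fix x assume x: "x \<in> A"
        have "\<delta> j / 2 < norm (Y j x - z)" if "j \<in> F" "z \<in> Z j" for j z
        proof -
          have "\<delta> j \<le> norm (Y j x - z)" using x that by (simp add: A_def)
          then show ?thesis using \<delta>(1)[of j] by linarith
        qed
        then show "x \<in> U" using x supp(3) by (simp add: U_def A_def)
      qed
      have cutarg: "norm ((Y j x - z) / of_real (\<delta> j)) = norm (Y j x - z) / \<delta> j" for j x z
        using \<delta>(1)[of j] by (simp add: norm_divide)
      have GA: "G S x = 0" if x: "x \<notin> A" for x
      proof -
        consider "x \<notin> C\<psi>" | j z where "j \<in> F" "z \<in> Z j" "norm (Y j x - z) < \<delta> j"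
          | j where "j \<in> S" "\<And>z. z \<in> Z j \<Longrightarrow> 2 * \<delta> j < norm (Y j x - z)"
          using x by (force simp: A_def not_le)
        then show ?thesis
        proof cases
          case 1
          then show ?thesis by (rule G0)
        next
          case (2 j z)
          have "cut M (norm ((Y j x - z) / of_real (\<delta> j))) = 0"
            unfolding cutarg using 2(3) \<delta>(1)[of j] by (intro cut_eq_0) (auto simp: M_def)
          then have "ch j x = 0"
            unfolding ch_def using 2 FJ Z(1)[of j] by (intro prod_zero) auto
          then have "f S j x = 0" using 2 by (simp add: f_def F_def)
          then have "(\<Prod>j\<in>J. f S j x) = 0" using 2 FJ by (intro prod_zero) auto
          then show ?thesis by (simp add: G_def)
        next
          case (3 j)
          have "cut M (norm ((Y j x - z) / of_real (\<delta> j))) = 1" if "z \<in> Z j" for z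
            unfolding cutarg using 3(2)[OF that] \<delta>(1)[of j] by (intro cut_eq_1) (auto simp: M_def field_simps)
          then have "ch j x = 1" unfolding ch_def by simp
          then have "f S j x = 0" using 3 by (simp add: f_def)
          then have "(\<Prod>j\<in>J. f S j x) = 0" using 3 S by (intro prod_zero) auto
          then show ?thesis by (simp add: G_def)
        qed
      qed
      define cc where "cc i x = 2 * of_real pi * \<i> * poly (pderiv (P i)) (Y i x)" for i x
      have ccd: "cc i differentiable at x" for i x
      proof -
        have "Y i differentiable at x" using Y_derivative by (auto simp: differentiable_def)
        moreover have "((\<lambda>y. 2 * of_real pi * \<i> * poly (pderiv (P i)) y) has_field_derivative
            2 * of_real pi * \<i> * poly (pderiv (pderiv (P i))) (Y i x)) (at (Y i x))"
          by (intro DERIV_cmult poly_DERIV)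
        ultimately show ?thesis unfolding cc_def[abs_def] by (rule D_chain(1))
      qed
      have mm: "bd \<delta> U m (\<lambda>_. Ki / H j) (\<lambda>x. inverse (cc j x))" "\<forall>x\<in>U. poly (pderiv (P j)) (Y j x) \<noteq> 0"
        if j: "j \<in> F" for j
      proof -
        have j2: "2 \<le> H j" using j by (simp add: F_def J_def)
        have hU: "H j \<le> height n (P j) (Y j x)" if "x \<in> U" for x
          using Hh that by (auto simp: U_def less_imp_le)
        have farU: "\<delta> j / 2 \<le> norm (Y j x - z)" if "x \<in> U" "poly (pderiv (P j)) z = 0" for x z
          using j that by (auto simp: U_def Z_def less_imp_le)
        have "bd \<delta> U m (\<lambda>_. Ki / H j) (\<lambda>x. inverse (2 * of_real pi * \<i> * poly (pderiv (P j)) (Y j x))) \<and>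
            (\<forall>x\<in>U. poly (pderiv (P j)) (Y j x) \<noteq> 0)"
          by (rule Ki(2)[THEN spec[of _ "P j"], THEN spec[of _ \<delta>], THEN spec[of _ U], THEN spec[of _ "H j"],
                THEN spec[of _ j], rule_format]) (use P \<open>open U\<close> \<delta>(1) j2 H\<delta>1 hU farU in auto)
        then show "bd \<delta> U m (\<lambda>_. Ki / H j) (\<lambda>x. inverse (cc j x))" "\<forall>x\<in>U. poly (pderiv (P j)) (Y j x) \<noteq> 0"
          unfolding cc_def by blast+
      qed
      obtain xs where xs: "set xs = F" "distinct xs" using finite_distinct_list[OF fin(2)] by blast
      define js where "js = concat (map (\<lambda>j. replicate N j) xs)"
      have js: "set js \<subseteq> F" using xs by (auto simp: js_def)
      have "length js = N * length xs" by (simp add: js_def length_concat o_def sum_list_triv)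
      also have "\<dots> \<le> N * k" using cardk[of F] xs distinct_card[OF xs(2)] by simp
      finally have len: "Suc (length js) \<le> m" by (simp add: m_def)
      have pl: "(\<Prod>j\<leftarrow>js. g j) = (\<Prod>j\<in>F. g j ^ N)" for g :: "'k \<Rightarrow> real"
      proof -
        have "(\<Prod>j\<leftarrow>concat (map (\<lambda>j. replicate N j) ys). g j) = (\<Prod>j\<leftarrow>ys. g j ^ N)" for ys
          by (induction ys) (simp_all add: map_replicate prod_list_replicate)
        also have "(\<Prod>j\<leftarrow>xs. g j ^ N) = (\<Prod>j\<in>F. g j ^ N)"
          using prod.distinct_set_conv_list[OF xs(2), of "\<lambda>j. g j ^ N"] xs(1) by simp
        finally show ?thesis by (simp add: js_def)
      qed
      have "norm (LINT x|lborel. e x * G S x) \<le> (\<Prod>j\<leftarrow>js. 2 ^ m * (Ki / H j) / \<delta> j) * W0 * measure lborel A"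
      proof (rule ibp_iterate[where c = cc and U = U and F = F and mm = "\<lambda>j x. inverse (cc j x)"])
        show "cc j x * inverse (cc j x) = 1" if "j \<in> F" "x \<in> U" for j x
          by (rule right_inverse) (use mm(2)[OF that(1)] that(2) in \<open>simp add: cc_def\<close>)
        show "0 \<le> Ki / H j" for j using Ki(1) H1[of j] by simp
        show "bd \<delta> U (Suc (length js)) (\<lambda>_. W0) (G S)"
          by (rule bd_subset[OF subset_UNIV bd_le[OF len bdG]])
        show "D i e x = cc i x * e x" for i x using De by (simp add: cc_def)
      qed (use \<open>open U\<close> \<delta> \<open>compact A\<close> AU e_diff ccd e1 mm GA js len pos in auto)
      also have "\<dots> \<le> (K3 ^ (N * k) * (\<Prod>j\<in>F. \<delta> j)) * W0 * (Cm * (2 * (1 + R)) ^ k * (\<Prod>j\<in>S. \<delta> j))"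
      proof (intro mult_mono)
        have "(\<Prod>j\<leftarrow>js. 2 ^ m * (Ki / H j) / \<delta> j) \<le> (\<Prod>j\<in>F. K3 ^ N * \<delta> j)"
          unfolding pl
        proof (rule prod_mono, intro conjI)
          fix j assume "j \<in> F"
          show "0 \<le> (2 ^ m * (Ki / H j) / \<delta> j) ^ N" using Ki(1) H1[of j] \<delta>(1)[of j] by simp
          \<comment> \<open>By \<open>H j * \<delta> j = H j powr \<epsilon>\<close> each step gains
            a power \<open>\<epsilon>\<close> of the height.\<close>
          have "2 ^ m * (Ki / H j) / \<delta> j = 2 ^ m * Ki / (H j powr \<epsilon>)"
            using H1[of j] \<delta>(1)[of j] by (simp add: H\<delta>[symmetric])
          also have "\<dots> \<le> K3 / (H j powr \<epsilon>)" by (intro divide_right_mono) (auto simp: K3_def)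
          finally have "(2 ^ m * (Ki / H j) / \<delta> j) ^ N \<le> (K3 / (H j powr \<epsilon>)) ^ N"
            using Ki(1) H1[of j] \<delta>(1)[of j] by (intro power_mono) auto
          also have "\<dots> = K3 ^ N * H j powr - (\<epsilon> * real N)"
            using H1[of j] by (simp add: power_divide powr_minus_divide powr_powr[symmetric] powr_realpow)
          also have "\<dots> \<le> K3 ^ N * \<delta> j"
            unfolding \<delta>_def using H1[of j] N \<epsilon> pos by (intro mult_left_mono powr_mono) auto
          finally show "(2 ^ m * (Ki / H j) / \<delta> j) ^ N \<le> K3 ^ N * \<delta> j" .
        qed
        also have "\<dots> = (K3 ^ N) ^ card F * (\<Prod>j\<in>F. \<delta> j)" by (simp add: prod.distrib)
        also have "\<dots> \<le> K3 ^ (N * k) * (\<Prod>j\<in>F. \<delta> j)"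
          using pos cardk[of F] \<delta>(1) unfolding power_mult[symmetric]
          by (intro mult_right_mono power_increasing prod_nonneg) (auto intro: less_imp_le)
        finally show "(\<Prod>j\<leftarrow>js. 2 ^ m * (Ki / H j) / \<delta> j) \<le> K3 ^ (N * k) * (\<Prod>j\<in>F. \<delta> j)" .
        \<comment> \<open>Places outside \<open>S\<close> are restricted by the support only: centre
          0 and radius \<open>R\<close>, so that \<open>near_measure\<close> treats all coordinates
          at once.\<close>
        define Z' where "Z' j = (if j \<in> S then Z j else {0})" for j
        define \<rho> where "\<rho> j = (if j \<in> S then 2 * \<delta> j else R)" for j
        have "measure lborel A \<le> Cm * (\<Prod>j\<in>UNIV. \<rho> j)"
        proof (rule Cm(2)[rule_format, of Z' \<rho>])
          show "finite (Z' j) \<and> card (Z' j) \<le> n \<and> 0 \<le> \<rho> j" for j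
            using Z[of j] S n R \<delta>(1)[of j] by (auto simp: Z'_def \<rho>_def)
          show "A \<in> sets borel" using \<open>compact A\<close> by (simp add: compact_imp_closed)
          show "A \<subseteq> {x. \<forall>j. \<exists>z\<in>Z' j. norm (Y j x - z) \<le> \<rho> j}"
            using supp(3) by (auto simp: A_def Z'_def \<rho>_def less_imp_le)
        qed
        also have "(\<Prod>j\<in>UNIV. \<rho> j) \<le> (2 * (1 + R)) ^ k * (\<Prod>j\<in>S. \<delta> j)"
        proof -
          have "(\<Prod>j\<in>UNIV. \<rho> j) \<le> (\<Prod>j\<in>UNIV. (2 * (1 + R)) * (if j \<in> S then \<delta> j else 1))"
            using R \<delta>(1) by (intro prod_mono) (auto simp: \<rho>_def less_imp_le)
          also have "\<dots> = (2 * (1 + R)) ^ k * (\<Prod>j\<in>UNIV. if j \<in> S then \<delta> j else 1)"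
            by (simp add: prod.distrib k_def)
          also have "(\<Prod>j\<in>UNIV. if j \<in> S then \<delta> j else 1) = (\<Prod>j\<in>S. \<delta> j)"
            by (simp add: prod.If_cases)
          finally show ?thesis .
        qed
        finally show "measure lborel A \<le> Cm * (2 * (1 + R)) ^ k * (\<Prod>j\<in>S. \<delta> j)"
          using Cm(1) by (simp add: mult.assoc mult_left_mono)
      qed (use pos less_imp_le[OF \<delta>(1)] in \<open>auto intro!: mult_nonneg_nonneg prod_nonneg\<close>)
      also have "\<dots> = K3 ^ (N * k) * W0 * (Cm * (2 * (1 + R)) ^ k) * ((\<Prod>j\<in>F. \<delta> j) * (\<Prod>j\<in>S. \<delta> j))"
        by simp
      also have "(\<Prod>j\<in>F. \<delta> j) * (\<Prod>j\<in>S. \<delta> j) = (\<Prod>j\<in>J. \<delta> j)"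
        unfolding F_def using prod.subset_diff[OF S fin(1), of \<delta>] by simp
      also have "K3 ^ (N * k) * W0 * (Cm * (2 * (1 + R)) ^ k) * (\<Prod>j\<in>J. \<delta> j)
          \<le> K3 ^ (N * k) * W0 * (Cm * (2 * (1 + R)) ^ k) * (2 ^ k * (\<Prod>j\<in>UNIV. \<delta> j))"
      proof (rule mult_left_mono)
        \<comment> \<open>For the small heights \<open>\<delta> j\<close> is at least 1/2, so the
          missing factors can be inserted at the cost of 2 each.\<close>
        have half: "1 \<le> 2 * \<delta> j" if "j \<notin> J" for j
        proof -
          have "H j powr (1 - \<epsilon>) \<le> H j powr 1" using H1[of j] \<epsilon> by (intro powr_mono) auto
          also have "\<dots> \<le> 2" using that H1[of j] by (simp add: J_def)
          finally show ?thesis using H1[of j] unfolding \<delta>_def powr_minus_divide by (simp add: field_simps)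
        qed
        have "(\<Prod>j\<in>J. \<delta> j) = (\<Prod>j\<in>UNIV. if j \<in> J then \<delta> j else 1)" by (simp add: prod.If_cases)
        also have "\<dots> \<le> (\<Prod>j\<in>UNIV. 2 * \<delta> j)"
          using half \<delta>(1) by (intro prod_mono) (auto simp: less_imp_le)
        also have "\<dots> = 2 ^ k * (\<Prod>j\<in>UNIV. \<delta> j)" by (simp add: prod.distrib k_def)
        finally show "(\<Prod>j\<in>J. \<delta> j) \<le> 2 ^ k * (\<Prod>j\<in>UNIV. \<delta> j)" .
        show "0 \<le> K3 ^ (N * k) * W0 * (Cm * (2 * (1 + R)) ^ k)" using pos Cm(1) R by simp
      qed
      also have "\<dots> = C1 * (\<Prod>j\<in>UNIV. \<delta> j)" by (simp add: C1_def)
      finally show ?thesis .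
    qed
    have "(LINT x|lborel. e x * of_real (\<psi> x)) = (LINT x|lborel. (\<Sum>S\<in>Pow J. e x * G S x))"
      by (simp add: sumG sum_distrib_left)
    also have "\<dots> = (\<Sum>S\<in>Pow J. (LINT x|lborel. e x * G S x))"
      using Gint by (intro Bochner_Integration.integral_sum)
    finally have "norm (LINT x|lborel. e x * of_real (\<psi> x)) \<le> (\<Sum>S\<in>Pow J. norm (LINT x|lborel. e x * G S x))"
      by (simp add: norm_sum)
    also have "\<dots> \<le> (\<Sum>S\<in>Pow J. C1 * (\<Prod>j\<in>UNIV. \<delta> j))"
      using piece by (intro sum_mono) auto
    also have "\<dots> = 2 ^ card J * (C1 * (\<Prod>j\<in>UNIV. \<delta> j))" by (simp add: card_Pow)
    also have "\<dots> \<le> 2 ^ k * (C1 * (\<Prod>j\<in>UNIV. \<delta> j))"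
      using pos cardk[of J] \<delta>(1)
      by (intro mult_right_mono power_increasing mult_nonneg_nonneg prod_nonneg) (auto simp: less_imp_le)
    finally show "norm (LINT x|lborel. e x * of_real (\<psi> x)) \<le> C * (\<Prod>j\<in>UNIV. H j powr - (1 - \<epsilon>))"
      by (simp add: C_def \<delta>_def mult.assoc)
  qed
qed

end

section \<open>Integrals of heights\<close>

lemma continuous_on_height:
  assumes "continuous_on A y" "\<And>s. s \<le> n \<Longrightarrow> continuous_on A (\<lambda>x. coeff (P x) s)" "\<And>x. degree (P x) \<le> n"
  shows "continuous_on A (\<lambda>x. height n (P x) (y x))"
proof -
  have "continuous_on A (\<lambda>x. norm (tc (P x) (y x) r) powr (1 / real r))" if "r \<in> {1..n}" for r
  proof (rule continuous_on_powr')
    show "continuous_on A (\<lambda>x. norm (tc (P x) (y x) r))"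
      unfolding tc_sum[OF assms(3)] by (intro continuous_intros assms) auto
  qed (use that in \<open>auto intro: continuous_intros\<close>)
  then show ?thesis unfolding height_def
    by (intro continuous_on_add continuous_on_const continuous_on_sum) auto
qed

text \<open>From \<open>1 + u ^ r \<le> (1 + u) ^ r\<close>, with \<open>u\<close> the summand of
  order \<open>r\<close> of the height. Decay in the coefficient of order \<open>r\<close> is paid
  for with \<open>r\<close> times as much decay in the height, which produces the sum
  \<open>1 + ... + n\<close>.\<close>

lemma height_powr_le:
  assumes i: "r \<in> {1..n}" and s: "0 < s"
  shows "height n P y powr - (s * real r) \<le> (1 + norm (tc P y r)) powr - s"
proof -
  define u where "u = norm (tc P y r) powr (1 / real r)"
  have u: "0 \<le> u" by (simp add: u_def)
  have ur: "u ^ r = norm (tc P y r)"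
    using i by (cases "tc P y r = 0") (auto simp: u_def powr_realpow[symmetric] powr_powr zero_power)
  have "u \<le> (\<Sum>r=1..n. norm (tc P y r) powr (1 / real r))"
    unfolding u_def using i by (intro member_le_sum) auto
  then have "1 + u \<le> height n P y" by (simp add: height_def)
  moreover have "1 + u ^ r \<le> (1 + u) ^ r"
  proof -
    obtain m where "r = Suc m" using i by (cases r) auto
    moreover have "1 + u ^ Suc m \<le> (1 + u) ^ Suc m" for m
    proof (induction m)
      case (Suc m)
      have "1 + u ^ Suc (Suc m) \<le> (1 + u) * (1 + u ^ Suc m)" using u by (simp add: algebra_simps)
      also have "\<dots> \<le> (1 + u) * (1 + u) ^ Suc m" using Suc u by (intro mult_left_mono) auto
      finally show ?case by simp
    qed simp
    ultimately show ?thesis by simp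
  qed
  moreover have "(1 + u) ^ r \<le> height n P y ^ r" using calculation(1) u by (intro power_mono) auto
  ultimately have le: "1 + norm (tc P y r) \<le> height n P y ^ r" by (simp add: ur)
  have "height n P y powr - (s * real r) = (height n P y ^ r) powr - s"
    using height_ge_1[of n P y] by (simp add: powr_realpow[symmetric] powr_powr mult.commute)
  also have "\<dots> \<le> (1 + norm (tc P y r)) powr - s"
    using le s by (intro powr_mono2') (auto simp: add_pos_nonneg)
  finally show ?thesis .
qed

context conj_frame begin

definition polybox :: "real \<Rightarrow> (real^'k) set" where
  "polybox R = {x. \<forall>j. norm (Y j x) \<le> R}"

lemma continuous_on_Y: "continuous_on A (Y j)"
  using linear_Y by (rule linear_continuous_on)

lemma compact_polybox: "compact (polybox R)"
proof -
  have "polybox R = (\<Inter>j. {x. norm (Y j x) \<le> R})" by (auto simp: polybox_def)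
  moreover have "closed {x. norm (Y j x) \<le> R}" for j
    by (intro closed_Collect_le continuous_intros continuous_on_Y)
  ultimately have "closed (polybox R)" by auto
  obtain C where C: "0 < C" "\<And>x. norm x \<le> C * (\<Sum>j\<in>UNIV. norm (Y j x))" using norm_le_Y by blast
  have "norm x \<le> C * (\<Sum>j\<in>(UNIV::'k set). R)" if "x \<in> polybox R" for x
  proof -
    have "(\<Sum>j\<in>UNIV. norm (Y j x)) \<le> (\<Sum>j\<in>(UNIV::'k set). R)"
      using that by (intro sum_mono) (auto simp: polybox_def)
    then show ?thesis using C(2)[of x] C(1) by (meson mult_left_mono less_imp_le order_trans)
  qed
  then have "bounded (polybox R)" unfolding bounded_iff by blast
  with \<open>closed (polybox R)\<close> show ?thesis by (simp add: compact_eq_bounded_closed)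
qed

lemma Y_diff: "Y j (x - y) = Y j x - Y j y"
  using linear_Y[of j] by (simp add: linear_simps)

lemma Y_zero: "Y j 0 = 0"
  using linear_Y[of j] by (simp add: linear_simps)

section \<open>Minimal heights and their comparison with integrals\<close>

text \<open>The heights at different places are minimised independently; the minimiser at the place
  \<open>j\<close> only matters through its coordinate \<open>Y j\<close>.\<close>

lemma common_minimizer:
  assumes P: "\<And>j. degree (P j) \<le> n" and R: "0 < R"
    and sym: "\<And>j x. height n (P (\<kappa> j)) (Y (\<kappa> j) x) = height n (P j) (Y j x)"
  shows "\<exists>x0\<in>polybox R. \<forall>j. \<forall>x\<in>polybox R. height n (P j) (Y j x0) \<le> height n (P j) (Y j x)"
proof -
  define h where "h j = (\<lambda>x. height n (P j) (Y j x))" for j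
  \<comment> \<open>The minimiser is a function of the height function alone. Conjugate places have
    equal height functions, hence the same minimiser, and so the chosen coordinates respect
    conjugation.\<close>
  define X where "X g = (SOME x. x \<in> polybox R \<and> (\<forall>x'\<in>polybox R. g x \<le> g x'))" for g :: "real^'k \<Rightarrow> real"
  have ne: "polybox R \<noteq> {}"
  proof -
    have "0 \<in> polybox R" using R by (simp add: polybox_def Y_zero)
    then show ?thesis by blast
  qed
  have X: "X (h j) \<in> polybox R \<and> (\<forall>x'\<in>polybox R. h j (X (h j)) \<le> h j x')" for j
  proof -
    have "continuous_on (polybox R) (h j)"
      unfolding h_def by (intro continuous_on_height continuous_on_Y continuous_intros P)
    then have "\<exists>x. x \<in> polybox R \<and> (\<forall>x'\<in>polybox R. h j x \<le> h j x')"
      using continuous_attains_inf[OF compact_polybox ne] by blast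
    then show ?thesis unfolding X_def by (rule someI_ex)
  qed
  have "h (\<kappa> j) = h j" for j by (simp add: h_def sym)
  then have "Y (\<kappa> j) (X (h (\<kappa> j))) = cnj (Y j (X (h j)))" for j by (simp add: Y_cnj)
  then obtain x0 where x0: "\<And>j. Y j x0 = Y j (X (h j))"
    using Y_surj[of "\<lambda>j. Y j (X (h j))"] by blast
  have "x0 \<in> polybox R" using X by (simp add: polybox_def x0)
  moreover have "height n (P j) (Y j x0) \<le> height n (P j) (Y j x)" if "x \<in> polybox R" for j x
    using X[of j] that by (simp add: h_def x0)
  ultimately show ?thesis by blast
qed

text \<open>The preimage of a box with sides \<open>1 / h j x0\<close> about \<open>x0\<close> has
  volume of order the product of these sides, and on it the heights are at most \<open>A\<close>
  times those at \<open>x0\<close>. The volume accounts for \<open>s + 1\<close> against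
  \<open>s\<close>. As heights are at least 1, it stays inside
  \<open>polybox (R + 1)\<close>.\<close>

lemma height_integral_lower:
  assumes s: "0 < s"
  shows "\<exists>C\<ge>0. \<forall>P. (\<forall>j. degree (P j) \<le> n) \<longrightarrow> (\<forall>j x. height n (P (\<kappa> j)) (Y (\<kappa> j) x) = height n (P j) (Y j x)) \<longrightarrow>
    (\<forall>x0\<in>polybox R. ennreal (\<Prod>j\<in>UNIV. height n (P j) (Y j x0) powr - (s + 1))
      \<le> ennreal C * (\<integral>\<^sup>+x. ennreal (\<Prod>j\<in>UNIV. height n (P j) (Y j x) powr - s) * indicator (polybox (R + 1)) x \<partial>lborel))"
proof -
  obtain c where c: "0 < c" and scale: "\<And>A. A \<in> sets borel \<Longrightarrow> emeasure lborel (tmap -` A) = ennreal c * emeasure lborel A"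
    using lborel_linear_scaling(1,2)[OF tmap] by blast
  define A where "A = 1 + real n * ((real n + 1) * 2 ^ n)"
  have A: "1 \<le> A" by (simp add: A_def)
  define k where "k = CARD('k)"
  define C where "C = (A powr s) ^ k / c"
  have C0: "0 \<le> C" using c by (simp add: C_def)
  have main: "ennreal (\<Prod>j\<in>UNIV. height n (P j) (Y j x0) powr - (s + 1))
      \<le> ennreal C * (\<integral>\<^sup>+x. ennreal (\<Prod>j\<in>UNIV. height n (P j) (Y j x) powr - s) * indicator (polybox (R + 1)) x \<partial>lborel)"
    if P: "\<And>j. degree (P j) \<le> n" and sym: "\<And>j x. height n (P (\<kappa> j)) (Y (\<kappa> j) x) = height n (P j) (Y j x)"
      and x0: "x0 \<in> polybox R" for P x0
  proof -
    define h where "h j x = height n (P j) (Y j x)" for j x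
    have h1: "1 \<le> h j x" for j x unfolding h_def by (rule height_ge_1)
    \<comment> \<open>Half of \<open>1 / h j x0\<close>, since \<open>norm (Y j (x - x0))\<close> is
      bounded by the sum of two real coordinates, at \<open>j\<close> and at
      \<open>\<kappa> j\<close>.\<close>
    define B where "B = {t :: real^'k. \<forall>j. \<bar>t $ j - tmap x0 $ j\<bar> \<le> 1 / (2 * h j x0)}"
    have "closed B" unfolding B_def
      by (intro closed_Collect_all closed_Collect_le continuous_intros)
    then have B: "B \<in> sets borel" by simp
    have r0: "0 \<le> 1 / (2 * h j x0)" for j using h1[of j x0] by simp
    have eB: "emeasure lborel (tmap -` B) = ennreal (c * (\<Prod>j\<in>UNIV. 1 / h j x0))"
    proof -
      have "emeasure lborel B = ennreal (\<Prod>j\<in>UNIV. 2 * (1 / (2 * h j x0)))"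
        unfolding B_def using r0 by (rule emeasure_box_vec)
      then show ?thesis using c by (simp add: scale[OF B] ennreal_mult')
    qed
    have tB: "tmap -` B \<in> sets borel"
    proof -
      have "tmap \<in> borel_measurable borel"
        using linear_continuous_on[OF linear_linear[THEN iffD2, OF tmap(1)]]
        by (intro borel_measurable_continuous_onI) simp
      from measurable_sets[OF this B] show ?thesis by simp
    qed
    have near: "norm (Y j (x - x0)) \<le> 1 / h j x0" if x: "x \<in> tmap -` B" for j x
    proof -
      have t: "\<bar>rpart i (Y i (x - x0))\<bar> \<le> 1 / (2 * h i x0)" for i
        using x by (simp add: B_def tmap_def Y_diff rpart_diff)
      have "norm (Y j (x - x0)) \<le> \<bar>rpart j (Y j (x - x0))\<bar> + \<bar>rpart (\<kappa> j) (Y (\<kappa> j) (x - x0))\<bar>"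
        by (rule norm_le_rpart[of "\<lambda>j. Y j (x - x0)"]) (rule Y_cnj)
      also have "\<dots> \<le> 1 / (2 * h j x0) + 1 / (2 * h (\<kappa> j) x0)" by (intro add_mono t)
      also have "h (\<kappa> j) x0 = h j x0" by (simp add: h_def sym)
      finally show ?thesis by simp
    qed
    have in_box: "x \<in> polybox (R + 1)" if x: "x \<in> tmap -` B" for x
    proof -
      have "norm (Y j x) \<le> R + 1" for j
      proof -
        have "norm (Y j x) \<le> norm (Y j x0) + norm (Y j (x - x0))"
          using norm_triangle_ineq[of "Y j x0" "Y j (x - x0)"] by (simp add: Y_diff)
        also have "\<dots> \<le> R + 1"
        proof (rule add_mono)
          show "norm (Y j x0) \<le> R" using x0 by (simp add: polybox_def)
          have "1 / h j x0 \<le> 1" using h1[of j x0] by simp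
          then show "norm (Y j (x - x0)) \<le> 1" using near[OF x, of j] by linarith
        qed
        finally show ?thesis .
      qed
      then show ?thesis by (simp add: polybox_def)
    qed
    have slow: "(A * h j x0) powr - s \<le> h j x powr - s" if x: "x \<in> tmap -` B" for j x
    proof -
      have "height n (P j) (Y j x0 + Y j (x - x0)) \<le> A * height n (P j) (Y j x0)"
        unfolding A_def using near[OF x, of j] by (intro height_slowly_varying P) (simp add: h_def)
      then have "h j x \<le> A * h j x0" by (simp add: h_def Y_diff)
      then show ?thesis using h1[of j x] s by (intro powr_mono2') auto
    qed
    have Ah: "(A * h j x0) powr - s = (A powr s) powr - 1 * h j x0 powr - s" for j
    proof -
      have "(A powr s) powr - 1 = A powr - s" by (simp only: powr_powr) simp
      then show ?thesis using A h1[of j x0] by (simp only: powr_mult)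
    qed
    have "ennreal (\<Prod>j\<in>UNIV. h j x0 powr - (s + 1))
        = ennreal C * (ennreal (\<Prod>j\<in>UNIV. (A * h j x0) powr - s) * ennreal (c * (\<Prod>j\<in>UNIV. 1 / h j x0)))"
    proof -
      have "(\<Prod>j\<in>UNIV. h j x0 powr - (s + 1)) = (\<Prod>j\<in>UNIV. h j x0 powr - s * (1 / h j x0))"
      proof (rule prod.cong[OF refl])
        fix j
        have "- (s + 1) = - s + - 1" by simp
        then have "h j x0 powr - (s + 1) = h j x0 powr - s * h j x0 powr - 1" by (simp only: powr_add)
        moreover have "h j x0 powr - 1 = 1 / h j x0"
          using h1[of j x0] by (simp add: powr_minus_divide)
        ultimately show "h j x0 powr - (s + 1) = h j x0 powr - s * (1 / h j x0)" by simp
      qed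
      also have "\<dots> = C * ((\<Prod>j\<in>UNIV. (A * h j x0) powr - s) * (c * (\<Prod>j\<in>UNIV. 1 / h j x0)))"
      proof -
        define a where "a = A powr s"
        define u where "u = (\<Prod>j\<in>UNIV. h j x0 powr - s)"
        define v where "v = (\<Prod>j\<in>UNIV. 1 / h j x0)"
        have "0 < a" using A by (simp add: a_def)
        then have one: "a ^ k * (a powr - 1) ^ k = 1"
          by (simp add: powr_minus_divide power_one_over)
        have "(\<Prod>j\<in>UNIV. (A * h j x0) powr - s) = (a powr - 1) ^ k * u"
          unfolding Ah a_def[symmetric] u_def by (simp only: prod.distrib prod_constant k_def)
        moreover have "C = a ^ k / c" by (simp add: C_def a_def)
        moreover have "(\<Prod>j\<in>UNIV. h j x0 powr - s * (1 / h j x0)) = u * v"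
          unfolding u_def v_def by (rule prod.distrib)
        moreover have "a ^ k / c * ((a powr - 1) ^ k * u * (c * v)) = (a ^ k * (a powr - 1) ^ k) * (u * v)"
          using c by (simp only: times_divide_eq_left) (simp add: mult_ac)
        ultimately show ?thesis by (simp only: one v_def[symmetric] mult_1)
      qed
      finally show ?thesis
        using c h1 C0 by (simp add: ennreal_mult[symmetric] prod_nonneg order_trans[OF zero_le_one])
    qed
    also have "ennreal (\<Prod>j\<in>UNIV. (A * h j x0) powr - s) * ennreal (c * (\<Prod>j\<in>UNIV. 1 / h j x0))
        = (\<integral>\<^sup>+x. ennreal (\<Prod>j\<in>UNIV. (A * h j x0) powr - s) * indicator (tmap -` B) x \<partial>lborel)"
      using tB by (simp add: nn_integral_cmult_indicator eB)
    also have "\<dots> \<le> (\<integral>\<^sup>+x. ennreal (\<Prod>j\<in>UNIV. h j x powr - s) * indicator (polybox (R + 1)) x \<partial>lborel)"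
    proof (rule nn_integral_mono)
      fix x
      show "ennreal (\<Prod>j\<in>UNIV. (A * h j x0) powr - s) * indicator (tmap -` B) x
          \<le> ennreal (\<Prod>j\<in>UNIV. h j x powr - s) * indicator (polybox (R + 1)) x"
      proof (cases "x \<in> tmap -` B")
        case True
        have "(\<Prod>j\<in>UNIV. (A * h j x0) powr - s) \<le> (\<Prod>j\<in>UNIV. h j x powr - s)"
          using slow[OF True] by (intro prod_mono) auto
        then show ?thesis using True in_box[OF True] by (simp add: ennreal_leI)
      qed simp
    qed
    finally show ?thesis unfolding h_def by (simp add: mult_left_mono)
  qed
  show ?thesis
    by (intro exI[of _ C] conjI C0 allI impI ballI main) auto
qed

end

section \<open>Frequencies and the Taylor coefficients of the phase\<close>

locale conj_frame_phase = conj_frame S T \<kappa> for S T :: "'k::finite \<Rightarrow> 'k \<Rightarrow> complex" and \<kappa> +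
  fixes deg :: "'n::finite \<Rightarrow> nat" and n :: nat
  assumes deg: "bij_betw deg UNIV {1..n}"
begin

text \<open>The frequency in the basis dual to \<open>Y\<close>: the coefficient of
  \<open>Y j ^ deg i\<close> in the phase, as \<open>phase_eq\<close> shows.\<close>

definition alpha :: "real^'k^'n \<Rightarrow> 'n \<Rightarrow> 'k \<Rightarrow> complex" where
  "alpha \<xi> i j = (\<Sum>m\<in>UNIV. of_real (\<xi> $ i $ m) * T m j)"

definition Pol :: "real^'k^'n \<Rightarrow> 'k \<Rightarrow> complex poly" where
  "Pol \<xi> j = (\<Sum>i\<in>UNIV. monom (alpha \<xi> i j) (deg i))"

lemma deg_range: "deg i \<in> {1..n}"
  using deg by (auto simp: bij_betw_def)

lemma degree_Pol: "degree (Pol \<xi> j) \<le> n"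
  unfolding Pol_def using deg_range by (intro degree_sum_le) (auto intro: order_trans[OF degree_monom_le])

lemma coeff_Pol: "coeff (Pol \<xi> j) s = (\<Sum>i\<in>UNIV. if deg i = s then alpha \<xi> i j else 0)"
  by (simp add: Pol_def coeff_sum)

lemma coeff_Pol_deg: "coeff (Pol \<xi> j) (deg i) = alpha \<xi> i j"
proof -
  have "deg i' = deg i \<longleftrightarrow> i' = i" for i' using deg by (auto simp: bij_betw_def inj_def)
  then show ?thesis by (simp add: coeff_Pol)
qed

lemma alpha_kappa: "alpha \<xi> i (\<kappa> j) = cnj (alpha \<xi> i j)"
  by (simp add: alpha_def T_cnj cnj_sum)

lemma alpha_inverse: "(\<Sum>j\<in>UNIV. alpha \<xi> i j * S j m) = of_real (\<xi> $ i $ m)"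
proof -
  have "(\<Sum>j\<in>UNIV. alpha \<xi> i j * S j m) = (\<Sum>l\<in>UNIV. of_real (\<xi> $ i $ l) * (\<Sum>j\<in>UNIV. T l j * S j m))"
    unfolding alpha_def sum_distrib_left sum_distrib_right by (subst sum.swap) (simp add: mult_ac)
  then show ?thesis by (simp add: TS if_distrib[of "\<lambda>c. _ * c"] cong: if_cong)
qed

lemma tc_kappa: "tc (Pol \<xi> (\<kappa> j)) (Y (\<kappa> j) x) r = cnj (tc (Pol \<xi> j) (Y j x) r)"
proof -
  have "coeff (Pol \<xi> (\<kappa> j)) s = cnj (coeff (Pol \<xi> j) s)" for s
    unfolding coeff_Pol cnj_sum by (intro sum.cong refl) (simp add: alpha_kappa)
  then show ?thesis by (simp add: tc_sum[OF degree_Pol] Y_cnj cnj_sum)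
qed

lemma height_kappa: "height n (Pol \<xi> (\<kappa> j)) (Y (\<kappa> j) x) = height n (Pol \<xi> j) (Y j x)"
  by (simp add: height_def tc_kappa)

definition Theta :: "real^'k \<Rightarrow> real^'k^'n \<Rightarrow> real^'k^'n" where
  "Theta x \<xi> = (\<chi> i j. rpart j (tc (Pol \<xi> j) (Y j x) (deg i)))"

lemma alpha_linear: "alpha (\<xi> + \<eta>) i j = alpha \<xi> i j + alpha \<eta> i j"
  "alpha (c *\<^sub>R \<xi>) i j = of_real c * alpha \<xi> i j"
  by (simp_all add: alpha_def distrib_right distrib_left sum.distrib sum_distrib_left mult_ac)

lemma coeff_Pol_linear: "coeff (Pol (\<xi> + \<eta>) j) s = coeff (Pol \<xi> j) s + coeff (Pol \<eta> j) s"
  "coeff (Pol (c *\<^sub>R \<xi>) j) s = of_real c * coeff (Pol \<xi> j) s"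
  unfolding coeff_Pol by (simp_all add: alpha_linear sum.distrib[symmetric] sum_distrib_left if_distrib[of "\<lambda>a. _ * a"] cong: if_cong)
     (auto intro: sum.cong)

lemma linear_Theta: "linear (Theta x)"
proof (rule linearI)
  show "Theta x (\<xi> + \<eta>) = Theta x \<xi> + Theta x \<eta>" for \<xi> \<eta>
    by (simp add: Theta_def vec_eq_iff tc_sum[OF degree_Pol] coeff_Pol_linear distrib_right sum.distrib rpart_def)
  have "tc (Pol (c *\<^sub>R \<xi>) j) (Y j x) r = of_real c * tc (Pol \<xi> j) (Y j x) r" for c \<xi> j r
    by (simp add: tc_sum[OF degree_Pol] coeff_Pol_linear sum_distrib_left mult_ac)
  then show "Theta x (c *\<^sub>R \<xi>) = c *\<^sub>R Theta x \<xi>" for c \<xi>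
    by (simp add: Theta_def vec_eq_iff rpart_def)
qed

text \<open>By conjugation symmetry the real parts kept by \<open>rpart\<close> determine the Taylor
  coefficients. If those of positive order vanish at \<open>Y j x\<close>, they vanish at 0, where
  they are the numbers \<open>alpha\<close>, and these determine \<open>\<xi>\<close>.\<close>

lemma inj_Theta: "inj (Theta x)"
proof -
  have "\<xi> = 0" if z: "Theta x \<xi> = 0" for \<xi>
  proof -
    have r0: "rpart j (tc (Pol \<xi> j) (Y j x) (deg i)) = 0" for i j
      using z by (simp add: Theta_def vec_eq_iff)
    have t0: "tc (Pol \<xi> j) (Y j x) (deg i) = 0" for i j
    proof -
      have "norm (tc (Pol \<xi> j) (Y j x) (deg i)) \<le> \<bar>rpart j (tc (Pol \<xi> j) (Y j x) (deg i))\<bar>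
          + \<bar>rpart (\<kappa> j) (tc (Pol \<xi> (\<kappa> j)) (Y (\<kappa> j) x) (deg i))\<bar>"
        by (rule norm_le_rpart[of "\<lambda>j. tc (Pol \<xi> j) (Y j x) (deg i)"]) (rule tc_kappa)
      then show ?thesis unfolding r0 by simp
    qed
    have t1: "tc (Pol \<xi> j) (Y j x) r = 0" if "r \<in> {1..n}" for j r
    proof -
      have "r \<in> range deg" using that deg by (simp add: bij_betw_def)
      then obtain i where "r = deg i" by blast
      then show ?thesis using t0 by simp
    qed
    have a0: "alpha \<xi> i j = 0" for i j
    proof -
      have "tc (Pol \<xi> j) (Y j x + - Y j x) (deg i)
          = (\<Sum>s\<le>n. tc (Pol \<xi> j) (Y j x) s * of_nat (s choose deg i) * (- Y j x) ^ (s - deg i))"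
        by (rule tc_shift[OF degree_Pol])
      also have "\<dots> = 0"
      proof (rule sum.neutral, rule ballI)
        fix s assume s: "s \<in> {..n}"
        show "tc (Pol \<xi> j) (Y j x) s * of_nat (s choose deg i) * (- Y j x) ^ (s - deg i) = 0"
        proof (cases "s = 0")
          \<comment> \<open>The coefficient of order 0 is not known to vanish, but it does not enter
            those of positive order.\<close>
          case True
          then show ?thesis using deg_range[of i] by (simp add: binomial_eq_0)
        next
          case False
          then show ?thesis using s t1[of s j] by simp
        qed
      qed
      finally have "tc (Pol \<xi> j) 0 (deg i) = 0" by simp
      then show ?thesis by (simp add: tc_def coeff_Pol_deg)
    qed
    have "complex_of_real (\<xi> $ i $ m) = 0" for i m
      using alpha_inverse[of \<xi> i m] by (simp add: a0)
    then show "\<xi> = 0" by (simp add: vec_eq_iff)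
  qed
  then show ?thesis using linear_Theta linear_injective_0 by blast
qed

lemma continuous_alpha: "continuous_on A (\<lambda>z. \<xi> z) \<Longrightarrow> continuous_on A (\<lambda>z. alpha (\<xi> z) i j)"
  unfolding alpha_def by (intro continuous_intros)

lemma continuous_coeff_Pol: "continuous_on A (\<lambda>z. \<xi> z) \<Longrightarrow> continuous_on A (\<lambda>z. coeff (Pol (\<xi> z) j) s)"
  unfolding coeff_Pol
proof (rule continuous_on_sum)
  fix i assume "continuous_on A (\<lambda>z. \<xi> z)"
  then show "continuous_on A (\<lambda>z. if deg i = s then alpha (\<xi> z) i j else 0)"
    by (cases "deg i = s") (simp_all add: continuous_alpha)
qed

text \<open>Compactness of the base points and of the unit sphere of frequencies makes injectivity
  quantitative, uniformly in \<open>x\<close>.\<close>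

lemma Theta_lower_bound: "\<exists>b>0. \<forall>x\<in>polybox R. \<forall>\<xi>. b * norm \<xi> \<le> norm (Theta x \<xi>)"
proof (cases "polybox R = {}")
  case True
  then show ?thesis by (intro exI[of _ 1]) auto
next
  case False
  let ?D = "polybox R \<times> sphere (0 :: real^'k^'n) 1"
  have sph: "sphere (0 :: real^'k^'n) 1 \<noteq> {}" by simp
  have "continuous_on ?D (\<lambda>z. norm (Theta (fst z) (snd z)))"
  proof (rule continuous_on_norm)
    have "continuous_on ?D (\<lambda>z. tc (Pol (snd z) j) (Y j (fst z)) r)" for j r
      unfolding tc_sum[OF degree_Pol]
      by (intro continuous_intros continuous_coeff_Pol continuous_on_compose2[OF continuous_on_Y]) auto
    then have "continuous_on ?D (\<lambda>z. rpart j (tc (Pol (snd z) j) (Y j (fst z)) r))" for j r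
      unfolding rpart_def by (cases "rp j = j") (simp_all add: continuous_on_Re continuous_on_Im)
    then show "continuous_on ?D (\<lambda>z. Theta (fst z) (snd z))"
      unfolding Theta_def by (intro continuous_on_vec_lambda)
  qed
  moreover have "compact ?D" by (intro compact_Times compact_polybox compact_sphere)
  moreover have "?D \<noteq> {}" using False sph by blast
  ultimately obtain z where z: "z \<in> ?D" "\<And>w. w \<in> ?D \<Longrightarrow> norm (Theta (fst z) (snd z)) \<le> norm (Theta (fst w) (snd w))"
    using continuous_attains_inf[of ?D "\<lambda>z. norm (Theta (fst z) (snd z))"] by blast
  define b where "b = norm (Theta (fst z) (snd z))"
  have "snd z \<noteq> 0" using z(1) by auto
  then have "Theta (fst z) (snd z) \<noteq> 0"
    using inj_Theta linear_Theta linear_injective_0 by blast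
  then have "0 < b" by (simp add: b_def)
  moreover have "b * norm \<xi> \<le> norm (Theta x \<xi>)" if x: "x \<in> polybox R" for x \<xi>
  proof (cases "\<xi> = 0")
    case False
    have "(x, \<xi> /\<^sub>R norm \<xi>) \<in> ?D" using x False by simp
    from z(2)[OF this] have "b \<le> norm (Theta x (\<xi> /\<^sub>R norm \<xi>))" by (simp add: b_def)
    also have "\<dots> = norm (Theta x \<xi>) / norm \<xi>"
      by (simp add: linear_scale[OF linear_Theta] divide_inverse mult.commute)
    finally show ?thesis using False by (simp add: pos_le_divide_eq)
  qed simp
  ultimately show ?thesis by blast
qed

lemma sum_deg: "(\<Sum>i\<in>UNIV. real (deg i)) = real n * (real n + 1) / 2"
proof -
  have "(\<Sum>i\<in>UNIV. real (deg i)) = (\<Sum>r\<in>{1..n}. real r)" by (rule sum.reindex_bij_betw[OF deg])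
  also have "\<dots> = real n * (real n + 1) / 2" by (induction n) (auto simp: field_simps)
  finally show ?thesis .
qed

text \<open>The degrees add up to \<open>n * (n + 1) / 2\<close>, so the exponent \<open>s\<close>
  splits into shares \<open>(1 + \<eta>) * deg i\<close>, each of which yields integrable decay in
  one entry of \<open>Theta x \<xi>\<close>. The change of variables leaves an integral free of
  \<open>x\<close>, and \<open>Theta_lower_bound\<close> controls its Jacobian factor.\<close>

lemma height_integral_upper:
  assumes \<eta>: "0 < \<eta>" and s: "s = (1 + \<eta>) * (real n * (real n + 1) / 2)"
  shows "\<exists>C<\<infinity>. \<forall>x\<in>polybox R. (\<integral>\<^sup>+\<xi>. ennreal (\<Prod>j\<in>UNIV. height n (Pol \<xi> j) (Y j x) powr - s) \<partial>lborel) \<le> C"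
proof -
  obtain b where b: "0 < b" "\<And>x \<xi>. x \<in> polybox R \<Longrightarrow> b * norm \<xi> \<le> norm (Theta x \<xi>)"
    using Theta_lower_bound by blast
  define I where "I = (\<integral>\<^sup>+\<xi>. (\<Prod>i\<in>UNIV. \<Prod>j\<in>UNIV. ennreal ((1 + \<bar>(\<xi>::real^'k^'n) $ i $ j\<bar>) powr - (1 + \<eta>))) \<partial>lborel)"
  have I: "I < \<infinity>" unfolding I_def by (rule nn_integral_matrix_decay_finite) (use \<eta> in simp)
  define C0 where "C0 = measure lborel (cball (0::real^'k^'n) (1 / b)) / measure lborel (cball (0::real^'k^'n) 1)"
  have "(\<integral>\<^sup>+\<xi>. ennreal (\<Prod>j\<in>UNIV. height n (Pol \<xi> j) (Y j x) powr - s) \<partial>lborel) \<le> ennreal C0 * I"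
    if x: "x \<in> polybox R" for x
  proof -
    define g where "g \<xi> = (\<Prod>i\<in>UNIV. \<Prod>j\<in>UNIV. ennreal ((1 + \<bar>(\<xi>::real^'k^'n) $ i $ j\<bar>) powr - (1 + \<eta>)))" for \<xi>
    have g: "g \<in> borel_measurable borel"
    proof -
      have [measurable]: "(\<lambda>x :: real^'k^'n. x $ i $ j) \<in> borel_measurable borel" for i j
        by (intro borel_measurable_continuous_onI continuous_intros)
      show ?thesis unfolding g_def by measurable
    qed
    have pw: "ennreal (\<Prod>j\<in>UNIV. height n (Pol \<xi> j) (Y j x) powr - s) \<le> g (Theta x \<xi>)" for \<xi>
    proof -
      have "(\<Prod>j\<in>UNIV. height n (Pol \<xi> j) (Y j x) powr - s)
          \<le> (\<Prod>j\<in>UNIV. \<Prod>i\<in>UNIV. (1 + \<bar>Theta x \<xi> $ i $ j\<bar>) powr - (1 + \<eta>))"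
      proof (rule prod_mono, rule conjI)
        fix j
        define h where "h = height n (Pol \<xi> j) (Y j x)"
        have h: "1 \<le> h" unfolding h_def by (rule height_ge_1)
        have "- s = (\<Sum>i\<in>UNIV. - ((1 + \<eta>) * real (deg i)))"
          by (simp add: s sum_negf sum_distrib_left[symmetric] sum_deg)
        then have "h powr - s = (\<Prod>i\<in>UNIV. h powr - ((1 + \<eta>) * real (deg i)))"
          using h by (simp add: powr_sum)
        also have "\<dots> \<le> (\<Prod>i\<in>UNIV. (1 + \<bar>Theta x \<xi> $ i $ j\<bar>) powr - (1 + \<eta>))"
        proof (rule prod_mono, rule conjI)
          fix i
          have "h powr - ((1 + \<eta>) * real (deg i)) \<le> (1 + norm (tc (Pol \<xi> j) (Y j x) (deg i))) powr - (1 + \<eta>)"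
            unfolding h_def by (rule height_powr_le[OF deg_range]) (use \<eta> in simp)
          also have "\<dots> \<le> (1 + \<bar>Theta x \<xi> $ i $ j\<bar>) powr - (1 + \<eta>)"
            using \<eta> abs_rpart_le by (intro powr_mono2') (auto simp: Theta_def)
          finally show "h powr - ((1 + \<eta>) * real (deg i)) \<le> (1 + \<bar>Theta x \<xi> $ i $ j\<bar>) powr - (1 + \<eta>)" .
        qed simp
        finally show "height n (Pol \<xi> j) (Y j x) powr - s \<le> (\<Prod>i\<in>UNIV. (1 + \<bar>Theta x \<xi> $ i $ j\<bar>) powr - (1 + \<eta>))"
          by (simp add: h_def)
      qed simp
      also have "\<dots> = (\<Prod>i\<in>UNIV. \<Prod>j\<in>UNIV. (1 + \<bar>Theta x \<xi> $ i $ j\<bar>) powr - (1 + \<eta>))"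
        by (rule prod.swap)
      finally show ?thesis unfolding g_def by (simp add: prod_ennreal prod_nonneg ennreal_leI)
    qed
    define c where "c = measure lborel (Theta x -` cball 0 1) / measure lborel (cball (0::real^'k^'n) 1)"
    have "(\<integral>\<^sup>+\<xi>. ennreal (\<Prod>j\<in>UNIV. height n (Pol \<xi> j) (Y j x) powr - s) \<partial>lborel) \<le> (\<integral>\<^sup>+\<xi>. g (Theta x \<xi>) \<partial>lborel)"
      using pw by (rule nn_integral_mono)
    also have "\<dots> = ennreal c * I"
      unfolding I_def g_def[symmetric] c_def by (rule lborel_linear_scaling(3)[OF linear_Theta inj_Theta g])
    also have "\<dots> \<le> ennreal C0 * I"
    proof (rule mult_right_mono[OF ennreal_leI])
      have sub: "Theta x -` cball 0 1 \<subseteq> cball 0 (1 / b)"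
      proof
        fix \<xi> assume "\<xi> \<in> Theta x -` cball 0 1"
        then have "b * norm \<xi> \<le> 1" using b(2)[OF x, of \<xi>] by simp
        then show "\<xi> \<in> cball 0 (1 / b)" using b(1) by (simp add: pos_le_divide_eq mult.commute)
      qed
      have "Theta x -` cball 0 1 \<in> sets borel"
      proof -
        have "Theta x \<in> borel_measurable borel"
          using linear_continuous_on[OF linear_linear[THEN iffD2, OF linear_Theta]]
          by (intro borel_measurable_continuous_onI) simp
        from measurable_sets[OF this, of "cball 0 1"] show ?thesis by simp
      qed
      then have "measure lborel (Theta x -` cball 0 1) \<le> measure lborel (cball (0::real^'k^'n) (1 / b))"
        using sub emeasure_bounded_finite[OF bounded_cball, of "0 :: real^'k^'n" "1 / b"]
        by (intro measure_mono_fmeasurable) (auto simp: fmeasurable_def)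
      then show "c \<le> C0" unfolding c_def C0_def by (intro divide_right_mono) auto
    qed simp
    finally show ?thesis .
  qed
  moreover have "ennreal C0 * I < \<infinity>" using I by (simp add: ennreal_mult_less_top)
  ultimately show ?thesis by blast
qed

end

section \<open>Integrability of the extension operator\<close>

context conj_frame begin

lemma D_sum:
  assumes "finite I" "\<And>i. i \<in> I \<Longrightarrow> g i differentiable at x"
  shows "(\<lambda>x. \<Sum>i\<in>I. g i x) differentiable at x" "D j (\<lambda>x. \<Sum>i\<in>I. g i x) x = (\<Sum>i\<in>I. D j (g i) x)"
proof -
  have "(\<lambda>x. \<Sum>i\<in>I. g i x) differentiable at x \<and> D j (\<lambda>x. \<Sum>i\<in>I. g i x) x = (\<Sum>i\<in>I. D j (g i) x)"
    using assms
  proof (induction I rule: finite_induct)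
    case (insert i I)
    then show ?case using D_add[of "g i" x "\<lambda>x. \<Sum>i\<in>I. g i x" j] by simp
  qed simp
  then show "(\<lambda>x. \<Sum>i\<in>I. g i x) differentiable at x" "D j (\<lambda>x. \<Sum>i\<in>I. g i x) x = (\<Sum>i\<in>I. D j (g i) x)"
    by auto
qed

end

lemma continuous_on_mpoly_eval: "continuous_on A (\<lambda>x. mpoly_eval p (\<lambda>m. (x :: real^'k::finite) $ m))"
  unfolding mpoly_eval_def by (intro continuous_intros)

lemma continuous_on_power_map: "continuous_on A (power_map deg Q)"
  unfolding power_map_def by (intro continuous_on_vec_lambda continuous_on_mpoly_eval)

context conj_frame_phase begin

text \<open>The hypothesis is the product rule for characters: it turns the polynomials
  \<open>Q\<close> into powers of \<open>Y j\<close>. Inverting with \<open>T\<close> then separates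
  the phase.\<close>

lemma phase_eq:
  assumes Q: "\<And>l j x. l \<in> {1..n} \<Longrightarrow> (\<Sum>m\<in>UNIV. S j m * of_real (mpoly_eval (Q l m) (\<lambda>m. x $ m))) = Y j x ^ l"
  shows "complex_of_real (\<xi> \<bullet> power_map deg Q x) = (\<Sum>j\<in>UNIV. poly (Pol \<xi> j) (Y j x))"
proof -
  have q: "complex_of_real (mpoly_eval (Q (deg i) m) (\<lambda>m. x $ m)) = (\<Sum>j\<in>UNIV. T m j * Y j x ^ deg i)" for i m
  proof -
    define v :: "real^'k" where "v = (\<chi> m. mpoly_eval (Q (deg i) m) (\<lambda>m. x $ m))"
    have "Y j v = Y j x ^ deg i" for j
      unfolding Y_def[of j v] using Q[OF deg_range[of i], of j x] by (simp add: v_def)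
    then have "(\<Sum>j\<in>UNIV. T m j * Y j x ^ deg i) = of_real (v $ m)"
      using Y_inverse[of m v] by simp
    then show ?thesis by (simp add: v_def)
  qed
  have "complex_of_real (\<xi> \<bullet> power_map deg Q x)
      = (\<Sum>i\<in>UNIV. \<Sum>m\<in>UNIV. of_real (\<xi> $ i $ m) * of_real (mpoly_eval (Q (deg i) m) (\<lambda>m. x $ m)))"
    by (simp add: inner_vec_def power_map_def)
  also have "\<dots> = (\<Sum>i\<in>UNIV. \<Sum>j\<in>UNIV. alpha \<xi> i j * Y j x ^ deg i)"
    unfolding q alpha_def sum_distrib_left sum_distrib_right
    by (rule sum.cong[OF refl], subst sum.swap) (simp add: mult.assoc)
  also have "\<dots> = (\<Sum>j\<in>UNIV. poly (Pol \<xi> j) (Y j x))"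
    by (subst sum.swap) (simp add: Pol_def poly_sum poly_monom)
  finally show ?thesis .
qed

lemma in_Lp_extension:
  fixes \<psi> :: "real^'k \<Rightarrow> real"
  assumes Q: "\<And>l j x. l \<in> {1..n} \<Longrightarrow> (\<Sum>m\<in>UNIV. S j m * of_real (mpoly_eval (Q l m) (\<lambda>m. x $ m))) = Y j x ^ l"
    and n: "1 \<le> n" and \<psi>: "smooth \<psi>" "compactly_supported \<psi>"
    and q: "(q::real) > real n * (real n + 1) / 2 + 1"
  shows "in_Lp q (lebesgue :: (real^'k^'n) measure) (extension_operator deg Q \<psi> (\<lambda>_. 1))"
proof -
  define p0 :: real where "p0 = real n * (real n + 1) / 2"
  have p0: "1 \<le> p0" using n mult_mono[of 1 "real n" 2 "real n + 1"] by (simp add: p0_def)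
  \<comment> \<open>The surplus \<open>q - (p0 + 1)\<close> is halved: \<open>s + 1\<close> is the
    midpoint of the critical exponent and \<open>q\<close>, and \<open>\<epsilon>\<close> makes
    \<open>(1 - \<epsilon>) * q = s + 1\<close>. The other half makes \<open>\<eta>\<close>
    positive.\<close>
  define \<epsilon> where "\<epsilon> = (q - (p0 + 1)) / (2 * q)"
  define s where "s = (q + (p0 + 1)) / 2 - 1"
  define \<eta> where "\<eta> = s / p0 - 1"
  have qp: "p0 + 1 < q" using q by (simp add: p0_def)
  have q0: "0 < q" using qp p0 by simp
  have \<epsilon>: "0 < \<epsilon>" "\<epsilon> < 1" using qp p0 by (auto simp: \<epsilon>_def field_simps)
  have \<epsilon>q: "(1 - \<epsilon>) * q = s + 1" using q0 by (simp add: \<epsilon>_def s_def field_simps)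
  have "2 * (p0 + 1) < q + (p0 + 1)" using qp by simp
  then have "p0 < s" by (simp add: s_def field_simps)
  with p0 have s: "p0 < s" "0 < s" by simp_all
  have \<eta>: "0 < \<eta>" "s = (1 + \<eta>) * (real n * (real n + 1) / 2)"
    using s p0 by (auto simp: \<eta>_def p0_def[symmetric])
  define C\<psi> where "C\<psi> = closure {x. \<psi> x \<noteq> 0}"
  have C\<psi>: "compact C\<psi>" using \<psi>(2) by (simp add: compactly_supported_def C\<psi>_def)
  have supp_sub: "{x. \<psi> x \<noteq> 0} \<subseteq> C\<psi>"
    unfolding C\<psi>_def by (rule closure_subset)
  have td: "times_differentiable m \<psi>" for m using \<psi>(1) by (simp add: smooth_def)
  have c\<psi>: "continuous_on UNIV \<psi>" using td[of 0] by simp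
  have "\<exists>B. \<forall>x\<in>C\<psi>. norm (Y j x) \<le> B" for j
  proof -
    have "bounded (Y j ` C\<psi>)"
      by (intro compact_imp_bounded compact_continuous_image continuous_on_Y C\<psi>)
    then show ?thesis by (auto simp: bounded_iff)
  qed
  then obtain B where B: "\<And>j x. x \<in> C\<psi> \<Longrightarrow> norm (Y j x) \<le> B j" by metis
  \<comment> \<open>The summand 1 puts the support strictly inside, as the oscillatory bound works
    on open neighbourhoods.\<close>
  define R where "R = 1 + (\<Sum>j\<in>UNIV. \<bar>B j\<bar>)"
  have R: "0 < R" unfolding R_def by (intro add_pos_nonneg sum_nonneg) auto
  have YR: "norm (Y j x) < R" if "x \<in> C\<psi>" for j x
  proof -
    have "\<bar>B j\<bar> \<le> (\<Sum>j\<in>UNIV. \<bar>B j\<bar>)" by (rule member_le_sum) auto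
    then show ?thesis using B[OF that, of j] by (simp add: R_def)
  qed
  then have YR_sub: "C\<psi> \<subseteq> {x. \<forall>j. norm (Y j x) < R}" by blast
  define e where "e \<xi> x = exp (2 * of_real pi * \<i> * of_real (\<xi> \<bullet> power_map deg Q x))" for \<xi> x
  define E where "E \<xi> = (LINT x|lborel. e \<xi> x * of_real (\<psi> x))" for \<xi>
  have ec: "continuous_on A (\<lambda>z. e (f z) (g z))" if "continuous_on A f" "continuous_on A g"
    for A :: "'z::topological_space set" and f g
    unfolding e_def using that
    by (intro continuous_intros continuous_on_compose2[OF continuous_on_power_map[of UNIV]]) auto
  \<comment> \<open>The integrand is Borel measurable, so completing the measure does not change the
    integral.\<close>
  have ext: "extension_operator deg Q \<psi> (\<lambda>_. 1) = E"
  proof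
    fix \<xi>
    have "continuous_on UNIV (\<lambda>x. e \<xi> x * of_real (\<psi> x))"
      by (intro continuous_intros ec continuous_on_of_real c\<psi>)
    then have "(\<lambda>x. e \<xi> x * of_real (\<psi> x)) \<in> borel_measurable lborel"
      by (simp add: borel_measurable_continuous_onI)
    then show "extension_operator deg Q \<psi> (\<lambda>_. 1) \<xi> = E \<xi>"
      unfolding extension_operator_def E_def by (simp add: e_def[symmetric] integral_completion)
  qed
  have E_meas: "E \<in> borel_measurable lborel"
  proof -
    have "continuous_on UNIV (\<lambda>z :: (real^'k^'n) \<times> (real^'k). e (fst z) (snd z) * of_real (\<psi> (snd z)))"
      by (intro continuous_intros ec continuous_on_of_real continuous_on_compose2[OF c\<psi>]) auto
    then have "(\<lambda>z :: (real^'k^'n) \<times> (real^'k). e (fst z) (snd z) * of_real (\<psi> (snd z))) \<in> borel_measurable (lborel \<Otimes>\<^sub>M lborel)"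
      by (simp add: lborel_prod borel_measurable_continuous_onI)
    then show ?thesis
      unfolding E_def by (intro lborel.borel_measurable_lebesgue_integral) (simp add: case_prod_beta')
  qed
  obtain C1 where C1: "0 \<le> C1" "\<forall>P e H. (\<forall>j. degree (P j) \<le> n) \<longrightarrow> (\<forall>x. e differentiable at x) \<longrightarrow>
     (\<forall>i x. D i e x = (2 * of_real pi * \<i> * poly (pderiv (P i)) (Y i x)) * e x) \<longrightarrow> (\<forall>x. norm (e x) = 1) \<longrightarrow>
     (\<forall>j. 1 \<le> H j \<and> H (\<kappa> j) = H j) \<longrightarrow>
     (\<forall>j x. (\<forall>i. norm (Y i x) \<le> R) \<longrightarrow> H j \<le> height n (P j) (Y j x)) \<longrightarrow>
     norm (LINT x|lborel. e x * of_real (\<psi> x)) \<le> C1 * (\<Prod>j\<in>UNIV. H j powr - (1 - \<epsilon>))"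
    using oscillatory_integral_bound[OF td C\<psi> supp_sub YR_sub R \<epsilon> n] by (elim exE conjE) (rule that)
  obtain C2 where C2: "0 \<le> C2" "\<forall>P. (\<forall>j. degree (P j) \<le> n) \<longrightarrow> (\<forall>j x. height n (P (\<kappa> j)) (Y (\<kappa> j) x) = height n (P j) (Y j x)) \<longrightarrow>
    (\<forall>x0\<in>polybox R. ennreal (\<Prod>j\<in>UNIV. height n (P j) (Y j x0) powr - (s + 1))
      \<le> ennreal C2 * (\<integral>\<^sup>+x. ennreal (\<Prod>j\<in>UNIV. height n (P j) (Y j x) powr - s) * indicator (polybox (R + 1)) x \<partial>lborel))"
    using height_integral_lower[OF s(2), of n R] by (elim exE conjE) (rule that)
  obtain C3 where C3: "C3 < \<infinity>"
    "\<And>x. x \<in> polybox (R + 1) \<Longrightarrow> (\<integral>\<^sup>+\<xi>. ennreal (\<Prod>j\<in>UNIV. height n (Pol \<xi> j) (Y j x) powr - s) \<partial>lborel) \<le> C3"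
    using height_integral_upper[OF \<eta>, of "R + 1"] by blast
  define \<Phi> where "\<Phi> \<xi> x = ennreal (\<Prod>j\<in>UNIV. height n (Pol \<xi> j) (Y j x) powr - s) * indicator (polybox (R + 1)) x" for \<xi> x
  \<comment> \<open>The heights at a common minimiser serve as the constants \<open>H j\<close> of
    the oscillatory bound.\<close>
  have E_bound: "norm (E \<xi>) \<le> C1 * (\<Prod>j\<in>UNIV. height n (Pol \<xi> j) (Y j x0) powr - (1 - \<epsilon>))"
    if x0: "x0 \<in> polybox R" "\<And>j x. x \<in> polybox R \<Longrightarrow> height n (Pol \<xi> j) (Y j x0) \<le> height n (Pol \<xi> j) (Y j x)" for \<xi> x0
  proof -
    have Yd: "Y j differentiable at x" for j x
      using Y_derivative by (auto simp: differentiable_def)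
    have pd: "(\<lambda>x. poly (Pol \<xi> j) (Y j x)) differentiable at x"
      "D i (\<lambda>x. poly (Pol \<xi> j) (Y j x)) x = (if i = j then poly (pderiv (Pol \<xi> i)) (Y i x) else 0)" for i j x
      using D_chain[of "Y j" x "poly (Pol \<xi> j)", OF Yd poly_DERIV] by (auto simp: D_Y)
    define F where "F x = (\<Sum>j\<in>UNIV. poly (Pol \<xi> j) (Y j x))" for x
    have F: "F differentiable at x" "D i F x = poly (pderiv (Pol \<xi> i)) (Y i x)" for i x
      unfolding F_def[abs_def] using D_sum[of UNIV "\<lambda>j x. poly (Pol \<xi> j) (Y j x)" x] pd by simp_all
    have "complex_of_real (\<xi> \<bullet> power_map deg Q x) = F x" for x
      unfolding F_def by (rule phase_eq[OF Q])
    then have eF: "e \<xi> = (\<lambda>x. exp (2 * of_real pi * \<i> * F x))"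
      by (simp add: e_def fun_eq_iff)
    have dexp: "((\<lambda>z. exp (2 * of_real pi * \<i> * z)) has_field_derivative
        (2 * of_real pi * \<i>) * exp (2 * of_real pi * \<i> * z)) (at z)" for z
      by (rule derivative_eq_intros refl | simp)+
    have ed: "e \<xi> differentiable at x" "D i (e \<xi>) x = (2 * of_real pi * \<i> * poly (pderiv (Pol \<xi> i)) (Y i x)) * e \<xi> x" for i x
      unfolding eF D_chain(2)[OF F(1) dexp] F(2) by (rule D_chain(1)[OF F(1) dexp]) (simp add: mult_ac)
    have e1: "norm (e \<xi> x) = 1" for x
      unfolding e_def by (simp add: norm_exp_eq_Re)
    show ?thesis unfolding E_def
      by (rule C1(2)[THEN spec[of _ "Pol \<xi>"], THEN spec[of _ "e \<xi>"],
            THEN spec[of _ "\<lambda>j. height n (Pol \<xi> j) (Y j x0)"], rule_format])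
        (use degree_Pol ed e1 height_ge_1 height_kappa x0(2) in \<open>auto simp: polybox_def\<close>)
  qed
  have pw: "ennreal (norm (E \<xi>) powr q) \<le> ennreal (C1 powr q * C2) * (\<integral>\<^sup>+x. \<Phi> \<xi> x \<partial>lborel)" for \<xi>
  proof -
    obtain x0 where x0: "x0 \<in> polybox R" "\<And>j x. x \<in> polybox R \<Longrightarrow> height n (Pol \<xi> j) (Y j x0) \<le> height n (Pol \<xi> j) (Y j x)"
      using common_minimizer[of "Pol \<xi>" n R, OF degree_Pol R height_kappa] by blast
    define h where "h j = height n (Pol \<xi> j) (Y j x0)" for j
    have h1: "1 \<le> h j" for j unfolding h_def by (rule height_ge_1)
    have "norm (E \<xi>) powr q \<le> (C1 * (\<Prod>j\<in>UNIV. h j powr - (1 - \<epsilon>))) powr q"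
      unfolding h_def using q0 by (intro powr_mono2 E_bound x0) auto
    also have "\<dots> = C1 powr q * (\<Prod>j\<in>UNIV. h j powr - (1 - \<epsilon>)) powr q"
      using C1(1) by (simp add: powr_mult prod_nonneg)
    also have "(\<Prod>j\<in>UNIV. h j powr - (1 - \<epsilon>)) powr q = (\<Prod>j\<in>UNIV. h j powr - (s + 1))"
    proof -
      have "- (1 - \<epsilon>) * q = - (s + 1)" by (simp only: mult_minus_left \<epsilon>q)
      then show ?thesis by (simp only: prod_powr_distrib[symmetric] powr_ge_zero powr_powr)
    qed
    finally have "ennreal (norm (E \<xi>) powr q) \<le> ennreal (C1 powr q) * ennreal (\<Prod>j\<in>UNIV. h j powr - (s + 1))"
      by (simp add: ennreal_mult[symmetric] ennreal_leI prod_nonneg)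
    also have "\<dots> \<le> ennreal (C1 powr q) * (ennreal C2 * (\<integral>\<^sup>+x. \<Phi> \<xi> x \<partial>lborel))"
      unfolding h_def \<Phi>_def
      by (intro mult_left_mono C2(2)[THEN spec[of _ "Pol \<xi>"], rule_format] degree_Pol height_kappa x0(1)) auto
    finally show ?thesis using C2(1) by (simp add: ennreal_mult mult.assoc)
  qed
  have \<Phi>_meas: "(\<lambda>(\<xi>, x). \<Phi> \<xi> x) \<in> borel_measurable (lborel \<Otimes>\<^sub>M lborel)"
  proof -
    have "continuous_on UNIV (\<lambda>z :: (real^'k^'n) \<times> (real^'k). \<Prod>j\<in>UNIV. height n (Pol (fst z) j) (Y j (snd z)) powr - s)"
    proof (intro continuous_on_prod continuous_on_powr continuous_on_const)
      fix j
      show "continuous_on UNIV (\<lambda>z :: (real^'k^'n) \<times> (real^'k). height n (Pol (fst z) j) (Y j (snd z)))"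
        by (intro continuous_on_height degree_Pol continuous_coeff_Pol continuous_intros
            continuous_on_compose2[OF continuous_on_Y[of UNIV]]) auto
      show "\<forall>z\<in>UNIV. height n (Pol (fst (z :: (real^'k^'n) \<times> (real^'k))) j) (Y j (snd z)) \<noteq> 0"
        using height_ge_1 by (metis not_one_le_zero)
    qed
    then have 1: "(\<lambda>z :: (real^'k^'n) \<times> (real^'k). \<Prod>j\<in>UNIV. height n (Pol (fst z) j) (Y j (snd z)) powr - s) \<in> borel_measurable borel"
      by (rule borel_measurable_continuous_onI)
    have "closed (UNIV \<times> polybox (R + 1) :: ((real^'k^'n) \<times> (real^'k)) set)"
      using compact_polybox by (intro closed_Times) (auto intro: compact_imp_closed)
    then have 2: "(UNIV \<times> polybox (R + 1) :: ((real^'k^'n) \<times> (real^'k)) set) \<in> sets borel" by simp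
    have "(\<lambda>z :: (real^'k^'n) \<times> (real^'k). ennreal (\<Prod>j\<in>UNIV. height n (Pol (fst z) j) (Y j (snd z)) powr - s)
        * indicator (UNIV \<times> polybox (R + 1)) z) \<in> borel_measurable borel"
      using 1 2 by measurable
    moreover have "(\<lambda>(\<xi>, x). \<Phi> \<xi> x) = (\<lambda>z :: (real^'k^'n) \<times> (real^'k). ennreal (\<Prod>j\<in>UNIV. height n (Pol (fst z) j) (Y j (snd z)) powr - s)
        * indicator (UNIV \<times> polybox (R + 1)) z)"
      by (auto simp: \<Phi>_def indicator_def fun_eq_iff)
    ultimately show ?thesis by (simp add: lborel_prod)
  qed
  have "(\<integral>\<^sup>+\<xi>. ennreal (norm (E \<xi>) powr q) \<partial>lborel) \<le> (\<integral>\<^sup>+\<xi>. ennreal (C1 powr q * C2) * (\<integral>\<^sup>+x. \<Phi> \<xi> x \<partial>lborel) \<partial>lborel)"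
    using pw by (rule nn_integral_mono)
  also have "\<dots> = ennreal (C1 powr q * C2) * (\<integral>\<^sup>+\<xi>. \<integral>\<^sup>+x. \<Phi> \<xi> x \<partial>lborel \<partial>lborel)"
    using lborel.borel_measurable_nn_integral[OF \<Phi>_meas] by (intro nn_integral_cmult)
  also have "(\<integral>\<^sup>+\<xi>. \<integral>\<^sup>+x. \<Phi> \<xi> x \<partial>lborel \<partial>lborel) = (\<integral>\<^sup>+x. \<integral>\<^sup>+\<xi>. \<Phi> \<xi> x \<partial>lborel \<partial>lborel)"
    using lborel_pair.Fubini'[OF \<Phi>_meas] by simp
  also have "\<dots> \<le> (\<integral>\<^sup>+x. C3 * indicator (polybox (R + 1)) x \<partial>lborel)"
  proof (rule nn_integral_mono)
    fix x
    show "(\<integral>\<^sup>+\<xi>. \<Phi> \<xi> x \<partial>lborel) \<le> C3 * indicator (polybox (R + 1)) x"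
      using C3(2)[of x] by (cases "x \<in> polybox (R + 1)") (auto simp: \<Phi>_def)
  qed
  also have "\<dots> = C3 * emeasure lborel (polybox (R + 1))"
    using compact_polybox[of "R + 1"] by (intro nn_integral_cmult_indicator) (auto simp: compact_imp_closed)
  finally have "(\<integral>\<^sup>+\<xi>. ennreal (norm (E \<xi>) powr q) \<partial>lborel)
      \<le> ennreal (C1 powr q * C2) * (C3 * emeasure lborel (polybox (R + 1)))"
    by (simp add: mult_left_mono)
  also have "\<dots> < \<infinity>"
    using C3(1) emeasure_bounded_finite[OF compact_imp_bounded[OF compact_polybox[of "R + 1"]]]
    by (simp add: ennreal_mult_less_top)
  finally have fin: "(\<integral>\<^sup>+\<xi>. ennreal (norm (E \<xi>) powr q) \<partial>lborel) < \<infinity>" .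
  have m: "(\<lambda>\<xi>. norm (E \<xi>) powr q) \<in> borel_measurable lborel" using E_meas by measurable
  show ?thesis unfolding in_Lp_def ext
  proof
    show "E \<in> borel_measurable lebesgue" using E_meas by (rule measurable_completion)
    have "integrable lborel (\<lambda>\<xi>. norm (E \<xi>) powr q)"
      using m fin by (intro integrableI_bounded) auto
    then show "integrable lebesgue (\<lambda>\<xi>. norm (E \<xi>) powr q)"
      using integrable_completion[OF m] by simp
  qed
qed

end

section \<open>From the number field to the frame\<close>

lemma complex_of_real_of_rat: "complex_of_real (of_rat r) = of_rat r"
  by (cases r) (simp add: of_rat_rat)

lemma of_rat_mpoly_eval: "(of_rat (mpoly_eval p q) :: 'b::field_char_0) = mpoly_eval p (\<lambda>m. of_rat (q m))"
  by (simp add: mpoly_eval_def of_rat_sum of_rat_mult of_rat_prod of_rat_power)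

lemma rational_points_dense: "closure {x :: real^'k::finite. \<exists>q. \<forall>m. x $ m = of_rat (q m)} = UNIV"
proof -
  have "(\<Union>f\<in>Basis \<rightarrow> \<rat>. {\<Sum>i\<in>Basis. f i *\<^sub>R i}) \<subseteq> {x :: real^'k. \<exists>q. \<forall>m. x $ m = of_rat (q m)}"
  proof safe
    fix f :: "real^'k \<Rightarrow> real" assume f: "f \<in> Basis \<rightarrow> \<rat>"
    have "\<exists>r. (\<Sum>i\<in>Basis. f i *\<^sub>R i) $ m = of_rat r" for m
    proof -
      have b: "axis m 1 \<in> (Basis :: (real^'k) set)" by (simp add: axis_in_Basis_iff)
      have "(\<Sum>i\<in>Basis. f i *\<^sub>R i) $ m = (\<Sum>i\<in>Basis. f i *\<^sub>R i) \<bullet> axis m 1"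
        by (simp add: inner_axis)
      also have "\<dots> = f (axis m 1)" using b by simp
      finally have "(\<Sum>i\<in>Basis. f i *\<^sub>R i) $ m = f (axis m 1)" .
      moreover have "f (axis m 1) \<in> \<rat>" using f b by blast
      ultimately show ?thesis by (metis Rats_cases)
    qed
    then show "\<exists>q. \<forall>m. (\<Sum>i\<in>Basis. f i *\<^sub>R i) $ m = of_rat (q m)" by metis
  qed
  from closure_mono[OF this] show ?thesis unfolding closure_rational_coordinates by blast
qed

context number_field_basis begin

lemma chars_power:
  assumes "s \<in> chars" "x \<in> K"
  shows "lin s (x ^ l) = lin s x ^ l"
  using assms by (induction l) (auto simp: chars_def mem_power)

text \<open>The polynomials are given through their values at rational points, where the identity is
  the multiplicativity of the character. Both sides are continuous and rational points are
  dense.\<close>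

lemma chars_power_coordinates:
  assumes Q: "power_coordinates \<omega> n Q" and l: "l \<in> {1..n}" and s: "s \<in> chars"
  shows "(\<Sum>m\<in>UNIV. s $ m * of_real (mpoly_eval (Q l m) (\<lambda>m. x $ m))) = (\<Sum>m\<in>UNIV. s $ m * of_real (x $ m)) ^ l"
proof -
  define A where "A = {x :: real^'k. (\<Sum>m\<in>UNIV. s $ m * of_real (mpoly_eval (Q l m) (\<lambda>m. x $ m))) = (\<Sum>m\<in>UNIV. s $ m * of_real (x $ m)) ^ l}"
  have "closed A" unfolding A_def
    by (intro closed_Collect_eq continuous_intros continuous_on_of_real continuous_on_mpoly_eval)
  moreover have "{x. \<exists>q. \<forall>m. x $ m = of_rat (q m)} \<subseteq> A"
  proof safe
    fix x :: "real^'k" and q assume xq: "\<forall>m. x $ m = of_rat (q m)"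
    define X where "X = (\<Sum>j\<in>UNIV. of_rat (q j) * \<omega> j)"
    have X: "X \<in> K" unfolding X_def by (rule comb_mem)
    have "X ^ l = (\<Sum>j\<in>UNIV. of_rat (mpoly_eval (Q l j) q) * \<omega> j)"
      using Q l by (simp add: power_coordinates_def X_def)
    then have "coord (X ^ l) = (\<lambda>j. mpoly_eval (Q l j) q)" by (rule coord_unique)
    then have "lin s (X ^ l) = (\<Sum>m\<in>UNIV. s $ m * of_rat (mpoly_eval (Q l m) q))" by (simp add: lin_def)
    moreover have "lin s X = (\<Sum>m\<in>UNIV. s $ m * of_rat (q m))"
      using coord_unique[of X q] by (simp add: lin_def X_def)
    ultimately have "(\<Sum>m\<in>UNIV. s $ m * of_rat (mpoly_eval (Q l m) q)) = (\<Sum>m\<in>UNIV. s $ m * of_rat (q m)) ^ l"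
      using chars_power[OF s X, of l] by simp
    moreover have me: "mpoly_eval (Q l m) (\<lambda>m. x $ m) = of_rat (mpoly_eval (Q l m) q)" for m
      using xq by (simp add: of_rat_mpoly_eval)
    ultimately show "x \<in> A"
      unfolding A_def mem_Collect_eq me using xq by (simp add: complex_of_real_of_rat)
  qed
  ultimately have "A = UNIV" using closure_minimal rational_points_dense by blast
  then show ?thesis unfolding A_def by blast
qed

text \<open>There are as many characters as indices, so they are the rows of a square matrix,
  invertible because they span. Conjugation maps characters to characters and hence permutes the
  rows.\<close>

lemma conj_frame_exists:
  "\<exists>S T \<kappa>. conj_frame S T \<kappa> \<and> (\<forall>j :: 'k. (\<chi> m. S j m) \<in> chars)"
proof -
  obtain s :: "'k \<Rightarrow> complex^'k" where s: "bij_betw s UNIV chars"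
    using finite_same_card_bij[of "UNIV :: 'k set" chars] card_chars by auto
  define A :: "complex^'k^'k" where "A = (\<chi> j. s j)"
  have "rows A = chars" using s by (auto simp: rows_def row_def A_def bij_betw_def)
  then obtain B where B: "B ** A = mat 1"
    using matrix_left_invertible_span_rows_gen[of A] chars_span by auto
  then have B': "A ** B = mat 1" using matrix_left_right_inverse by blast
  have "\<exists>i. \<forall>m. s i $ m = cnj (s j $ m)" for j
  proof -
    have "(\<chi> m. cnj (s j $ m)) \<in> chars" using cnj_chars s by (auto simp: bij_betw_def)
    then have "(\<chi> m. cnj (s j $ m)) \<in> range s" using s by (simp add: bij_betw_def)
    then obtain i where "s i = (\<chi> m. cnj (s j $ m))" by (metis imageE)
    then show ?thesis by (intro exI[of _ i]) simp
  qed
  then obtain \<kappa> where \<kappa>: "\<And>j m. s (\<kappa> j) $ m = cnj (s j $ m)" by metis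
  have "conj_frame (\<lambda>j m. s j $ m) (\<lambda>m j. B $ m $ j) \<kappa>"
  proof
    fix i j
    have "(A ** B) $ i $ j = (mat 1 :: complex^'k^'k) $ i $ j" by (simp add: B')
    then show "(\<Sum>m\<in>UNIV. s i $ m * B $ m $ j) = (if i = j then 1 else 0)"
      by (simp add: matrix_matrix_mult_def mat_def A_def)
    have "(B ** A) $ i $ j = (mat 1 :: complex^'k^'k) $ i $ j" by (simp add: B)
    then show "(\<Sum>m\<in>UNIV. B $ i $ m * s m $ j) = (if i = j then 1 else 0)"
      by (simp add: matrix_matrix_mult_def mat_def A_def)
  qed (rule \<kappa>)
  moreover have "(\<chi> m. s j $ m) \<in> chars" for j using s by (auto simp: bij_betw_def)
  ultimately show ?thesis by blast
qed

end

theorem theorem10p5: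
  fixes K :: "'a::field_char_0 set"
    and \<omega> :: "'k::finite \<Rightarrow> 'a"
    and n :: nat
    and deg :: "'n::finite \<Rightarrow> nat"
    and Q :: "nat \<Rightarrow> 'k \<Rightarrow> 'k rat_mpoly"
    and \<psi> :: "real^'k \<Rightarrow> real"
    and q :: real
  assumes "number_field K"
    and "rat_basis K \<omega>"
    and "n \<ge> 1"
    and "bij_betw deg UNIV {1..n}"
    and "power_coordinates \<omega> n Q"
    and "smooth \<psi>"
    and "compactly_supported \<psi>"
    and "\<And>x. norm x \<le> 2 \<Longrightarrow> \<psi> x = 1"
    and "q > real n * (real n + 1) / 2 + 1"
  shows "in_Lp q (lebesgue :: (real^'k^'n) measure) (extension_operator deg Q \<psi> (\<lambda>_. 1))"
proof -
  interpret number_field_basis K \<omega> by unfold_locales (rule assms)+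
  obtain S T \<kappa> where frame: "conj_frame S T \<kappa>" and S: "\<And>j :: 'k. (\<chi> m. S j m) \<in> chars"
    using conj_frame_exists by blast
  interpret conj_frame S T \<kappa> by (rule frame)
  interpret conj_frame_phase S T \<kappa> deg n by unfold_locales (rule assms)
  show ?thesis
  proof (rule in_Lp_extension)
    fix l j and x :: "real^'k" assume "l \<in> {1..n}"
    from chars_power_coordinates[OF assms(5) this S[of j], of x]
    show "(\<Sum>m\<in>UNIV. S j m * of_real (mpoly_eval (Q l m) (\<lambda>m. x $ m))) = Y j x ^ l"
      by (simp add: Y_def)
  qed (use assms in auto)
qed

end
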